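(* Assume that the graph matrix $A$ has no eigenvalue of modulus one. Then the trace of the heat kernel has the following expansion as $t\to0^+$: $$\mathrm{Tr}(e^{-tD^2})=\sum_{j:|\lambda_j|>1}P_j\Big(\frac1{-\log\rho}\frac{d}{ds_j}\Big)\,\mathfrak p_{-2\log\rho,\,-s_j\log\rho}(-\log t)\;t^{-s_j/2}+h(t),$$ where $s_j=\frac{\log\lambda_j}{-\log\rho}$ and $h$ is a smooth function around $0$ (the differential operator acts on the whole product to its right). The leading term of the expansion comes from the Perron-Frobenius eigenvalue, and one has the equivalent $$\mathrm{Tr}(e^{-tD^2})\ \stackrel{t\to0}{\sim}\ C^1_{\hat{\mathcal H}}\;\mathfrak p_{-2\log\rho,\,\log\lambda_{PF}}(-\log t)\;t^{-s_0/2},$$ where $s_0=\frac{\log\lambda_{PF}}{-\log\rho}$ is the spectral dimension (the abscissa of convergence of $\mathrm{Tr}(|D|^{-s})$).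
   Context: Data. $\mathcal G=(\mathcal V,\mathcal E)$ is a finite oriented graph with source and range maps $s,r:\mathcal E\to\mathcal V$; its graph matrix $A$ has entries $A_{vw}=$ number of edges with source $v$ and range $w$, and is assumed primitive (some power of $A$ has only positive entries); $\lambda_{PF}$ is its Perron-Frobenius eigenvalue. $l^*\in\mathcal E$ is a distinguished one-edge loop. $\hat\tau:\mathcal E\to\mathcal E$ satisfies: if $r(\varepsilon)$ is the vertex of $l^*$ then $\hat\tau(\varepsilon)=l^*$; otherwise $\hat\tau(\varepsilon)$ starts at $r(\varepsilon)$ and its range is closer to the vertex of $l^*$ (combinatorial graph metric, non-loop edges having length 1 and loop edges length 0). $\hat{\mathcal H}$ is a symmetric subset of $\{(\varepsilon,\varepsilon')\in\mathcal E\times\mathcal E:\varepsilon\ne\varepsilon',\ s(\varepsilon)=s(\varepsilon')\}$; for $h=(\varepsilon,\varepsilon')\in\hat{\mathcal H}$ put $s^2(h)=s(\varepsilon)\in\mathcal V$. Finally $\rho\in(0,1)$. Spectral triple. $\Pi_n$ is the set of paths $\varepsilon_1\cdots\varepsilon_n$ of length $n$ ($r(\varepsilon_i)=s(\varepsilon_{i+1})$; $\Pi_0=\mathcal V$), and $\Pi_\infty$ the compact space of one-sided infinite paths. For $n\ge1$, $\tau:\Pi_n\to\Pi_\infty$ is $\tau(\varepsilon_1\cdots\varepsilon_n)=\varepsilon_1\cdots\varepsilon_n\hat\tau(\varepsilon_n)\hat\tau^2(\varepsilon_n)\cdots$. For $n\ge 1$, $E_n$ is the set of pairs $e=(\tau(\eta\varepsilon),\tau(\eta\varepsilon'))$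 with $\eta\in\Pi_{n-1}$ ending at $s(\varepsilon)$ and $(\varepsilon,\varepsilon')\in\hat{\mathcal H}$; $s(e)$ and $r(e)$ are the first and second components, $e^{op}$ is the reversed pair, and $E=\bigcup_{n\ge1}E_n$ (a disjoint union). The triple is $(C(\Pi_\infty),\ell^2(E),D)$ with $\pi(f)\varphi(e)=f(s(e))\varphi(e)$ and $D\varphi(e)=\rho^{-n}\varphi(e^{op})$ for $e\in E_n$. Notation. $\lambda_1=\lambda_{PF},\lambda_2,\dots,\lambda_p$ are the distinct eigenvalues of $A$ and $m_j$ is the size of the largest Jordan block of $A$ for $\lambda_j$. The $P_j$ are the polynomials, of degree at most $m_j-1$, such that $\#E_n=\sum_{j=1}^pP_j(n)\lambda_j^n$ for all sufficiently large $n$. $R,L$ are the right and left Perron-Frobenius eigenvectors of $A$, normalized by $\sum_vR_v=1$, $\sum_vR_vL_v=1$, and $C^1_{\hat{\mathcal H}}=\lambda_{PF}^{-1}\sum_{v\in\mathcal V,\,h\in\hat{\mathcal H}}R_vL_{s^2(h)}$ (so $P_1=C^1_{\hat{\mathcal H}}$ is constant). For $r>0$ and $\mathrm{Re}(a)>0$, $$\mathfrak p_{r,a}(\sigma)=\frac1r\sum_{k\in\mathbb Z}\Gamma\Big(\frac{a+2\pi ik}{r}\Big)e^{2\pi ik\sigma/r},$$ a periodic function of period $r$. $f\stackrel{t\to0}{\sim}g$ means $|f-g|=o(|g|)$ as $t\to0^+$.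
   Formalization: Smoothness of h at 0 fails if some λ_j with 0<|λ_j|<1 has P_j≠0; proved instead: h is smooth for t>0 and C^k around 0 for each k such that |λ_j|<ρ^{2k} for all |λ_j|<1 with P_j≠0. The spectral dimension claim assumes Ĥ nonempty. *)

theory Defs
  imports
    "HOL-Analysis.Analysis"
    "HOL-Library.Landau_Symbols"
    "Graph_Theory.Shortest_Path"
    "Jordan_Normal_Form.Spectral_Radius"
begin

section \<open>The graph and its matrix\<close>

definition edge_count :: "('v, 'e) pre_digraph \<Rightarrow> 'v \<Rightarrow> 'v \<Rightarrow> nat" where
  "edge_count G v w = card {\<epsilon> \<in> arcs G. tail G \<epsilon> = v \<and> head G \<epsilon> = w}"

text \<open>The list \<open>vs\<close> enumerates the vertices without repetition; it only serves to
  index the rows and columns of the graph matrix by natural numbers.\<close>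

definition graph_matrix :: "('v, 'e) pre_digraph \<Rightarrow> 'v list \<Rightarrow> 'a :: semiring_1 mat" where
  "graph_matrix G vs =
     Matrix.mat (length vs) (length vs) (\<lambda>(i, j). of_nat (edge_count G (vs ! i) (vs ! j)))"

definition vertex_vec :: "'v list \<Rightarrow> ('v \<Rightarrow> 'a) \<Rightarrow> 'a Matrix.vec" where
  "vertex_vec vs f = Matrix.vec (length vs) (\<lambda>i. f (vs ! i))"

definition primitive_mat :: "real mat \<Rightarrow> bool" where
  "primitive_mat A \<longleftrightarrow>
     (\<exists>k>0. \<forall>i<dim_row A. \<forall>j<dim_col A. (A ^\<^sub>m k) $$ (i, j) > 0)"

definition max_jordan_block :: "complex mat \<Rightarrow> complex \<Rightarrow> nat" where
  "max_jordan_block A \<mu> = Max {k. \<exists>blocks. jordan_nf A blocks \<and> (k, \<mu>) \<in> set blocks}"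

text \<open>For a primitive matrix the Perron--Frobenius eigenvalue is the eigenvalue of largest modulus.\<close>

definition lambda_PF :: "('v, 'e) pre_digraph \<Rightarrow> 'v list \<Rightarrow> real" where
  "lambda_PF G vs = spectral_radius (graph_matrix G vs)"

definition PF_eigenvectors ::
    "('v, 'e) pre_digraph \<Rightarrow> 'v list \<Rightarrow> ('v \<Rightarrow> real) \<Rightarrow> ('v \<Rightarrow> real) \<Rightarrow> bool" where
  "PF_eigenvectors G vs R L \<longleftrightarrow>
     (\<forall>v\<in>verts G. R v > 0 \<and> L v > 0) \<and>
     eigenvector (graph_matrix G vs) (vertex_vec vs R) (lambda_PF G vs) \<and>
     eigenvector (transpose_mat (graph_matrix G vs)) (vertex_vec vs L) (lambda_PF G vs) \<and>
     (\<Sum>v\<in>verts G. R v) = 1 \<and> (\<Sum>v\<in>verts G. R v * L v) = 1"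


section \<open>Choice of infinite continuations, and horizontal edges\<close>

text \<open>Distance in the oriented graph, measured along oriented paths.\<close>

definition graph_dist :: "('v, 'e) pre_digraph \<Rightarrow> 'v \<Rightarrow> 'v \<Rightarrow> ereal" where
  "graph_dist G = wf_digraph.\<mu> G (\<lambda>\<epsilon>. if tail G \<epsilon> = head G \<epsilon> then 0 else 1)"

definition is_continuation :: "('v, 'e) pre_digraph \<Rightarrow> 'e \<Rightarrow> ('e \<Rightarrow> 'e) \<Rightarrow> bool" where
  "is_continuation G l \<tau>h \<longleftrightarrow>
     (\<forall>\<epsilon>\<in>arcs G.
        if head G \<epsilon> = head G l then \<tau>h \<epsilon> = l
        else \<tau>h \<epsilon> \<in> arcs G \<and> tail G (\<tau>h \<epsilon>) = head G \<epsilon> \<and>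
             graph_dist G (head G (\<tau>h \<epsilon>)) (head G l) < graph_dist G (head G \<epsilon>) (head G l))"

definition horizontal_pairs :: "('v, 'e) pre_digraph \<Rightarrow> ('e \<times> 'e) set" where
  "horizontal_pairs G =
     {(\<epsilon>, \<epsilon>'). \<epsilon> \<in> arcs G \<and> \<epsilon>' \<in> arcs G \<and> \<epsilon> \<noteq> \<epsilon>' \<and> tail G \<epsilon> = tail G \<epsilon>'}"

text \<open>Infinite paths are sequences of edges, indexed from \<open>0\<close>.\<close>

definition extend_path :: "('e \<Rightarrow> 'e) \<Rightarrow> 'e list \<Rightarrow> nat \<Rightarrow> 'e" where
  "extend_path \<tau>h p i =
     (if i < length p then p ! i else (\<tau>h ^^ (i + 1 - length p)) (last p))"

type_synonym 'e path_pair = "(nat \<Rightarrow> 'e) \<times> (nat \<Rightarrow> 'e)"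

text \<open>The condition \<open>length \<eta> + 1 = n\<close> makes the set for \<open>n = 0\<close> empty.
  For \<open>n = 1\<close> the path \<open>\<eta>\<close> is the trivial path at the source of \<open>\<epsilon>\<close>.\<close>

definition edges_at ::
    "('v, 'e) pre_digraph \<Rightarrow> ('e \<Rightarrow> 'e) \<Rightarrow> ('e \<times> 'e) set \<Rightarrow> nat \<Rightarrow> 'e path_pair set" where
  "edges_at G \<tau>h H n =
     {(extend_path \<tau>h (\<eta> @ [\<epsilon>]), extend_path \<tau>h (\<eta> @ [\<epsilon>'])) | \<eta> \<epsilon> \<epsilon>'.
        (\<epsilon>, \<epsilon>') \<in> H \<and> length \<eta> + 1 = n \<and> (\<exists>u. pre_digraph.awalk G u \<eta> (tail G \<epsilon>))}"

definition all_edges ::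
    "('v, 'e) pre_digraph \<Rightarrow> ('e \<Rightarrow> 'e) \<Rightarrow> ('e \<times> 'e) set \<Rightarrow> 'e path_pair set" where
  "all_edges G \<tau>h H = (\<Union>n\<in>{1..}. edges_at G \<tau>h H n)"

text \<open>Well defined for \<open>e\<close> in \<^const>\<open>all_edges\<close>: the two sequences of an element of
  \<open>edges_at G \<tau>h H n\<close> differ for the first time in their \<open>n\<close>-th letter.\<close>

definition edge_level ::
    "('v, 'e) pre_digraph \<Rightarrow> ('e \<Rightarrow> 'e) \<Rightarrow> ('e \<times> 'e) set \<Rightarrow> 'e path_pair \<Rightarrow> nat" where
  "edge_level G \<tau>h H e = (THE n. e \<in> edges_at G \<tau>h H n)"

definition C1 :: "('v, 'e) pre_digraph \<Rightarrow> 'v list \<Rightarrow> ('v \<Rightarrow> real) \<Rightarrow> ('v \<Rightarrow> real) \<Rightarrow>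
    ('e \<times> 'e) set \<Rightarrow> real" where
  "C1 G vs R L H =
     (1 / lambda_PF G vs) * (\<Sum>v\<in>verts G. \<Sum>h\<in>H. R v * L (tail G (fst h)))"


section \<open>Operators on square-summable functions\<close>

text \<open>Elements of \<open>\<ell>\<^sup>2(X)\<close> are represented by functions vanishing outside \<open>X\<close>.\<close>

definition ell2 :: "'x set \<Rightarrow> ('x \<Rightarrow> complex) set" where
  "ell2 X = {\<phi>. (\<forall>x. x \<notin> X \<longrightarrow> \<phi> x = 0) \<and> (\<lambda>x. (cmod (\<phi> x))\<^sup>2) summable_on X}"

definition ell2_inner :: "'x set \<Rightarrow> ('x \<Rightarrow> complex) \<Rightarrow> ('x \<Rightarrow> complex) \<Rightarrow> complex" where
  "ell2_inner X \<phi> \<psi> = (\<Sum>\<^sub>\<infinity>x\<in>X. cnj (\<phi> x) * \<psi> x)"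

definition ell2_basis :: "'x \<Rightarrow> 'x \<Rightarrow> complex" where
  "ell2_basis x = (\<lambda>y. if y = x then 1 else 0)"

definition orth_proj ::
    "'x set \<Rightarrow> ('x \<Rightarrow> complex) set \<Rightarrow> ('x \<Rightarrow> complex) \<Rightarrow> 'x \<Rightarrow> complex" where
  "orth_proj X S \<phi> = (THE \<psi>. \<psi> \<in> S \<and> (\<forall>\<theta>\<in>S. ell2_inner X \<theta> (\<lambda>x. \<phi> x - \<psi> x) = 0))"

text \<open>An unbounded operator is given by its action on all functions and carries its maximal
  domain \<open>{\<phi> \<in> ell2 X. T \<phi> \<in> ell2 X}\<close>; eigenvectors lie in this domain automatically.\<close>

definition eigenspace ::
    "'x set \<Rightarrow> (('x \<Rightarrow> complex) \<Rightarrow> 'x \<Rightarrow> complex) \<Rightarrow> real \<Rightarrow> ('x \<Rightarrow> complex) set" where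
  "eigenspace X T \<mu> = {\<phi> \<in> ell2 X. T \<phi> = (\<lambda>x. of_real \<mu> * \<phi> x)}"

text \<open>The functional calculus \<open>f(T) = \<Sum>\<mu>. f(\<mu>) P\<^sub>\<mu>\<close> of a self-adjoint operator with pure
  point spectrum, \<open>P\<^sub>\<mu>\<close> being the orthogonal projection onto the eigenspace of \<open>\<mu>\<close>.\<close>

definition fun_calculus :: "'x set \<Rightarrow> (('x \<Rightarrow> complex) \<Rightarrow> 'x \<Rightarrow> complex) \<Rightarrow> (real \<Rightarrow> real) \<Rightarrow>
    ('x \<Rightarrow> complex) \<Rightarrow> 'x \<Rightarrow> complex" where
  "fun_calculus X T f \<phi> =
     (\<lambda>x. \<Sum>\<^sub>\<infinity>\<mu>\<in>{\<mu>. eigenspace X T \<mu> \<noteq> {\<lambda>_. 0}}. of_real (f \<mu>) * orth_proj X (eigenspace X T \<mu>) \<phi> x)"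

text \<open>Only used for positive operators, for which being of trace class means that this sum
  converges.\<close>

definition finite_trace :: "'x set \<Rightarrow> (('x \<Rightarrow> complex) \<Rightarrow> 'x \<Rightarrow> complex) \<Rightarrow> bool" where
  "finite_trace X T \<longleftrightarrow> (\<lambda>x. ell2_inner X (ell2_basis x) (T (ell2_basis x))) summable_on X"

definition op_trace :: "'x set \<Rightarrow> (('x \<Rightarrow> complex) \<Rightarrow> 'x \<Rightarrow> complex) \<Rightarrow> complex" where
  "op_trace X T = (\<Sum>\<^sub>\<infinity>x\<in>X. ell2_inner X (ell2_basis x) (T (ell2_basis x)))"


section \<open>The Dirac operator\<close>

definition dirac :: "('v, 'e) pre_digraph \<Rightarrow> ('e \<Rightarrow> 'e) \<Rightarrow> ('e \<times> 'e) set \<Rightarrow> real \<Rightarrow>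
    ('e path_pair \<Rightarrow> complex) \<Rightarrow> 'e path_pair \<Rightarrow> complex" where
  "dirac G \<tau>h H \<rho> \<phi> =
     (\<lambda>e. if e \<in> all_edges G \<tau>h H
          then of_real (inverse (\<rho> ^ edge_level G \<tau>h H e)) * \<phi> (prod.swap e) else 0)"

text \<open>\<open>exp(-tD\<^sup>2)\<close> and \<open>|D|\<^sup>-\<^sup>s\<close>\<close>

definition heat_op :: "('v, 'e) pre_digraph \<Rightarrow> ('e \<Rightarrow> 'e) \<Rightarrow> ('e \<times> 'e) set \<Rightarrow> real \<Rightarrow> real \<Rightarrow>
    ('e path_pair \<Rightarrow> complex) \<Rightarrow> 'e path_pair \<Rightarrow> complex" where
  "heat_op G \<tau>h H \<rho> t =
     fun_calculus (all_edges G \<tau>h H) (dirac G \<tau>h H \<rho>) (\<lambda>x. exp (- t * x\<^sup>2))"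

definition abs_dirac_power :: "('v, 'e) pre_digraph \<Rightarrow> ('e \<Rightarrow> 'e) \<Rightarrow> ('e \<times> 'e) set \<Rightarrow> real \<Rightarrow> real \<Rightarrow>
    ('e path_pair \<Rightarrow> complex) \<Rightarrow> 'e path_pair \<Rightarrow> complex" where
  "abs_dirac_power G \<tau>h H \<rho> s =
     fun_calculus (all_edges G \<tau>h H) (dirac G \<tau>h H \<rho>) (\<lambda>x. \<bar>x\<bar> powr (- s))"

definition spectral_dim :: "('v, 'e) pre_digraph \<Rightarrow> ('e \<Rightarrow> 'e) \<Rightarrow> ('e \<times> 'e) set \<Rightarrow> real \<Rightarrow> ereal" where
  "spectral_dim G \<tau>h H \<rho> =
     Inf {ereal s | s. finite_trace (all_edges G \<tau>h H) (abs_dirac_power G \<tau>h H \<rho> s)}"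


section \<open>Ingredients of the expansion\<close>

definition counting_polys :: "('v, 'e) pre_digraph \<Rightarrow> 'v list \<Rightarrow> ('e \<Rightarrow> 'e) \<Rightarrow> ('e \<times> 'e) set \<Rightarrow>
    (complex \<Rightarrow> complex poly) \<Rightarrow> bool" where
  "counting_polys G vs \<tau>h H P \<longleftrightarrow>
     (\<forall>\<mu>\<in>spectrum (graph_matrix G vs). degree (P \<mu>) \<le> max_jordan_block (graph_matrix G vs) \<mu> - 1) \<and>
     (\<forall>\<^sub>F n in sequentially. of_nat (card (edges_at G \<tau>h H n)) =
        (\<Sum>\<mu>\<in>spectrum (graph_matrix G vs). poly (P \<mu>) (of_nat n) * \<mu> ^ n))"

definition per :: "real \<Rightarrow> complex \<Rightarrow> real \<Rightarrow> complex" where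
  "per r a \<sigma> = (1 / of_real r) *
     (\<Sum>\<^sub>\<infinity>k\<in>(UNIV :: int set). Gamma ((a + 2 * pi * \<i> * of_int k) / of_real r)
        * exp (2 * pi * \<i> * of_int k * of_real \<sigma> / of_real r))"

text \<open>\<open>Q(c d/ds) F\<close>\<close>

definition poly_deriv :: "complex poly \<Rightarrow> complex \<Rightarrow> (complex \<Rightarrow> complex) \<Rightarrow> complex \<Rightarrow> complex" where
  "poly_deriv Q c F s = (\<Sum>i\<le>degree Q. coeff Q i * c ^ i * (deriv ^^ i) F s)"

definition Ck_on :: "nat \<Rightarrow> (real \<Rightarrow> complex) \<Rightarrow> real set \<Rightarrow> bool" where
  "Ck_on k f U \<longleftrightarrow>
     (\<exists>g. g 0 = f \<and> (\<forall>i<k. \<forall>x\<in>U. (g i has_vector_derivative g (Suc i) x) (at x)) \<and>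
          continuous_on U (g k))"

text \<open>Regularity of the remainder \<open>h\<close>. The eigenvalues \<open>\<mu>\<close> with \<open>0 < |\<mu>| < 1\<close> contribute series
  \<open>\<Sum>n. P\<^sub>\<mu>(n) \<mu>^n exp(-t \<rho>^(-2n))\<close> to \<open>h\<close>. These are smooth for \<open>t > 0\<close> and bounded near \<open>0\<close>, but
  if \<open>P\<^sub>\<mu>\<close> is not zero, their \<open>k\<close>-th derivatives stay continuous at \<open>0\<close> only as long as
  \<open>|\<mu>| < \<rho>^(2k)\<close>. So \<open>h\<close> is of class \<open>C\<^sup>k\<close> around \<open>0\<close> for these \<open>k\<close> (always for \<open>k = 0\<close>), and it is
  smooth around \<open>0\<close> if there are no such eigenvalues.\<close>

definition remainder_regular ::
    "complex mat \<Rightarrow> (complex \<Rightarrow> complex poly) \<Rightarrow> real \<Rightarrow> (real \<Rightarrow> complex) \<Rightarrow> bool" where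
  "remainder_regular A P \<rho> h \<longleftrightarrow>
     (\<forall>k. Ck_on k h {0<..}) \<and>
     (\<exists>\<delta>>0. \<forall>k. (\<forall>\<mu>\<in>spectrum A. cmod \<mu> < 1 \<and> P \<mu> \<noteq> 0 \<longrightarrow> cmod \<mu> < \<rho> ^ (2 * k))
              \<longrightarrow> Ck_on k h {- \<delta><..<\<delta>})"

end

theory Submission
  imports Defs
begin

text \<open>
  The Dirac operator pairs each edge with its opposite, so its eigenspaces for \<open>\<plusminus>\<rho>\<^sup>-\<^sup>n\<close> are spanned by the
  sums and differences of opposite edges of \<open>E\<^sub>n\<close>, and the trace of the heat operator is
  \<open>\<Sum>n. #E\<^sub>n exp (- t \<rho>\<^sup>-\<^sup>2\<^sup>n)\<close>. An eigenvalue \<open>\<mu>\<close> of modulus greater than one contributes the same sum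
  with \<open>P\<^sub>\<mu>(n) \<mu>\<^sup>n\<close> in place of \<open>#E\<^sub>n\<close>. Extending it to all integers \<open>n\<close> costs a function that is
  smooth at \<open>0\<close>, and the two-sided sum is a derivative with respect to \<open>s\<close> of a sum that the Poisson
  formula turns into a Fourier series in \<open>ln t\<close> with Gamma values as coefficients. The leading term
  comes from \<open>#E\<^sub>n / \<lambda>\<^sup>n\<close> converging to \<open>C1\<close>, that is, from the convergence of \<open>A\<^sup>n / \<lambda>\<^sup>n\<close> for a
  primitive matrix.
\<close>

section \<open>Fourier series and Poisson summation\<close>

definition fourier_coeff :: "(real \<Rightarrow> complex) \<Rightarrow> int \<Rightarrow> complex" where
  "fourier_coeff f k = integral {0..1} (\<lambda>x. f x * cis (- (2 * pi * of_int k * x)))"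

lemma periodic_add_int:
  fixes f :: "real \<Rightarrow> 'a"
  assumes "\<And>x. f (x + 1) = f x"
  shows "f (x + of_int n) = f x"
proof -
  interpret periodic_fun_simple' f by standard (rule assms)
  show ?thesis by (rule plus_of_int)
qed

lemma cis_eq_iff_int: "cis (2 * pi * x) = cis (2 * pi * y) \<longleftrightarrow> (\<exists>n. x = y + of_int n)"
proof -
  have "cis (2 * pi * x) = cis (2 * pi * y) \<longleftrightarrow>
      sin (2 * pi * x) = sin (2 * pi * y) \<and> cos (2 * pi * x) = cos (2 * pi * y)"
    by (auto simp: complex_eq_iff)
  also have "\<dots> \<longleftrightarrow> (\<exists>n::int. 2 * pi * x = 2 * pi * y + 2 * pi * n)"
    by (rule sin_cos_eq_iff)
  also have "\<dots> \<longleftrightarrow> (\<exists>n::int. 2 * pi * x = 2 * pi * (y + of_int n))"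
    by (simp only: distrib_left)
  finally show ?thesis by simp
qed

lemma continuous_periodic_on_circle:
  fixes f :: "real \<Rightarrow> complex"
  assumes per: "\<And>x. f (x + 1) = f x" and cont: "continuous_on UNIV f"
  obtains g where "continuous_on (sphere 0 1) g" "\<And>x. g (cis (2 * pi * x)) = f x"
proof
  define g where "g w = f (Arg w / (2 * pi))" for w
  have eq: "f x = f y" if "cis (2 * pi * x) = cis (2 * pi * y)" for x y
    using that periodic_add_int[of f, OF per] by (auto simp: cis_eq_iff_int)
  have cis_Arg: "cis (2 * pi * (Arg w / (2 * pi))) = w" if "norm w = 1" for w
    using that cis_Arg[of w] by (cases "w = 0") (auto simp: sgn_div_norm)
  have isf: "isCont f x" for x
    using cont by (simp add: continuous_on_eq_continuous_at)
  show "g (cis (2 * pi * x)) = f x" for x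
    unfolding g_def by (rule eq) (subst cis_Arg, auto)
  have g': "g w = f (Arg (- w) / (2 * pi) + 1 / 2)" if "norm w = 1" for w
  proof -
    have "cis (2 * pi * (Arg (- w) / (2 * pi) + 1 / 2)) =
          cis (2 * pi * (Arg (- w) / (2 * pi))) * cis pi"
      unfolding cis_mult by (simp add: distrib_left del: cis_pi)
    also have "\<dots> = w" using that by (subst cis_Arg) auto
    finally show ?thesis unfolding g_def using cis_Arg[OF that] by (intro eq) simp
  qed
  show "continuous_on (sphere 0 1) g"
    unfolding continuous_on_eq_continuous_within
  proof
    fix w :: complex assume w: "w \<in> sphere 0 1"
    show "continuous (at w within sphere 0 1) g"
    proof (cases "w \<in> \<real>\<^sub>\<le>\<^sub>0")
      case False
      then have "isCont (\<lambda>w. f (Arg w / (2 * pi))) w"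
        by (intro isCont_o2[OF _ isf] continuous_intros continuous_at_Arg) auto
      then show ?thesis unfolding g_def by (rule continuous_at_imp_continuous_at_within)
    next
      case True
      have "- w \<notin> \<real>\<^sub>\<le>\<^sub>0" using True w by (auto simp: complex_nonpos_Reals_iff complex_eq_iff cmod_def)
      then have "isCont Arg (- w)" by (rule continuous_at_Arg)
      then have "isCont (\<lambda>w. Arg (- w)) w" by (intro isCont_o2[of _ uminus Arg]) auto
      then have "isCont (\<lambda>w. f (Arg (- w) / (2 * pi) + 1 / 2)) w"
        by (intro isCont_o2[OF _ isf] continuous_intros) auto
      then have "continuous (at w within sphere 0 1) (\<lambda>w. f (Arg (- w) / (2 * pi) + 1 / 2))"
        by (rule continuous_at_imp_continuous_at_within)
      then show ?thesis
        by (rule continuous_transform_within[where \<delta> = 1]) (use w g' in auto)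
    qed
  qed
qed

lemma integrable_mult_cis:
  fixes f :: "real \<Rightarrow> complex"
  assumes "continuous_on UNIV f"
  shows "(\<lambda>x. f x * cis (c * x)) integrable_on {a..b}"
  using assms by (intro integrable_continuous_real continuous_intros) (auto intro: continuous_on_subset)

lemma fourier_coeff_mult_real_polynomial:
  assumes "real_polynomial_function p" "continuous_on UNIV D" "\<And>k. fourier_coeff D k = 0"
  shows "fourier_coeff (\<lambda>x. D x * of_real (p (cis (2 * pi * x)))) k = 0"
  using assms
proof (induction p arbitrary: D k rule: real_polynomial_function.induct)
  case (linear p D k)
  define c1 c2 where "c1 = (of_real (p 1) - \<i> * of_real (p \<i>)) / 2"
    and "c2 = (of_real (p 1) + \<i> * of_real (p \<i>)) / 2"
  have p: "p w = Re w * p 1 + Im w * p \<i>" for w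
  proof -
    have "p w = p (Re w *\<^sub>R 1 + Im w *\<^sub>R \<i>)"
      by (rule arg_cong[of _ _ p]) (simp add: complex_eq_iff)
    then show ?thesis
      using linear(1) by (simp only: linear_simps) simp
  qed
  have split: "of_real (p (cis u)) = c1 * cis u + c2 * cis (- u)" for u
    unfolding p[of "cis u"] c1_def c2_def by (simp add: complex_eq_iff field_simps)
  have "(\<lambda>x. D x * of_real (p (cis (2 * pi * x))) * cis (- (2 * pi * of_int k * x))) =
      (\<lambda>x. c1 * (D x * cis (- (2 * pi * of_int (k - 1) * x))) +
           c2 * (D x * cis (- (2 * pi * of_int (k + 1) * x))))"
    unfolding split by (simp add: fun_eq_iff cis_mult algebra_simps)
  moreover have "(\<lambda>x. D x * cis (- (2 * pi * of_int m * x))) integrable_on {0..1}" for m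
    using integrable_mult_cis[OF linear(2), of "- (2 * pi * of_int m)"] by (simp add: mult.assoc)
  ultimately show ?case
    using linear(3)[of "k - 1"] linear(3)[of "k + 1"] unfolding fourier_coeff_def
    by (simp only:) (subst integral_add, auto intro!: integrable_on_mult_right simp del: of_int_diff of_int_add)
next
  case (const c D k)
  then show ?case
    by (simp add: fourier_coeff_def mult.assoc mult.left_commute[of _ "of_real c"] integral_mult_right)
next
  case (add p q D k)
  have cp: "continuous_on UNIV (\<lambda>x. p (cis (2 * pi * x)))" if "real_polynomial_function p" for p :: "complex \<Rightarrow> real"
    by (intro continuous_on_compose2[OF _ continuous_on_cis, of UNIV p])
      (auto intro!: continuous_intros continuous_at_imp_continuous_on continuous_real_polymonial_function that)
  have int: "(\<lambda>x. D x * of_real (p (cis (2 * pi * x))) * cis (- (2 * pi * of_int k * x))) integrable_on {0..1}"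
    if "real_polynomial_function p" for p
    using integrable_mult_cis[of "\<lambda>x. D x * of_real (p (cis (2 * pi * x)))" "- (2 * pi * of_int k)" 0 1]
      add.prems(1) cp[OF that]
    by (simp add: mult.assoc continuous_intros)
  show ?case
    using add.IH(1)[OF add.prems, of k] add.IH(2)[OF add.prems, of k] int[OF add.hyps(1)] int[OF add.hyps(2)]
    unfolding fourier_coeff_def by (simp add: integral_add algebra_simps)
next
  case (mult p q D k)
  have cp: "continuous_on UNIV (\<lambda>x. p (cis (2 * pi * x)))"
    by (intro continuous_on_compose2[OF _ continuous_on_cis, of UNIV p])
      (auto intro!: continuous_intros continuous_at_imp_continuous_on continuous_real_polymonial_function mult.hyps)
  have "fourier_coeff (\<lambda>x. (D x * of_real (p (cis (2 * pi * x)))) * of_real (q (cis (2 * pi * x)))) k = 0"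
    by (rule mult.IH(2)) (use mult.prems cp mult.IH(1)[OF mult.prems] in \<open>auto intro!: continuous_intros\<close>)
  then show ?case by (simp add: mult.assoc)
qed

text \<open>By the preceding lemma \<open>D\<close> is orthogonal to every polynomial on the circle, hence, by
  Stone--Weierstrass, to its own conjugate.\<close>

lemma fourier_unique:
  fixes D :: "real \<Rightarrow> complex"
  assumes per: "\<And>x. D (x + 1) = D x" and cont: "continuous_on UNIV D"
    and coeff: "\<And>k. fourier_coeff D k = 0"
  shows "D x = 0"
proof -
  define I where "I = integral {0..1} (\<lambda>x. (norm (D x))\<^sup>2)"
  have contI: "continuous_on {0..1} D" using cont by (rule continuous_on_subset) auto
  have "compact (D ` {0..1})" using contI by (intro compact_continuous_image) auto
  then obtain M where M: "M > 0" "\<And>x. x \<in> {0..1} \<Longrightarrow> norm (D x) \<le> M"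
    by (auto dest!: compact_imp_bounded simp: bounded_pos)
  obtain g where g: "continuous_on (sphere 0 1) g" "\<And>x. g (cis (2 * pi * x)) = cnj (D x)"
    using continuous_periodic_on_circle[of "\<lambda>x. cnj (D x)"] per cont
    by (metis continuous_on_cnj)
  have "I \<le> e" if e: "e > 0" for e
  proof -
    obtain q where q: "polynomial_function q" "\<And>w. w \<in> sphere 0 1 \<Longrightarrow> norm (g w - q w) < e / M"
      using Stone_Weierstrass_polynomial_function[OF _ g(1), of "e / M"] e M(1) by auto
    define Q where "Q x = q (cis (2 * pi * x))" for x
    have rp: "real_polynomial_function (\<lambda>w. Re (q w))" "real_polynomial_function (\<lambda>w. Im (q w))"
      using q(1) bounded_linear_Re bounded_linear_Im by (auto simp: polynomial_function_def o_def)
    have contQ: "continuous_on UNIV Q" unfolding Q_def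
      by (intro continuous_on_compose2[OF _ continuous_on_cis, of UNIV q])
        (auto intro!: continuous_intros continuous_at_imp_continuous_on continuous_polymonial_function q)
    have cc: "continuous_on {0..1} Q" using contQ by (rule continuous_on_subset) auto
    have "integral {0..1} (\<lambda>x. D x * Q x) =
        integral {0..1} (\<lambda>x. D x * of_real (Re (Q x)) + \<i> * (D x * of_real (Im (Q x))))"
      by (intro integral_cong) (simp add: complex_eq_iff)
    also have "\<dots> = integral {0..1} (\<lambda>x. D x * of_real (Re (Q x)))
          + \<i> * integral {0..1} (\<lambda>x. D x * of_real (Im (Q x)))"
      by (subst integral_add) (auto intro!: integrable_continuous_real continuous_intros cc contI)
    also have "\<dots> = 0"
      using fourier_coeff_mult_real_polynomial[OF rp(1) cont coeff, of 0]
        fourier_coeff_mult_real_polynomial[OF rp(2) cont coeff, of 0]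
      by (simp add: fourier_coeff_def Q_def)
    finally have z: "integral {0..1} (\<lambda>x. D x * Q x) = 0" .
    have "of_real I = integral {0..1} (\<lambda>x. D x * cnj (D x))"
    proof -
      have "((\<lambda>x. (norm (D x))\<^sup>2) has_integral I) {0..1}"
        unfolding I_def by (intro integrable_integral integrable_continuous_real continuous_intros contI)
      from has_integral_of_real[OF this, where 'b = complex] show ?thesis
        by (intro integral_unique[symmetric]) (simp only: complex_norm_square)
    qed
    also have "\<dots> = integral {0..1} (\<lambda>x. D x * (cnj (D x) - Q x))"
      using z unfolding right_diff_distrib
      by (subst integral_diff) (auto intro!: integrable_continuous_real continuous_intros contI cc)
    finally have "norm (complex_of_real I) = norm (integral {0..1} (\<lambda>x. D x * (cnj (D x) - Q x)))"
      by simp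
    also have "\<dots> \<le> e * (1 - 0)"
    proof (rule integral_bound)
      fix x :: real assume x: "x \<in> {0..1}"
      have "norm (D x * (cnj (D x) - Q x)) \<le> M * (e / M)"
        unfolding norm_mult using M(2)[OF x] q(2)[of "cis (2 * pi * x)"] g(2)[of x]
        by (intro mult_mono) (auto simp: Q_def intro: less_imp_le M)
      then show "norm (D x * (cnj (D x) - Q x)) \<le> e" using M(1) by simp
    qed (auto intro!: continuous_intros contI cc)
    finally show ?thesis by simp
  qed
  then have "I \<le> 0" using field_le_epsilon[of I 0] by simp
  moreover have "I \<ge> 0" unfolding I_def
    by (intro integral_nonneg integrable_continuous_real continuous_intros contI) auto
  ultimately have "I = 0" by simp
  have "(\<lambda>x. (norm (D x))\<^sup>2) integrable_on {0..1}"
    by (intro integrable_continuous_real continuous_intros contI)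
  then have I0: "((\<lambda>x. (norm (D x))\<^sup>2) has_integral 0) (cbox 0 1)"
    using \<open>I = 0\<close> by (simp add: I_def has_integral_integral)
  have zero: "D x = 0" if "x \<in> {0..1}" for x
    using has_integral_0_cbox_imp_0[OF _ _ I0, of x] that contI
    by (auto simp: continuous_on_norm continuous_on_power)
  have "D x = D (x + of_int (- \<lfloor>x\<rfloor>))" by (rule periodic_add_int[of D, OF per, symmetric])
  also have "\<dots> = 0" by (rule zero) (simp, linarith)
  finally show ?thesis .
qed

lemma infsum_int_decode:
  fixes f :: "int \<Rightarrow> 'a :: banach"
  assumes "summable (\<lambda>n. norm (f (int_decode n)))"
  shows "f summable_on UNIV" "infsum f UNIV = (\<Sum>n. f (int_decode n))"
proof -
  have "(\<lambda>n. f (int_decode n)) sums (\<Sum>n. f (int_decode n))"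
    using summable_norm_cancel[OF assms] by (rule summable_sums)
  with assms have "((\<lambda>n. f (int_decode n)) has_sum (\<Sum>n. f (int_decode n))) UNIV"
    by (rule norm_summable_imp_has_sum)
  then have "(f has_sum (\<Sum>n. f (int_decode n))) UNIV"
    using has_sum_reindex_bij_betw[OF bij_int_decode, of f] by blast
  then show "f summable_on UNIV" "infsum f UNIV = (\<Sum>n. f (int_decode n))"
    by (auto simp: summable_on_def infsumI)
qed

lemma abs_int_decode_ge: "2 * \<bar>int_decode n\<bar> + 1 \<ge> int n"
proof (cases "int_decode n \<ge> 0")
  case True
  have "int n = int (int_encode (int_decode n))" by simp
  also have "\<dots> = 2 * int_decode n" using True
    by (subst int_encode_def) (simp add: sum_encode_def)
  finally show ?thesis using True by simp
next
  case False
  have "int n = int (int_encode (int_decode n))" by simp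
  also have "\<dots> = 2 * (- int_decode n - 1) + 1" using False
    by (subst int_encode_def) (simp add: sum_encode_def)
  finally show ?thesis using False by simp
qed

lemma summable_exp_neg_abs_int_decode:
  fixes c :: real
  assumes "c > 0"
  shows "summable (\<lambda>n. exp (- (c * \<bar>of_int (int_decode n)\<bar>)))"
proof (rule summable_comparison_test)
  show "summable (\<lambda>n. exp (c / 2) * exp (- (c / 2)) ^ n)"
    using assms by (intro summable_mult summable_geometric) simp
  have "exp (- (c * \<bar>of_int (int_decode n)\<bar>)) \<le> exp (c / 2) * exp (- (c / 2)) ^ n" for n
  proof -
    have "real_of_int (2 * \<bar>int_decode n\<bar> + 1) \<ge> real_of_int (int n)"
      using abs_int_decode_ge[of n] by (simp only: of_int_le_iff)
    then have "c * real n \<le> c * (2 * \<bar>of_int (int_decode n)\<bar> + 1)"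
      using assms by (intro mult_left_mono) auto
    then show ?thesis
      by (simp add: exp_of_nat_mult[symmetric] exp_add[symmetric] field_simps)
  qed
  then show "\<exists>N. \<forall>n\<ge>N. norm (exp (- (c * \<bar>of_int (int_decode n)\<bar>))) \<le> exp (c / 2) * exp (- (c / 2)) ^ n"
    by auto
qed

lemma summable_inverse_square_int_decode:
  "summable (\<lambda>n. 1 / (1 + (real_of_int (int_decode n))\<^sup>2))"
proof (rule summable_comparison_test)
  have "summable (\<lambda>n. inverse (real (Suc n) ^ 2))"
    using inverse_power_summable[of 2, where 'a = real] summable_Suc_iff[of "\<lambda>n. inverse (real n ^ 2)"] by simp
  then show "summable (\<lambda>n. 8 * inverse (real (Suc n) ^ 2))" by (rule summable_mult)
  have "1 / (1 + (real_of_int (int_decode n))\<^sup>2) \<le> 8 * inverse (real (Suc n) ^ 2)" for n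
  proof -
    define k where "k = \<bar>real_of_int (int_decode n)\<bar>"
    have "real_of_int (2 * \<bar>int_decode n\<bar> + 1) \<ge> real_of_int (int n)"
      using abs_int_decode_ge[of n] by (simp only: of_int_le_iff)
    then have "real (Suc n) \<le> 2 * (1 + k)" by (simp add: k_def)
    then have "real (Suc n) ^ 2 \<le> (2 * (1 + k)) ^ 2" by (intro power_mono) auto
    also have "\<dots> \<le> 8 * (1 + k\<^sup>2)"
      using sum_squares_ge_zero[of "k - 1" 0] by (simp add: power2_eq_square algebra_simps)
    finally have *: "real (Suc n) ^ 2 \<le> 8 * (1 + k\<^sup>2)" .
    have "1 / (1 + k\<^sup>2) \<le> 8 / real (Suc n) ^ 2"
      using * add_pos_nonneg[of 1 "k\<^sup>2"] by (simp add: divide_simps)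
    then show ?thesis by (simp add: k_def field_simps)
  qed
  then show "\<exists>N. \<forall>n\<ge>N. norm (1 / (1 + (real_of_int (int_decode n))\<^sup>2)) \<le> 8 * inverse (real (Suc n) ^ 2)"
    by (auto simp: abs_of_nonneg)
qed

lemma integral_cis_int:
  "integral {0..1} (\<lambda>x. cis (2 * pi * of_int n * x)) = (if n = 0 then 1 else 0)"
proof (cases "n = 0")
  case False
  define c where "c = \<i> * (2 * pi * of_int n)"
  have c: "c \<noteq> 0" using False by (simp add: c_def)
  have "((\<lambda>x. exp (c * of_real x)) has_integral (exp (c * of_real 1) / c - exp (c * of_real 0) / c)) {0..1}"
    by (rule fundamental_theorem_of_calculus)
      (use c in \<open>auto intro!: has_vector_derivative_real_field derivative_eq_intros\<close>)
  moreover have "exp (c * of_real x) = cis (2 * pi * of_int n * x)" for x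
    by (simp add: c_def cis_conv_exp mult_ac)
  moreover have "cis (2 * pi * of_int n) = 1"
    using cis_eq_iff_int[of "of_int n" 0] by simp
  then have "exp c = 1" by (simp add: c_def cis_conv_exp mult_ac)
  ultimately show ?thesis using False by (simp add: integral_unique)
qed simp

lemma fourier_series_eq:
  fixes F :: "real \<Rightarrow> complex"
  assumes per: "\<And>x. F (x + 1) = F x" and cont: "continuous_on UNIV F"
    and sm: "summable (\<lambda>n. norm (fourier_coeff F (int_decode n)))"
  shows "F x = (\<Sum>\<^sub>\<infinity>k\<in>UNIV. fourier_coeff F k * cis (2 * pi * of_int k * x))"
proof -
  define c where "c = fourier_coeff F"
  define G where "G x = (\<Sum>n. c (int_decode n) * cis (2 * pi * of_int (int_decode n) * x))" for x
  have ul: "uniform_limit UNIV (\<lambda>n x. \<Sum>i<n. c (int_decode i) * cis (2 * pi * of_int (int_decode i) * x)) G sequentially"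
    unfolding G_def by (rule Weierstrass_m_test[OF _ sm]) (simp add: norm_mult c_def)
  have contG: "continuous_on UNIV G"
    by (rule uniform_limit_theorem[OF _ ul]) (auto intro!: always_eventually continuous_intros)
  have perG: "G (x + 1) = G x" for x
  proof -
    have "cis (2 * pi * of_int k * (x + 1)) = cis (2 * pi * of_int k * x)" for k
      using cis_eq_iff_int[of "of_int k * (x + 1)" "of_int k * x"]
      by (auto simp: mult.assoc distrib_left intro!: exI[of _ k])
    then show ?thesis by (simp add: G_def)
  qed
  have "fourier_coeff G m = c m" for m
  proof -
    define f where "f n x = (\<Sum>i<n. c (int_decode i) * cis (2 * pi * of_int (int_decode i - m) * x))" for n x
    have "uniform_limit {0..1} (\<lambda>n x. \<Sum>i<n. c (int_decode i) * cis (2 * pi * of_int (int_decode i - m) * x))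
        (\<lambda>x. \<Sum>i. c (int_decode i) * cis (2 * pi * of_int (int_decode i - m) * x)) sequentially"
      by (rule Weierstrass_m_test[OF _ sm]) (simp add: norm_mult c_def)
    moreover have "(\<Sum>i. c (int_decode i) * cis (2 * pi * of_int (int_decode i - m) * x)) =
        G x * cis (- (2 * pi * of_int m * x))" for x
    proof -
      have "summable (\<lambda>n. c (int_decode n) * cis (2 * pi * of_int (int_decode n) * x))"
        by (rule summable_norm_cancel) (use sm in \<open>simp add: norm_mult c_def\<close>)
      then have "G x * cis (- (2 * pi * of_int m * x)) =
          (\<Sum>n. c (int_decode n) * cis (2 * pi * of_int (int_decode n) * x) * cis (- (2 * pi * of_int m * x)))"
        unfolding G_def by (rule suminf_mult2)
      also have "\<dots> = (\<Sum>i. c (int_decode i) * cis (2 * pi * of_int (int_decode i - m) * x))"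
        by (simp add: mult.assoc cis_mult algebra_simps)
      finally show ?thesis by (rule sym)
    qed
    ultimately have ul: "uniform_limit {0..1} f (\<lambda>x. G x * cis (- (2 * pi * of_int m * x))) sequentially"
      by (simp add: f_def [abs_def])
    obtain I J where IJ: "\<And>n. (f n has_integral I n) {0..1}"
       "((\<lambda>x. G x * cis (- (2 * pi * of_int m * x))) has_integral J) {0..1}" "I \<longlonglongrightarrow> J"
      by (rule uniform_limit_integral[OF ul]) (auto simp: f_def intro!: continuous_intros)
    have Im: "I n = c m" if n: "n > int_encode m" for n
    proof -
      have "((\<lambda>x. \<Sum>i<n. c (int_decode i) * cis (2 * pi * of_int (int_decode i - m) * x)) has_integral
          (\<Sum>i<n. c (int_decode i) * integral {0..1} (\<lambda>x. cis (2 * pi * of_int (int_decode i - m) * x)))) {0..1}"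
        by (intro has_integral_sum has_integral_mult_right integrable_integral integrable_continuous_real continuous_intros) auto
      with IJ(1)[of n] have "I n = (\<Sum>i<n. c (int_decode i) * integral {0..1} (\<lambda>x. cis (2 * pi * of_int (int_decode i - m) * x)))"
        unfolding f_def by (rule has_integral_unique)
      also have "\<dots> = (\<Sum>i<n. if i = int_encode m then c m else 0)"
        unfolding integral_cis_int by (intro sum.cong) auto
      also have "\<dots> = c m" using n by simp
      finally show "I n = c m" .
    qed
    have "I \<longlonglongrightarrow> c m"
      by (rule tendsto_eventually) (use Im in \<open>auto intro: eventually_sequentiallyI[of "Suc (int_encode m)"]\<close>)
    with IJ(3) have "J = c m" by (rule LIMSEQ_unique)
    with IJ(2) show ?thesis by (simp add: fourier_coeff_def integral_unique)
  qed
  moreover have "fourier_coeff (\<lambda>x. F x - G x) k = fourier_coeff F k - fourier_coeff G k" for k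
    using integrable_mult_cis[OF cont, of "- (2 * pi * of_int k)" 0 1]
      integrable_mult_cis[OF contG, of "- (2 * pi * of_int k)" 0 1]
    by (simp add: fourier_coeff_def left_diff_distrib integral_diff)
  ultimately have *: "F x - G x = 0"
    by (intro fourier_unique[of "\<lambda>x. F x - G x"]) (auto simp: per perG c_def intro!: continuous_intros cont contG)
  have "G x = (\<Sum>\<^sub>\<infinity>k\<in>UNIV. fourier_coeff F k * cis (2 * pi * of_int k * x))"
    unfolding G_def c_def by (rule infsum_int_decode(2)[symmetric]) (use sm in \<open>simp add: norm_mult\<close>)
  with * show ?thesis by simp
qed

lemma norm_Gamma_complex_le:
  assumes "Re z > 0" shows "norm (Gamma z) \<le> Gamma (Re z)"
proof -
  have "Re (of_real (Re z) :: complex) > 0" using assms by simp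
  note A = Gamma_integral_complex'[OF this] Gamma_integral_complex'[OF assms]
  have C1: "((\<lambda>t. Re (of_real t powr (of_real (Re z) - 1) / of_real (exp t))) has_integral Re (Gamma (of_real (Re z)))) {0<..}"
    using has_integral_linear[OF A(1) bounded_linear_Re] by (simp add: o_def)
  have C2: "Re (of_real t powr (of_real (Re z) - 1) / of_real (exp t)) = t powr (Re z - 1) / exp t"
    if "t \<in> {0<..}" for t :: real
    using that powr_of_real[of t "Re z - 1"] by simp
  have "((\<lambda>t. t powr (Re z - 1) / exp t) has_integral Re (Gamma (of_real (Re z)))) {0<..}"
    by (rule has_integral_eq[OF C2 C1])
  then have B: "((\<lambda>t. t powr (Re z - 1) / exp t) has_integral Gamma (Re z)) {0<..}"
    by (simp add: Gamma_complex_of_real)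
  have "norm (integral {0<..} (\<lambda>t. of_real t powr (z - 1) / of_real (exp t))) \<le>
      integral {0<..} (\<lambda>t. t powr (Re z - 1) / exp t)"
    using A(2) B by (intro integral_norm_bound_integral)
      (auto simp: norm_divide norm_powr_real_powr has_integral_integrable)
  then show ?thesis using A(2) B by (simp add: integral_unique)
qed

lemma summable_Gamma_vertical:
  fixes a :: complex and c :: real
  assumes a: "Re a > 0" and c: "c > 0"
  shows "summable (\<lambda>n. norm (Gamma (a + \<i> * of_real (c * of_int (int_decode n)))))"
proof -
  define A where "A = Re a"
  define B where "B = Im a"
  define \<theta> where "\<theta> = A\<^sup>2 / (2 * (A\<^sup>2 + B\<^sup>2))"
  have A: "A > 0" using a by (simp add: A_def)
  have sq: "A\<^sup>2 + B\<^sup>2 > 0" using A by (simp add: add_pos_nonneg)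
  have th: "\<theta> > 0" "\<theta> \<le> 1" "\<theta> * B\<^sup>2 \<le> A\<^sup>2 / 2"
    using A sq by (auto simp: \<theta>_def field_simps)
  define \<delta> where "\<delta> = min (A\<^sup>2 / 2) (\<theta> * c\<^sup>2 / 2)"
  have d: "\<delta> > 0" using A c th by (simp add: \<delta>_def)
  have bound: "norm (Gamma (a + \<i> * of_real (c * of_int k))) \<le> Gamma (A + 2) / \<delta> * (1 / (1 + (of_int k)\<^sup>2))" for k :: int
  proof -
    define z where "z = a + \<i> * of_real (c * of_int k)"
    have Re: "Re z = A" and Im: "Im z = B + c * of_int k" by (simp_all add: z_def A_def B_def)
    have z: "z \<notin> \<int>\<^sub>\<le>\<^sub>0" "z + 1 \<notin> \<int>\<^sub>\<le>\<^sub>0"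
      using A Re by (auto simp: complex_eq_iff elim!: nonpos_Ints_cases)
    have nz: "z \<noteq> 0" "z + 1 \<noteq> 0" using Re A by (auto simp: complex_eq_iff)
    have "Gamma (z + 2) = (z + 1) * (z * Gamma z)"
      using Gamma_plus1[OF z(1)] Gamma_plus1[OF z(2)] by (simp add: add.assoc)
    then have "Gamma (z + 2) = ((z + 1) * z) * Gamma z" by simp
    then have G: "Gamma z = Gamma (z + 2) / ((z + 1) * z)" using nz by simp
    have "(norm z)\<^sup>2 = A\<^sup>2 + (B + c * of_int k)\<^sup>2" by (simp add: cmod_power2 Re Im)
    moreover have "(B + c * of_int k)\<^sup>2 \<ge> (c * of_int k)\<^sup>2 / 2 - B\<^sup>2"
      using zero_le_power2[of "2 * B + c * of_int k"] by (simp add: power2_eq_square algebra_simps)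
    then have "\<theta> * ((c * of_int k)\<^sup>2 / 2 - B\<^sup>2) \<le> \<theta> * (B + c * of_int k)\<^sup>2"
      using th by (intro mult_left_mono) auto
    moreover have "\<theta> * (B + c * of_int k)\<^sup>2 \<le> 1 * (B + c * of_int k)\<^sup>2"
      using th by (intro mult_right_mono) auto
    ultimately have "(norm z)\<^sup>2 \<ge> A\<^sup>2 / 2 + \<theta> * c\<^sup>2 / 2 * (of_int k)\<^sup>2"
      using th(3) by (simp add: algebra_simps power_mult_distrib)
    moreover have "\<theta> * c\<^sup>2 / 2 * (of_int k)\<^sup>2 \<ge> \<delta> * (of_int k)\<^sup>2"
      by (rule mult_right_mono) (simp_all add: \<delta>_def)
    moreover have "A\<^sup>2 / 2 \<ge> \<delta>" by (simp add: \<delta>_def)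
    ultimately have n1: "(norm z)\<^sup>2 \<ge> \<delta> * (1 + (of_int k)\<^sup>2)" by (simp add: algebra_simps)
    have "(norm (z + 1))\<^sup>2 \<ge> (norm z)\<^sup>2"
      using A by (simp add: cmod_power2 Re Im)
    then have "norm (z + 1) \<ge> norm z" by (rule power2_le_imp_le) simp
    then have "norm ((z + 1) * z) \<ge> norm z * norm z" unfolding norm_mult by (intro mult_right_mono) auto
    with n1 have n2: "norm ((z + 1) * z) \<ge> \<delta> * (1 + (of_int k)\<^sup>2)" by (simp add: power2_eq_square)
    have pos: "\<delta> * (1 + (real_of_int k)\<^sup>2) > 0" using d by (simp add: add_pos_nonneg)
    have "norm (Gamma (z + 2)) \<le> Gamma (A + 2)"
      using norm_Gamma_complex_le[of "z + 2"] Re A by simp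
    then have "norm (Gamma z) \<le> Gamma (A + 2) / (\<delta> * (1 + (of_int k)\<^sup>2))"
      unfolding G norm_divide using n2 pos A by (intro frac_le) (auto intro: less_imp_le Gamma_real_pos)
    then show ?thesis by (simp add: z_def)
  qed
  show ?thesis
  proof (rule summable_comparison_test)
    show "summable (\<lambda>n. Gamma (A + 2) / \<delta> * (1 / (1 + (real_of_int (int_decode n))\<^sup>2)))"
      by (intro summable_mult summable_inverse_square_int_decode)
  qed (use bound in auto)
qed

lemma norm_exp_exp_bound:
  fixes \<alpha> :: real
  assumes "\<alpha> > 0"
  obtains C where "\<And>y. exp (\<alpha> * y) * exp (- exp y) \<le> C * exp (- (\<alpha> * \<bar>y\<bar>))" "C > 0"
proof
  define m where "m = nat \<lceil>2 * \<alpha>\<rceil>"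
  have m: "real m \<ge> 2 * \<alpha>" "m > 0" using assms by (simp_all add: m_def)
  show "real m ^ m > 0" using m by simp
  show "exp (\<alpha> * y) * exp (- exp y) \<le> real m ^ m * exp (- (\<alpha> * \<bar>y\<bar>))" for y
  proof (cases "y \<ge> 0")
    case False
    have "exp (\<alpha> * y) * exp (- exp y) \<le> exp (\<alpha> * y) * 1" by (intro mult_left_mono) auto
    also have "\<dots> \<le> real m ^ m * exp (\<alpha> * y)" using one_le_power[of "real m" m] m by simp
    finally show ?thesis using False by simp
  next
    case True
    have "(exp y / real m) ^ m \<le> (1 + exp y / real m) ^ m" by (intro power_mono) auto
    also have "\<dots> \<le> exp (exp y)" using m by (intro exp_ge_one_plus_x_over_n_power_n) (auto intro: order_trans[of _ 0])
    finally have "exp (real m * y) / real m ^ m \<le> exp (exp y)"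
      by (simp add: exp_of_nat_mult power_divide)
    then have "exp (- exp y) \<le> real m ^ m * exp (- (real m * y))"
      using m by (simp add: exp_minus field_simps)
    also have "\<dots> \<le> real m ^ m * exp (- (2 * \<alpha> * y))"
      using True m by (intro mult_left_mono) (auto intro: mult_right_mono)
    finally have "exp (\<alpha> * y) * exp (- exp y) \<le> exp (\<alpha> * y) * (real m ^ m * exp (- (2 * \<alpha> * y)))"
      by (intro mult_left_mono) auto
    also have "\<dots> = real m ^ m * exp (- (\<alpha> * \<bar>y\<bar>))"
      using True by (simp add: exp_minus field_simps exp_add[symmetric])
    finally show ?thesis .
  qed
qed

lemma integral_exp_substitution:
  fixes b :: complex and r :: real and k m :: int
  assumes r: "r > 0"
  defines "z \<equiv> b + \<i> * of_real (2 * pi / r * of_int m)"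
  shows "((\<lambda>x. exp (b * of_real (r * (of_int k - x))) * of_real (exp (- exp (r * (of_int k - x)))) * cis (- (2 * pi * of_int m * x)))
    has_integral integral {exp (r * (of_int k - 1))..exp (r * of_int k)} (\<lambda>t. of_real t powr (z - 1) / of_real (exp t)) / of_real r) {0..1}"
proof -
  define f :: "real \<Rightarrow> complex" where "f t = of_real t powr (z - 1) / of_real (exp t)" for t
  define g where "g x = exp (r * (of_int k - x))" for x :: real
  define g' where "g' x = - r * exp (r * (of_int k - x))" for x :: real
  have lt: "g 1 < g 0" using r by (simp add: g_def)
  have "((\<lambda>x. g' x *\<^sub>R f (g x)) has_integral (integral {g 0..g 1} f - integral {g 1..g 0} f)) {0..1}"
  proof (rule has_integral_substitution_general[where s = "{}" and c = "g 1" and d = "g 0"])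
    show "g ` {0..1} \<subseteq> {g 1..g 0}" using r by (auto simp: g_def)
    have "g 1 > 0" by (simp add: g_def)
    then show "continuous_on {g 1..g 0} f" unfolding f_def
      by (intro continuous_intros) (auto simp: complex_nonpos_Reals_iff)
  qed (auto simp: g_def g'_def intro!: continuous_intros derivative_eq_intros)
  then have "((\<lambda>x. - (1 / r) *\<^sub>R (g' x *\<^sub>R f (g x))) has_integral - (1 / r) *\<^sub>R (integral {g 0..g 1} f - integral {g 1..g 0} f)) {0..1}"
    by (rule has_integral_cmul)
  moreover have "- (1 / r) *\<^sub>R (integral {g 0..g 1} f - integral {g 1..g 0} f) = integral {g 1..g 0} f / of_real r"
    using lt r by (simp add: scaleR_conv_of_real)
  moreover have "- (1 / r) *\<^sub>R (g' x *\<^sub>R f (g x)) =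
     exp (b * of_real (r * (of_int k - x))) * of_real (exp (- exp (r * (of_int k - x)))) * cis (- (2 * pi * of_int m * x))" for x
  proof -
    define y where "y = r * (of_int k - x)"
    have cis: "exp (\<i> * of_real (2 * pi / r * of_int m) * of_real y) = cis (- (2 * pi * of_int m * x))"
    proof -
      have "exp (\<i> * of_real (2 * pi / r * of_int m) * of_real y) = cis (2 * pi * (of_int m * of_int k - of_int m * x))"
      proof -
        have "2 * pi / r * of_int m * y = 2 * pi * (of_int m * of_int k - of_int m * x)"
          using r by (simp add: y_def field_simps)
        then have "\<i> * complex_of_real (2 * pi / r * of_int m) * of_real y = \<i> * of_real (2 * pi * (of_int m * of_int k - of_int m * x))"
          by (simp only: mult.assoc of_real_mult[symmetric])
        then show ?thesis by (simp only: cis_conv_exp)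
      qed
      also have "\<dots> = cis (2 * pi * (- (of_int m * x)))"
        unfolding cis_eq_iff_int by (rule exI[of _ "m * k"]) simp
      finally show ?thesis by (simp add: mult.assoc)
    qed
    have "complex_of_real (exp y) powr (z - 1) = exp ((z - 1) * of_real y)"
      by (simp add: powr_def Ln_of_real)
    then have "- (1 / r) *\<^sub>R (g' x *\<^sub>R f (g x)) = exp (of_real y) * (exp ((z - 1) * of_real y) / exp (of_real (exp y)))"
      using r by (simp add: g'_def f_def g_def y_def[symmetric] scaleR_conv_of_real exp_of_real[symmetric])
    also have "\<dots> = exp (of_real y) * exp ((z - 1) * of_real y) * exp (- of_real (exp y))"
      by (simp add: exp_minus field_simps)
    also have "exp (of_real y) * exp ((z - 1) * of_real y) = exp (b * of_real y) * exp (\<i> * of_real (2 * pi / r * of_int m) * of_real y)"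
      by (simp add: z_def exp_add[symmetric] algebra_simps)
    finally show ?thesis unfolding cis by (simp add: y_def exp_of_real[symmetric] mult_ac)
  qed
  ultimately show ?thesis by (simp add: f_def[abs_def] g_def)
qed

definition exp_interval :: "real \<Rightarrow> int \<Rightarrow> real set" where
  "exp_interval r k = {exp (r * (of_int k - 1))<..exp (r * of_int k)}"

lemma mem_exp_interval_iff:
  assumes r: "r > 0"
  shows "t \<in> exp_interval r k \<longleftrightarrow> t > 0 \<and> k = \<lceil>ln t / r\<rceil>"
proof (cases "t > 0")
  case True
  then obtain y where y: "t = exp y" using exp_ln by metis
  have "t \<in> exp_interval r k \<longleftrightarrow> r * (of_int k - 1) < y \<and> y \<le> r * of_int k"
    by (simp add: exp_interval_def y)
  also have "\<dots> \<longleftrightarrow> of_int k - 1 < y / r \<and> y / r \<le> of_int k"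
    using r by (simp add: field_simps)
  also have "\<dots> \<longleftrightarrow> k = \<lceil>y / r\<rceil>" by linarith
  finally show ?thesis by (simp add: y)
next
  case False
  then have "\<not> exp (r * (of_int k - 1)) < t" using exp_gt_zero[of "r * (of_int k - 1)"] by linarith
  then show ?thesis using False by (simp add: exp_interval_def)
qed

lemma Gamma_eq_suminf:
  fixes r :: real
  assumes r: "r > 0" and z: "Re z > 0"
  shows "Gamma z = (\<Sum>n. integral {exp (r * (of_int (int_decode n) - 1))..exp (r * of_int (int_decode n))} (\<lambda>t. of_real t powr (z - 1) / of_real (exp t)))"
proof -
  define f :: "real \<Rightarrow> complex" where "f t = of_real t powr (z - 1) / of_real (exp t)" for t
  define J where "J = exp_interval r"
  have ai: "set_integrable lebesgue {0<..} f"
    using absolutely_integrable_Gamma_integral'[OF z] by (simp add: f_def[abs_def])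
  have "\<exists>n. \<lceil>ln t / r\<rceil> = int_decode n" for t
    using surj_int_decode by (rule surjD)
  then have UJ: "(\<Union>n. J (int_decode n)) = {0<..}"
    by (auto simp: J_def mem_exp_interval_iff[OF r]) metis
  have sub: "set_integrable lebesgue (J k) f" for k
    by (rule set_integrable_subset[OF ai]) (auto simp: J_def mem_exp_interval_iff[OF r], simp add: exp_interval_def)
  have "Gamma z = integral {0<..} f"
    using Gamma_integral_complex'[OF z] by (simp add: f_def[abs_def] integral_unique)
  also have "\<dots> = (LINT t:{0<..}|lebesgue. f t)"
    by (rule set_lebesgue_integral_eq_integral(2)[OF ai, symmetric])
  also have "\<dots> = (LINT t:(\<Union>n. J (int_decode n))|lebesgue. f t)" by (simp only: UJ)
  also have "\<dots> = (\<Sum>n. (LINT t:J (int_decode n)|lebesgue. f t))"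
  proof (rule lebesgue_integral_countable_add)
    show "J (int_decode i) \<inter> J (int_decode j) = {}" if "i \<noteq> j" for i j
    proof -
      have "int_decode i \<noteq> int_decode j" using that by (simp add: int_decode_eq)
      then show ?thesis by (auto simp: J_def mem_exp_interval_iff[OF r])
    qed
    show "J (int_decode i) \<in> sets lebesgue" for i by (simp add: J_def exp_interval_def)
  qed (use ai in \<open>simp add: UJ\<close>)
  finally have "Gamma z = (\<Sum>n. (LINT t:J (int_decode n)|lebesgue. f t))" .
  moreover have "(LINT t:J k|lebesgue. f t) = integral {exp (r * (of_int k - 1))..exp (r * of_int k)} f" for k
  proof -
    have "(LINT t:J k|lebesgue. f t) = integral (J k) f"
      by (rule set_lebesgue_integral_eq_integral(2)[OF sub])
    also have "\<dots> = integral {exp (r * (of_int k - 1))..exp (r * of_int k)} f"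
      by (rule integral_subset_negligible)
        (auto simp: J_def exp_interval_def intro: negligible_subset[OF negligible_sing[of "exp (r * (of_int k - 1))"]])
    finally show ?thesis .
  qed
  ultimately show ?thesis by (simp add: f_def[abs_def])
qed

lemma per_eq_infsum:
  fixes a :: complex and r \<sigma> :: real
  assumes r: "r > 0" and a: "Re a > 0"
  shows "per r a \<sigma> = (\<Sum>\<^sub>\<infinity>n\<in>(UNIV :: int set). exp (a / of_real r * of_real (r * of_int n - \<sigma>)) * of_real (exp (- exp (r * of_int n - \<sigma>))))"
proof -
  define b where "b = a / of_real r"
  define \<beta> where "\<beta> = Re b"
  have \<beta>: "\<beta> > 0" "Re b > 0" using r a by (simp_all add: \<beta>_def b_def)
  define \<phi> where "\<phi> y = exp (b * of_real y) * of_real (exp (- exp y))" for y :: real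
  define F where "F x = (\<Sum>\<^sub>\<infinity>n\<in>(UNIV :: int set). \<phi> (r * (of_int n - x)))" for x :: real
  obtain C where C: "\<And>y. exp (\<beta> * y) * exp (- exp y) \<le> C * exp (- (\<beta> * \<bar>y\<bar>))" "C > 0"
    using norm_exp_exp_bound[OF \<beta>(1)] by blast
  have bound: "norm (\<phi> (r * (of_int n - x))) \<le> C * exp (\<beta> * r * M) * exp (- (\<beta> * r * \<bar>of_int n\<bar>))"
    if "\<bar>x\<bar> \<le> M" for n x M
  proof -
    define y where "y = r * (of_int n - x)"
    have "r * (\<bar>of_int n\<bar> - M) \<le> r * \<bar>of_int n - x\<bar>"
      using r that by (intro mult_left_mono) auto
    then have "\<beta> * (r * (\<bar>of_int n\<bar> - M)) \<le> \<beta> * \<bar>y\<bar>"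
      using \<beta> r by (intro mult_left_mono) (auto simp: y_def abs_mult)
    then have "C * exp (- (\<beta> * \<bar>y\<bar>)) \<le> C * exp (\<beta> * r * M - \<beta> * r * \<bar>of_int n\<bar>)"
      using C(2) by (simp add: algebra_simps)
    moreover have "norm (\<phi> y) \<le> C * exp (- (\<beta> * \<bar>y\<bar>))"
      using C(1)[of y] by (simp add: \<phi>_def norm_mult \<beta>_def)
    moreover have "C * exp (\<beta> * r * M - \<beta> * r * \<bar>of_int n\<bar>) = C * exp (\<beta> * r * M) * exp (- (\<beta> * r * \<bar>of_int n\<bar>))"
      by (simp add: exp_diff exp_minus field_simps)
    ultimately show ?thesis by (simp add: y_def)
  qed
  have smM: "summable (\<lambda>n. C * exp (\<beta> * r * M) * exp (- (\<beta> * r * \<bar>of_int (int_decode n)\<bar>)))" for M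
    using \<beta> r by (intro summable_mult summable_exp_neg_abs_int_decode) simp
  have sm: "summable (\<lambda>n. norm (\<phi> (r * (of_int (int_decode n) - x))))" for x
    by (rule summable_comparison_test[OF _ smM[of "\<bar>x\<bar>"]]) (use bound[of x "\<bar>x\<bar>"] in auto)
  have F_eq: "F x = (\<Sum>n. \<phi> (r * (of_int (int_decode n) - x)))" for x
    unfolding F_def by (rule infsum_int_decode(2)) (rule sm)
  have per: "F (x + 1) = F x" for x
  proof -
    have "bij (\<lambda>n::int. n - 1)" by (rule bij_betw_byWitness[where f' = "\<lambda>n. n + 1"]) auto
    from infsum_reindex_bij_betw[OF this, of "\<lambda>n. \<phi> (r * (of_int n - x))"]
    show ?thesis by (simp add: F_def algebra_simps)
  qed
  have cont\<phi>: "continuous_on A \<phi>" for A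
    unfolding \<phi>_def by (intro continuous_intros)
  have ul: "uniform_limit {-M<..<M} (\<lambda>n x. \<Sum>i<n. \<phi> (r * (of_int (int_decode i) - x))) F sequentially" for M
    unfolding F_eq by (rule Weierstrass_m_test[OF _ smM[of M]]) (use bound in auto)
  have "continuous_on {-M<..<M} F" for M
    by (rule uniform_limit_theorem[OF _ ul])
      (auto intro!: always_eventually continuous_intros continuous_on_compose2[OF cont\<phi>[of UNIV]])
  then have "isCont F x" for x
    using continuous_on_eq_continuous_at[of "{-(\<bar>x\<bar> + 1)<..<\<bar>x\<bar> + 1}" F]
    by (meson abs_le_iff abs_less_iff greaterThanLessThan_iff less_add_one open_greaterThanLessThan minus_less_iff order_refl le_less_trans)
  then have contF: "continuous_on UNIV F" by (simp add: continuous_on_eq_continuous_at)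
  have coeff: "fourier_coeff F m = Gamma (b + \<i> * of_real (2 * pi / r * of_int m)) / of_real r" for m
  proof -
    define z where "z = b + \<i> * of_real (2 * pi / r * of_int m)"
    define K where "K i = integral {exp (r * (of_int (int_decode i) - 1))..exp (r * of_int (int_decode i))}
       (\<lambda>t. of_real t powr (z - 1) / of_real (exp t))" for i
    define f where "f n x = (\<Sum>i<n. \<phi> (r * (of_int (int_decode i) - x)) * cis (- (2 * pi * of_int m * x)))" for n x
    have "uniform_limit {0..1} f (\<lambda>x. \<Sum>i. \<phi> (r * (of_int (int_decode i) - x)) * cis (- (2 * pi * of_int m * x))) sequentially"
      unfolding f_def by (rule Weierstrass_m_test[OF _ smM[of 1]]) (use bound[where M = 1] in \<open>auto simp: norm_mult\<close>)
    moreover have "(\<Sum>i. \<phi> (r * (of_int (int_decode i) - x)) * cis (- (2 * pi * of_int m * x))) = F x * cis (- (2 * pi * of_int m * x))" for x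
      unfolding F_eq by (rule suminf_mult2[symmetric]) (rule summable_norm_cancel[OF sm])
    ultimately have ul: "uniform_limit {0..1} f (\<lambda>x. F x * cis (- (2 * pi * of_int m * x))) sequentially" by simp
    obtain I J where IJ: "\<And>n. (f n has_integral I n) {0..1}"
       "((\<lambda>x. F x * cis (- (2 * pi * of_int m * x))) has_integral J) {0..1}" "I \<longlonglongrightarrow> J"
      by (rule uniform_limit_integral[OF ul])
        (auto simp: f_def intro!: continuous_intros continuous_on_compose2[OF cont\<phi>[of UNIV]])
    have "((\<lambda>x. f n x) has_integral (\<Sum>i<n. K i / of_real r)) {0..1}" for n
      unfolding f_def \<phi>_def K_def z_def
      by (intro has_integral_sum integral_exp_substitution r) auto
    then have I: "I n = (\<Sum>i<n. K i / of_real r)" for n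
      using has_integral_unique[OF IJ(1)] by blast
    have "(\<lambda>i. K i / of_real r) sums J" using IJ(3) unfolding I sums_def .
    then have "(\<lambda>i. of_real r * (K i / of_real r)) sums (of_real r * J)" by (rule sums_mult)
    then have "K sums (of_real r * J)" using r by simp
    moreover have "Gamma z = suminf K"
      unfolding K_def by (rule Gamma_eq_suminf[OF r]) (use \<beta> in \<open>simp add: z_def\<close>)
    ultimately have "Gamma z = of_real r * J" by (simp add: sums_iff)
    then show ?thesis using r IJ(2) by (simp add: fourier_coeff_def integral_unique z_def)
  qed
  have smc: "summable (\<lambda>n. norm (fourier_coeff F (int_decode n)))"
    unfolding coeff norm_divide
    by (intro summable_divide summable_Gamma_vertical \<beta>) (use r in simp)
  have "F (\<sigma> / r) = (\<Sum>\<^sub>\<infinity>k\<in>UNIV. fourier_coeff F k * cis (2 * pi * of_int k * (\<sigma> / r)))"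
    by (rule fourier_series_eq[OF per contF smc])
  also have "\<dots> = (\<Sum>\<^sub>\<infinity>k\<in>UNIV. 1 / of_real r * (Gamma ((a + 2 * pi * \<i> * of_int k) / of_real r)
        * exp (2 * pi * \<i> * of_int k * of_real \<sigma> / of_real r)))"
    unfolding coeff b_def by (intro infsum_cong) (simp add: cis_conv_exp add_divide_distrib mult_ac)
  also have "\<dots> = per r a \<sigma>"
    unfolding per_def by (rule infsum_cmult_right')
  finally have "per r a \<sigma> = F (\<sigma> / r)" ..
  also have "\<dots> = (\<Sum>\<^sub>\<infinity>n\<in>UNIV. \<phi> (r * of_int n - \<sigma>))"
    using r by (simp add: F_def right_diff_distrib)
  finally show ?thesis by (simp add: \<phi>_def b_def)
qed

lemma per_times_powr:
  fixes s :: complex and \<kappa> t :: real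
  assumes "\<kappa> > 0" "t > 0" "Re s > 0"
  shows "per (2 * \<kappa>) (s * of_real \<kappa>) (- ln t) * of_real t powr (- s / 2) =
    (\<Sum>\<^sub>\<infinity>n\<in>(UNIV :: int set). exp (of_real (\<kappa> * of_int n) * s) * of_real (exp (- (t * exp (2 * \<kappa> * of_int n)))))"
proof -
  have "per (2 * \<kappa>) (s * of_real \<kappa>) (- ln t) * of_real t powr (- s / 2) =
     (\<Sum>\<^sub>\<infinity>n\<in>(UNIV :: int set). of_real t powr (- s / 2) * (exp (s * of_real \<kappa> / of_real (2 * \<kappa>) * of_real (2 * \<kappa> * of_int n - (- ln t))) * of_real (exp (- exp (2 * \<kappa> * of_int n - (- ln t))))))"
    by (subst per_eq_infsum) (use assms in \<open>auto simp: infsum_cmult_right' mult.commute[of _ "of_real t powr _"]\<close>)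
  also have "\<dots> = (\<Sum>\<^sub>\<infinity>n\<in>(UNIV :: int set). exp (of_real (\<kappa> * of_int n) * s) * of_real (exp (- (t * exp (2 * \<kappa> * of_int n)))))"
  proof (rule infsum_cong)
    fix n :: int
    have "s * of_real \<kappa> / of_real (2 * \<kappa>) = s / 2" using assms by simp
    moreover have "of_real t powr (- s / 2) = exp (- s / 2 * of_real (ln t))"
      using assms by (simp add: powr_def Ln_of_real)
    ultimately have "of_real t powr (- s / 2) * exp (s * of_real \<kappa> / of_real (2 * \<kappa>) * of_real (2 * \<kappa> * of_int n - (- ln t))) =
        exp (- s / 2 * of_real (ln t) + s / 2 * of_real (2 * \<kappa> * of_int n + ln t))"
      by (simp only: exp_add[symmetric] diff_minus_eq_add)
    also have "\<dots> = exp (of_real (\<kappa> * of_int n) * s)" by (simp add: algebra_simps)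
    finally have 1: "of_real t powr (- s / 2) * exp (s * of_real \<kappa> / of_real (2 * \<kappa>) * of_real (2 * \<kappa> * of_int n - (- ln t))) = exp (of_real (\<kappa> * of_int n) * s)" .
    have "exp (2 * \<kappa> * of_int n - (- ln t)) = t * exp (2 * \<kappa> * of_int n)"
      using assms by (simp add: exp_add)
    with 1 show "of_real t powr (- s / 2) * (exp (s * of_real \<kappa> / of_real (2 * \<kappa>) * of_real (2 * \<kappa> * of_int n - (- ln t))) * of_real (exp (- exp (2 * \<kappa> * of_int n - (- ln t))))) =
      exp (of_real (\<kappa> * of_int n) * s) * of_real (exp (- (t * exp (2 * \<kappa> * of_int n))))"
      by (simp only: mult.assoc[symmetric])
  qed
  finally show ?thesis .
qed

lemma abs_power_le_exp:
  fixes \<epsilon> :: real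
  assumes "\<epsilon> > 0"
  obtains D where "D > 0" "\<And>x::real. \<bar>x\<bar> ^ i \<le> D * exp (\<epsilon> * \<bar>x\<bar>)"
proof (cases "i = 0")
  case False
  show ?thesis
  proof
    show "(real i / \<epsilon>) ^ i > 0" using False assms by simp
    fix x :: real
    have "(\<epsilon> * \<bar>x\<bar> / real i) ^ i \<le> (1 + \<epsilon> * \<bar>x\<bar> / real i) ^ i" using assms by (intro power_mono) auto
    also have "\<dots> \<le> exp (\<epsilon> * \<bar>x\<bar>)" using False assms
      by (intro exp_ge_one_plus_x_over_n_power_n) (auto intro: order_trans[of _ 0])
    finally have "(real i / \<epsilon>) ^ i * (\<epsilon> * \<bar>x\<bar> / real i) ^ i \<le> (real i / \<epsilon>) ^ i * exp (\<epsilon> * \<bar>x\<bar>)"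
      using assms by (intro mult_left_mono) auto
    then show "\<bar>x\<bar> ^ i \<le> (real i / \<epsilon>) ^ i * exp (\<epsilon> * \<bar>x\<bar>)"
      using False assms by (simp add: power_mult_distrib[symmetric])
  qed
qed (use that[of 1] assms in auto)

lemma lattice_term_bound:
  fixes \<kappa> t \<sigma> :: real
  assumes "\<kappa> > 0" "t > 0" "\<sigma> > 0"
  obtains D where "\<And>n::int. \<bar>\<kappa> * of_int n\<bar> ^ i * exp (\<kappa> * of_int n * \<sigma>) * exp (- (t * exp (2 * \<kappa> * of_int n))) \<le> D * exp (- (\<sigma> * \<kappa> / 2 * \<bar>of_int n\<bar>))"
proof -
  obtain C where C: "\<And>y. exp (\<sigma> / 2 * y) * exp (- exp y) \<le> C * exp (- (\<sigma> / 2 * \<bar>y\<bar>))" "C > 0"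
    using norm_exp_exp_bound[of "\<sigma> / 2"] assms by auto
  obtain D where D: "D > 0" "\<And>x::real. \<bar>x\<bar> ^ i \<le> D * exp (\<sigma> / 2 * \<bar>x\<bar>)"
    using abs_power_le_exp[of "\<sigma> / 2" i] assms by auto
  define E where "E = C * exp (- (\<sigma> / 2 * ln t)) * exp (\<sigma> / 2 * \<bar>ln t\<bar>)"
  show ?thesis
  proof
    fix n :: int
    define y where "y = 2 * \<kappa> * of_int n + ln t"
    have ey: "exp y = t * exp (2 * \<kappa> * of_int n)" using assms by (simp add: y_def exp_add)
    have "exp (\<kappa> * of_int n * \<sigma>) * exp (- exp y) = exp (- (\<sigma> / 2 * ln t)) * (exp (\<sigma> / 2 * y) * exp (- exp y))"
      by (simp add: y_def exp_add[symmetric] algebra_simps)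
    also have "\<dots> \<le> exp (- (\<sigma> / 2 * ln t)) * (C * exp (- (\<sigma> / 2 * \<bar>y\<bar>)))"
      using C(1) by (intro mult_left_mono) auto
    also have "\<dots> \<le> exp (- (\<sigma> / 2 * ln t)) * (C * exp (\<sigma> / 2 * \<bar>ln t\<bar> - \<sigma> * \<kappa> * \<bar>of_int n\<bar>))"
    proof (intro mult_left_mono)
      have "2 * \<kappa> * \<bar>of_int n\<bar> = \<bar>2 * \<kappa> * of_int n\<bar>" using assms by (simp add: abs_mult)
      also have "\<dots> \<le> \<bar>y\<bar> + \<bar>ln t\<bar>" unfolding y_def by linarith
      finally have "\<sigma> / 2 * (2 * \<kappa> * \<bar>of_int n\<bar>) \<le> \<sigma> / 2 * (\<bar>y\<bar> + \<bar>ln t\<bar>)"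
        using assms by (intro mult_left_mono) auto
      then show "exp (- (\<sigma> / 2 * \<bar>y\<bar>)) \<le> exp (\<sigma> / 2 * \<bar>ln t\<bar> - \<sigma> * \<kappa> * \<bar>of_int n\<bar>)"
        by (simp add: algebra_simps)
    qed (use C in auto)
    also have "\<dots> = E * exp (- (\<sigma> * \<kappa> * \<bar>of_int n\<bar>))"
      by (simp only: E_def exp_diff exp_minus divide_inverse mult_ac)
    finally have 1: "exp (\<kappa> * of_int n * \<sigma>) * exp (- exp y) \<le> E * exp (- (\<sigma> * \<kappa> * \<bar>of_int n\<bar>))" .
    have "\<bar>\<kappa> * of_int n\<bar> ^ i * (exp (\<kappa> * of_int n * \<sigma>) * exp (- exp y)) \<le>
       (D * exp (\<sigma> / 2 * \<bar>\<kappa> * of_int n\<bar>)) * (E * exp (- (\<sigma> * \<kappa> * \<bar>of_int n\<bar>)))"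
      using D by (intro mult_mono 1 D(2)) auto
    also have "\<dots> = (D * E) * (exp (\<sigma> / 2 * \<bar>\<kappa> * of_int n\<bar>) * exp (- (\<sigma> * \<kappa> * \<bar>of_int n\<bar>)))"
      by (simp only: mult_ac)
    also have "exp (\<sigma> / 2 * \<bar>\<kappa> * of_int n\<bar>) * exp (- (\<sigma> * \<kappa> * \<bar>of_int n\<bar>)) = exp (- (\<sigma> * \<kappa> / 2 * \<bar>of_int n\<bar>))"
      using assms by (simp add: exp_add[symmetric] abs_mult)
    finally show "\<bar>\<kappa> * of_int n\<bar> ^ i * exp (\<kappa> * of_int n * \<sigma>) * exp (- (t * exp (2 * \<kappa> * of_int n))) \<le> (D * E) * exp (- (\<sigma> * \<kappa> / 2 * \<bar>of_int n\<bar>))"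
      by (simp add: ey mult.assoc)
  qed
qed

definition lattice_term :: "real \<Rightarrow> real \<Rightarrow> nat \<Rightarrow> complex \<Rightarrow> int \<Rightarrow> complex" where
  "lattice_term \<kappa> t i s n = of_real (\<kappa> * of_int n) ^ i * exp (of_real (\<kappa> * of_int n) * s) * of_real (exp (- (t * exp (2 * \<kappa> * of_int n))))"

lemma lattice_term_dominated:
  assumes "\<kappa> > 0" "t > 0" "Re s0 > 0"
  obtains M where "summable M" "\<And>n s. dist s s0 \<le> Re s0 / 4 \<Longrightarrow> norm (lattice_term \<kappa> t i s (int_decode n)) \<le> M n"
proof -
  define \<sigma> where "\<sigma> = Re s0"
  obtain D where D: "\<And>n::int. \<bar>\<kappa> * of_int n\<bar> ^ i * exp (\<kappa> * of_int n * \<sigma>) * exp (- (t * exp (2 * \<kappa> * of_int n))) \<le> D * exp (- (\<sigma> * \<kappa> / 2 * \<bar>of_int n\<bar>))"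
    using lattice_term_bound[of \<kappa> t \<sigma> i] assms by (auto simp: \<sigma>_def)
  show ?thesis
  proof
    show "summable (\<lambda>n. D * exp (- (\<sigma> * \<kappa> / 4 * \<bar>of_int (int_decode n)\<bar>)))"
      using assms by (intro summable_mult summable_exp_neg_abs_int_decode) (simp add: \<sigma>_def)
    fix n s assume s: "dist s s0 \<le> Re s0 / 4"
    define k where "k = int_decode n"
    have "\<bar>Re s - \<sigma>\<bar> \<le> \<sigma> / 4"
      using s abs_Re_le_cmod[of "s - s0"] by (simp add: dist_norm \<sigma>_def)
    then have "\<bar>\<kappa> * of_int k\<bar> * \<bar>Re s - \<sigma>\<bar> \<le> \<bar>\<kappa> * of_int k\<bar> * (\<sigma> / 4)"
      by (rule mult_left_mono) simp
    then have "(\<kappa> * of_int k) * (Re s - \<sigma>) \<le> \<bar>\<kappa> * of_int k\<bar> * (\<sigma> / 4)"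
      using abs_ge_self[of "(\<kappa> * of_int k) * (Re s - \<sigma>)"] by (simp only: abs_mult)
    then have "exp (\<kappa> * of_int k * Re s) \<le> exp (\<kappa> * of_int k * \<sigma> + \<sigma> * \<kappa> / 4 * \<bar>of_int k\<bar>)"
      using assms by (simp add: algebra_simps abs_mult)
    also have "\<dots> = exp (\<kappa> * of_int k * \<sigma>) * exp (\<sigma> * \<kappa> / 4 * \<bar>of_int k\<bar>)" by (rule exp_add)
    finally have e: "exp (\<kappa> * of_int k * Re s) \<le> exp (\<kappa> * of_int k * \<sigma>) * exp (\<sigma> * \<kappa> / 4 * \<bar>of_int k\<bar>)" .
    have "norm (lattice_term \<kappa> t i s k) = \<bar>\<kappa> * of_int k\<bar> ^ i * exp (\<kappa> * of_int k * Re s) * exp (- (t * exp (2 * \<kappa> * of_int k)))"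
      by (simp add: lattice_term_def norm_mult norm_power abs_mult)
    also have "\<dots> \<le> \<bar>\<kappa> * of_int k\<bar> ^ i * (exp (\<kappa> * of_int k * \<sigma>) * exp (\<sigma> * \<kappa> / 4 * \<bar>of_int k\<bar>)) * exp (- (t * exp (2 * \<kappa> * of_int k)))"
      by (intro mult_mono order_refl e) auto
    also have "\<dots> = (\<bar>\<kappa> * of_int k\<bar> ^ i * exp (\<kappa> * of_int k * \<sigma>) * exp (- (t * exp (2 * \<kappa> * of_int k)))) * exp (\<sigma> * \<kappa> / 4 * \<bar>of_int k\<bar>)"
      by (simp only: mult_ac)
    also have "\<dots> \<le> (D * exp (- (\<sigma> * \<kappa> / 2 * \<bar>of_int k\<bar>))) * exp (\<sigma> * \<kappa> / 4 * \<bar>of_int k\<bar>)"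
      by (intro mult_right_mono D) auto
    also have "\<dots> = D * exp (- (\<sigma> * \<kappa> / 4 * \<bar>of_int k\<bar>))"
      by (simp add: mult.assoc exp_add[symmetric])
    finally show "norm (lattice_term \<kappa> t i s (int_decode n)) \<le> D * exp (- (\<sigma> * \<kappa> / 4 * \<bar>of_int (int_decode n)\<bar>))"
      by (simp add: k_def)
  qed
qed

lemma lattice_term_summable:
  assumes "\<kappa> > 0" "t > 0" "Re s > 0"
  shows "summable (\<lambda>n. norm (lattice_term \<kappa> t i s (int_decode n)))"
proof -
  obtain M where "summable M" "\<And>n s'. dist s' s \<le> Re s / 4 \<Longrightarrow> norm (lattice_term \<kappa> t i s' (int_decode n)) \<le> M n"
    using lattice_term_dominated[OF assms, of i] by metis
  then show ?thesis using assms
    by (intro summable_comparison_test[of "\<lambda>n. norm (lattice_term \<kappa> t i s (int_decode n))" M]) auto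
qed

lemma lattice_sum_has_field_derivative:
  assumes "\<kappa> > 0" "t > 0" "Re s0 > 0"
  shows "((\<lambda>s. \<Sum>n. lattice_term \<kappa> t i s (int_decode n)) has_field_derivative (\<Sum>n. lattice_term \<kappa> t (Suc i) s0 (int_decode n))) (at s0)"
proof -
  obtain M where M: "summable M" "\<And>n s. dist s s0 \<le> Re s0 / 4 \<Longrightarrow> norm (lattice_term \<kappa> t (Suc i) s (int_decode n)) \<le> M n"
    using lattice_term_dominated[OF assms, of "Suc i"] by metis
  show ?thesis
  proof (rule has_field_derivative_series'(2))
    show "uniformly_convergent_on (ball s0 (Re s0 / 4)) (\<lambda>n s. \<Sum>i'<n. lattice_term \<kappa> t (Suc i) s (int_decode i'))"
      by (rule Weierstrass_m_test'[OF _ M(1)]) (use M(2) in \<open>auto simp: dist_commute less_imp_le\<close>)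
    show "s0 \<in> ball s0 (Re s0 / 4)" "s0 \<in> interior (ball s0 (Re s0 / 4))" using assms by auto
    show "summable (\<lambda>n. lattice_term \<kappa> t i s0 (int_decode n))"
      by (rule summable_norm_cancel[OF lattice_term_summable[OF assms]])
  qed (auto simp: lattice_term_def intro!: derivative_eq_intros)
qed

lemma higher_deriv_per_times_powr:
  assumes "\<kappa> > 0" "t > 0" "Re s > 0"
  shows "(deriv ^^ i) (\<lambda>s. per (2 * \<kappa>) (s * of_real \<kappa>) (- ln t) * of_real t powr (- s / 2)) s =
    (\<Sum>n. lattice_term \<kappa> t i s (int_decode n))"
  using assms(3)
proof (induction i arbitrary: s)
  case 0
  have "per (2 * \<kappa>) (s * of_real \<kappa>) (- ln t) * of_real t powr (- s / 2) = (\<Sum>\<^sub>\<infinity>n\<in>UNIV. lattice_term \<kappa> t 0 s n)"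
    unfolding per_times_powr[OF assms(1,2) 0] by (simp add: lattice_term_def)
  also have "\<dots> = (\<Sum>n. lattice_term \<kappa> t 0 s (int_decode n))"
    by (rule infsum_int_decode(2)[OF lattice_term_summable[OF assms(1,2) 0]])
  finally show ?case by simp
next
  case (Suc i s)
  let ?F = "\<lambda>s. per (2 * \<kappa>) (s * of_real \<kappa>) (- ln t) * of_real t powr (- s / 2)"
  have "eventually (\<lambda>s. s \<in> {s. Re s > 0}) (nhds s)"
    using Suc.prems by (intro eventually_nhds_in_open open_halfspace_Re_gt) auto
  then have "eventually (\<lambda>s. (deriv ^^ i) ?F s = (\<Sum>n. lattice_term \<kappa> t i s (int_decode n))) (nhds s)"
    by eventually_elim (rule Suc.IH, simp)
  then have "deriv ((deriv ^^ i) ?F) s = deriv (\<lambda>s. \<Sum>n. lattice_term \<kappa> t i s (int_decode n)) s"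
    by (intro deriv_cong_ev) auto
  also have "\<dots> = (\<Sum>n. lattice_term \<kappa> t (Suc i) s (int_decode n))"
    by (rule DERIV_imp_deriv[OF lattice_sum_has_field_derivative[OF assms(1,2) Suc.prems]])
  finally show ?case by simp
qed

lemma poly_deriv_per_times_powr:
  fixes Q :: "complex poly"
  assumes "\<kappa> > 0" "t > 0" "Re s > 0"
  defines "g \<equiv> \<lambda>n. poly Q (of_int n) * exp (of_real (\<kappa> * of_int n) * s) * of_real (exp (- (t * exp (2 * \<kappa> * of_int n))))"
  shows "poly_deriv Q (1 / of_real \<kappa>) (\<lambda>s. per (2 * \<kappa>) (s * of_real \<kappa>) (- ln t) * of_real t powr (- s / 2)) s =
    (\<Sum>n. g (int_decode n))"
    and "summable (\<lambda>n. norm (g (int_decode n)))"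
proof -
  have g: "g n = (\<Sum>i\<le>degree Q. coeff Q i * (1 / of_real \<kappa>) ^ i * lattice_term \<kappa> t i s n)" for n
    unfolding g_def poly_altdef sum_distrib_right
    by (rule sum.cong) (use assms(1) in \<open>auto simp: lattice_term_def power_mult_distrib field_simps\<close>)
  note sm = lattice_term_summable[OF assms(1-3)]
  note sm' = summable_norm_cancel[OF sm]
  show "poly_deriv Q (1 / of_real \<kappa>) (\<lambda>s. per (2 * \<kappa>) (s * of_real \<kappa>) (- ln t) * of_real t powr (- s / 2)) s =
    (\<Sum>n. g (int_decode n))"
    unfolding poly_deriv_def higher_deriv_per_times_powr[OF assms(1-3)] g
    by (subst suminf_sum) (auto intro!: sum.cong summable_mult sm' simp: suminf_mult[OF sm'])
  show "summable (\<lambda>n. norm (g (int_decode n)))"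
  proof (rule summable_comparison_test)
    show "summable (\<lambda>n. \<Sum>i\<le>degree Q. norm (coeff Q i * (1 / of_real \<kappa>) ^ i) * norm (lattice_term \<kappa> t i s (int_decode n)))"
      by (intro summable_sum summable_mult sm)
    have "norm (g k) \<le> (\<Sum>i\<le>degree Q. norm (coeff Q i * (1 / of_real \<kappa>) ^ i) * norm (lattice_term \<kappa> t i s k))" for k
      unfolding g norm_mult[symmetric] by (rule norm_sum)
    then show "\<exists>N. \<forall>n\<ge>N. norm (norm (g (int_decode n))) \<le> (\<Sum>i\<le>degree Q. norm (coeff Q i * (1 / of_real \<kappa>) ^ i) * norm (lattice_term \<kappa> t i s (int_decode n)))"
      by auto
  qed
qed

lemma int_sum_split:
  fixes f :: "int \<Rightarrow> complex"
  assumes "summable (\<lambda>n. norm (f (int_decode n)))"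
  shows "summable (\<lambda>m. norm (f (N + int m)))" "summable (\<lambda>m. norm (f (N - 1 - int m)))"
    and "(\<Sum>n. f (int_decode n)) = (\<Sum>m. f (N + int m)) + (\<Sum>m. f (N - 1 - int m))"
proof -
  have abs: "(\<lambda>n. norm (f n)) summable_on A" for A
    using infsum_int_decode(1)[of "\<lambda>n. norm (f n)"] assms summable_on_subset_banach[of "\<lambda>n. norm (f n)" UNIV A] by auto
  have smb: "f summable_on A" for A using abs_summable_summable[OF abs] .
  have b1: "bij_betw (\<lambda>m. N + int m) UNIV {N..}"
    by (rule bij_betw_byWitness[where f' = "\<lambda>n. nat (n - N)"]) auto
  have b2: "bij_betw (\<lambda>m. N - 1 - int m) UNIV {..<N}"
    by (rule bij_betw_byWitness[where f' = "\<lambda>n. nat (N - 1 - n)"]) auto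
  have nat: "summable (\<lambda>m. norm (f (h m))) \<and> infsum f B = (\<Sum>m. f (h m))" if "bij_betw h UNIV B" for h :: "nat \<Rightarrow> int" and B
  proof
    have "(\<lambda>m. norm (f (h m))) summable_on UNIV"
      using abs[of B] summable_on_reindex_bij_betw[OF that, of "\<lambda>n. norm (f n)"] by simp
    then show "summable (\<lambda>m. norm (f (h m)))"
      by (auto simp: summable_on_def dest!: has_sum_imp_sums intro: sums_summable)
    have "((\<lambda>m. f (h m)) has_sum infsum f B) UNIV"
      using has_sum_infsum[OF smb[of B]] has_sum_reindex_bij_betw[OF that, of f] by simp
    then show "infsum f B = (\<Sum>m. f (h m))"
      by (auto dest!: has_sum_imp_sums simp: sums_iff)
  qed
  show "summable (\<lambda>m. norm (f (N + int m)))" "summable (\<lambda>m. norm (f (N - 1 - int m)))"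
    using nat[OF b1] nat[OF b2] by auto
  have "(\<Sum>n. f (int_decode n)) = infsum f UNIV" using infsum_int_decode(2)[of f] assms by simp
  also have "UNIV = {N..} \<union> {..<N}" by auto
  also have "infsum f \<dots> = infsum f {N..} + infsum f {..<N}"
    by (rule infsum_Un_disjoint) (auto intro: smb)
  finally show "(\<Sum>n. f (int_decode n)) = (\<Sum>m. f (N + int m)) + (\<Sum>m. f (N - 1 - int m))"
    using nat[OF b1] nat[OF b2] by simp
qed

section \<open>Regularity of exponential series\<close>

lemma has_vector_derivative_series:
  fixes f :: "nat \<Rightarrow> real \<Rightarrow> 'a :: banach"
  assumes "convex S" "open S" "x \<in> S"
    and d: "\<And>n x. x \<in> S \<Longrightarrow> (f n has_vector_derivative f' n x) (at x)"
    and M: "summable M" "\<And>n x. x \<in> S \<Longrightarrow> norm (f' n x) \<le> M n"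
    and sm: "\<And>x. x \<in> S \<Longrightarrow> summable (\<lambda>n. f n x)"
  shows "((\<lambda>x. \<Sum>n. f n x) has_vector_derivative (\<Sum>n. f' n x)) (at x)"
proof -
  have ul: "uniform_limit S (\<lambda>n x. \<Sum>i<n. f' i x) (\<lambda>x. \<Sum>n. f' n x) sequentially"
    by (rule Weierstrass_m_test[OF M(2) M(1)])
  have "\<exists>g. \<forall>x\<in>S. (\<lambda>n. f n x) sums g x \<and> (g has_derivative (\<lambda>h. h *\<^sub>R (\<Sum>n. f' n x))) (at x within S)"
  proof (rule has_derivative_series[OF assms(1)])
    show "(f n has_derivative (\<lambda>h. h *\<^sub>R f' n x)) (at x within S)" if "x \<in> S" for n x
      using d[OF that] by (auto simp: has_vector_derivative_def intro: has_derivative_at_withinI)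
    show "(\<lambda>n. f n x) sums (\<Sum>n. f n x)" using sm[OF assms(3)] by (rule summable_sums)
    show "\<forall>\<^sub>F n in sequentially. \<forall>x\<in>S. \<forall>h. norm ((\<Sum>i<n. h *\<^sub>R f' i x) - h *\<^sub>R (\<Sum>n. f' n x)) \<le> e * norm h"
      if "e > 0" for e
      using uniform_limitD[OF ul that]
    proof eventually_elim
      case (elim n)
      show ?case
      proof (intro ballI allI)
        fix x h assume "x \<in> S"
        have "norm ((\<Sum>i<n. h *\<^sub>R f' i x) - h *\<^sub>R (\<Sum>n. f' n x)) = norm ((\<Sum>i<n. f' i x) - (\<Sum>n. f' n x)) * norm h"
          by (simp add: scaleR_right.sum[symmetric] scaleR_diff_right[symmetric])
        also have "\<dots> \<le> e * norm h"
          using elim \<open>x \<in> S\<close> by (intro mult_right_mono) (auto simp: dist_norm less_imp_le)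
        finally show "norm ((\<Sum>i<n. h *\<^sub>R f' i x) - h *\<^sub>R (\<Sum>n. f' n x)) \<le> e * norm h" .
      qed
    qed
  qed (rule assms(3))
  then obtain g where g: "\<And>x. x \<in> S \<Longrightarrow> (\<lambda>n. f n x) sums g x"
     "\<And>x. x \<in> S \<Longrightarrow> (g has_derivative (\<lambda>h. h *\<^sub>R (\<Sum>n. f' n x))) (at x within S)" by blast
  have "(g has_vector_derivative (\<Sum>n. f' n x)) (at x)"
    using g(2)[OF assms(3)] unfolding has_vector_derivative_def at_within_open[OF assms(3,2)] .
  then show ?thesis
    by (rule has_vector_derivative_transform_within_open[OF _ assms(2,3)]) (use g(1) in \<open>auto simp: sums_iff\<close>)
qed

lemma Ck_on_cong:
  assumes "open U" "\<And>x. x \<in> U \<Longrightarrow> f x = f' x" "Ck_on k f U"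
  shows "Ck_on k f' U"
proof -
  obtain g where g: "g 0 = f" "\<And>i x. i < k \<Longrightarrow> x \<in> U \<Longrightarrow> (g i has_vector_derivative g (Suc i) x) (at x)"
    "continuous_on U (g k)" using assms(3) by (auto simp: Ck_on_def)
  have "((g(0 := f')) i has_vector_derivative (g(0 := f')) (Suc i) x) (at x)" if "i < k" "x \<in> U" for i x
    using g(2)[OF that] that assms(2) g(1)
    by (cases "i = 0") (auto intro: has_vector_derivative_transform_within_open[OF _ assms(1)])
  moreover have "continuous_on U ((g(0 := f')) k)"
    using g(3) assms(2) g(1) by (cases "k = 0") (auto intro: continuous_on_eq)
  ultimately show ?thesis unfolding Ck_on_def by (intro exI[of _ "g(0 := f')"]) auto
qed

lemma Ck_on_add:
  assumes "Ck_on k f U" "Ck_on k g U" shows "Ck_on k (\<lambda>x. f x + g x) U"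
proof -
  obtain f' where f: "f' 0 = f" "\<And>i x. i < k \<Longrightarrow> x \<in> U \<Longrightarrow> (f' i has_vector_derivative f' (Suc i) x) (at x)"
    "continuous_on U (f' k)" using assms(1) by (auto simp: Ck_on_def)
  obtain g' where g: "g' 0 = g" "\<And>i x. i < k \<Longrightarrow> x \<in> U \<Longrightarrow> (g' i has_vector_derivative g' (Suc i) x) (at x)"
    "continuous_on U (g' k)" using assms(2) by (auto simp: Ck_on_def)
  show ?thesis unfolding Ck_on_def
    by (rule exI[of _ "\<lambda>i x. f' i x + g' i x"])
      (use f g in \<open>auto intro!: has_vector_derivative_add continuous_on_add\<close>)
qed

lemma Ck_on_suminf:
  fixes g :: "nat \<Rightarrow> nat \<Rightarrow> real \<Rightarrow> complex"
  assumes U: "open U"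
    and deriv: "\<And>i n x. i < k \<Longrightarrow> x \<in> U \<Longrightarrow> (g i n has_vector_derivative g (Suc i) n x) (at x)"
    and cont: "\<And>n. continuous_on U (g k n)"
    and dom: "\<And>i x. i \<le> k \<Longrightarrow> x \<in> U \<Longrightarrow> \<exists>\<delta>>0. \<exists>M. summable M \<and> (\<forall>n. \<forall>y\<in>ball x \<delta>. norm (g i n y) \<le> M n)"
  shows "Ck_on k (\<lambda>x. \<Sum>n. g 0 n x) U"
proof -
  have loc: "\<exists>\<delta>>0. ball x \<delta> \<subseteq> U \<and> (\<exists>M. summable M \<and> (\<forall>n. \<forall>y\<in>ball x \<delta>. norm (g i n y) \<le> M n))"
    if x: "x \<in> U" and i: "i \<le> k" for x i
  proof -
    obtain \<delta>1 M where 1: "\<delta>1 > 0" "summable M" "\<forall>n. \<forall>y\<in>ball x \<delta>1. norm (g i n y) \<le> M n" using dom[OF i x] by blast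
    obtain \<delta>2 where 2: "\<delta>2 > 0" "ball x \<delta>2 \<subseteq> U" using U x open_contains_ball by blast
    show ?thesis using 1 2
      by (intro exI[of _ "min \<delta>1 \<delta>2"] conjI exI[of _ M]) auto
  qed
  have sm: "summable (\<lambda>n. g i n x)" if x: "x \<in> U" and i: "i \<le> k" for x i
  proof -
    obtain \<delta> M where "\<delta> > 0" "summable M" "\<forall>n. \<forall>y\<in>ball x \<delta>. norm (g i n y) \<le> M n" using dom[OF i x] by blast
    then show ?thesis by (intro summable_comparison_test[OF _ \<open>summable M\<close>]) auto
  qed
  show ?thesis unfolding Ck_on_def
  proof (intro exI[of _ "\<lambda>i x. \<Sum>n. g i n x"] conjI allI impI ballI)
    fix i x assume ix: "i < k" "x \<in> U"
    obtain \<delta> M where d: "\<delta> > 0" "ball x \<delta> \<subseteq> U" "summable M" "\<forall>n. \<forall>y\<in>ball x \<delta>. norm (g (Suc i) n y) \<le> M n"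
      using loc[OF ix(2), of "Suc i"] ix(1) by auto
    show "((\<lambda>x. \<Sum>n. g i n x) has_vector_derivative (\<Sum>n. g (Suc i) n x)) (at x)"
    proof (rule has_vector_derivative_series[OF _ _ _ _ d(3)])
      show "(g i n has_vector_derivative g (Suc i) n y) (at y)" if "y \<in> ball x \<delta>" for n y
        using deriv[OF ix(1)] that d(2) by blast
      show "summable (\<lambda>n. g i n y)" if "y \<in> ball x \<delta>" for y
        by (rule sm) (use that d(2) ix in auto)
    qed (use d in auto)
  next
    have "isCont (\<lambda>x. \<Sum>n. g k n x) x" if x: "x \<in> U" for x
    proof -
      obtain \<delta> M where d: "\<delta> > 0" "ball x \<delta> \<subseteq> U" "summable M" "\<forall>n. \<forall>y\<in>ball x \<delta>. norm (g k n y) \<le> M n"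
        using loc[OF x, of k] by auto
      have ul: "uniform_limit (ball x \<delta>) (\<lambda>n y. \<Sum>i<n. g k i y) (\<lambda>y. \<Sum>n. g k n y) sequentially"
        by (rule Weierstrass_m_test[OF _ d(3)]) (use d(4) in auto)
      have "continuous_on (ball x \<delta>) (\<lambda>x. \<Sum>n. g k n x)"
        by (rule uniform_limit_theorem[OF _ ul])
          (auto intro!: always_eventually continuous_on_sum continuous_on_subset[OF cont d(2)])
      then show ?thesis using d(1) by (simp add: continuous_on_eq_continuous_at)
    qed
    then show "continuous_on U (\<lambda>x. \<Sum>n. g k n x)" using U by (simp add: continuous_on_eq_continuous_at)
  qed simp
qed

text \<open>Continuing \<open>exp (- y)\<close> to \<open>y < 0\<close> by its Taylor polynomial of degree \<open>m\<close> keeps the growth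
  polynomial, at the price of being only \<open>m\<close> times differentiable.\<close>

definition taylor_exp :: "nat \<Rightarrow> real \<Rightarrow> real" where
  "taylor_exp m y = (if y \<ge> 0 then exp (- y) else (\<Sum>i\<le>m. (- y) ^ i / fact i))"

lemma continuous_on_taylor_exp: "continuous_on UNIV (taylor_exp m)"
proof -
  have "continuous_on ({0..} \<union> {..0}) (\<lambda>y::real. if y \<ge> 0 then exp (- y) else (\<Sum>i\<le>m. (- y) ^ i / fact i))"
  proof (rule continuous_on_If)
    show "exp (- y) = (\<Sum>i\<le>m. (- y) ^ i / fact i)" if "y \<in> {..0}" "y \<ge> 0" for y :: real
    proof -
      have "y = 0" using that by simp
      then show ?thesis by (simp add: sum.atMost_shift)
    qed
    then show "exp (- y) = (\<Sum>i\<le>m. (- y) ^ i / fact i)" if "y \<in> {0..}" "\<not> y \<ge> 0" for y :: real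
      using that by simp
  qed (auto intro!: continuous_intros)
  moreover have "{0..} \<union> {..0} = (UNIV :: real set)" by auto
  ultimately show ?thesis by (simp add: taylor_exp_def [abs_def])
qed

lemma taylor_exp_has_derivative:
  "(taylor_exp (Suc m) has_real_derivative - taylor_exp m y) (at y)"
proof -
  define p where "p y = (\<Sum>i\<le>Suc m. (- y) ^ i / fact i)" for y :: real
  define q where "q y = (\<Sum>i\<le>m. (- y) ^ i / fact i)" for y :: real
  have p: "(p has_real_derivative - q y) (at y)" for y
  proof -
    have eq: "p = (\<lambda>y. 1 + (\<Sum>i\<le>m. (- y) ^ Suc i / fact (Suc i)))"
      unfolding p_def sum.atMost_Suc_shift by simp
    have "((\<lambda>y. (- y) ^ Suc i / fact (Suc i)) has_real_derivative - ((- y) ^ i / fact i)) (at y)" for i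
    proof -
      have "((\<lambda>y. (- y) ^ Suc i) has_real_derivative real (Suc i) * (- y) ^ i * (- 1)) (at y)"
      proof -
        have "((\<lambda>y::real. - y) has_real_derivative - 1) (at y)" by (auto intro!: derivative_eq_intros)
        from DERIV_power[OF this, of "Suc i"] show ?thesis by (simp del: power_Suc)
      qed
      then have "((\<lambda>y. (- y) ^ Suc i / fact (Suc i)) has_real_derivative real (Suc i) * (- y) ^ i * (- 1) / fact (Suc i)) (at y)"
        by (rule DERIV_cdivide)
      moreover have "real (Suc i) * (- y) ^ i * (- 1) / fact (Suc i) = - ((- y) ^ i / fact i)"
        unfolding fact_Suc by (simp del: of_nat_Suc)
      ultimately show ?thesis by simp
    qed
    then have "((\<lambda>y. 1 + (\<Sum>i\<le>m. (- y) ^ Suc i / fact (Suc i))) has_real_derivative 0 + (\<Sum>i\<le>m. - ((- y) ^ i / fact i))) (at y)"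
      by (intro DERIV_add DERIV_const DERIV_sum)
    then show ?thesis unfolding eq by (simp add: q_def sum_negf)
  qed
  consider "y > 0" | "y < 0" | "y = 0" by linarith
  then show ?thesis
  proof cases
    case 1
    have "((\<lambda>y. exp (- y)) has_real_derivative - taylor_exp m y) (at y)"
      using 1 by (auto simp: taylor_exp_def intro!: derivative_eq_intros)
    then show ?thesis
      by (rule has_field_derivative_transform_within_open[where S = "{0<..}"]) (use 1 in \<open>auto simp: taylor_exp_def\<close>)
  next
    case 2
    have "(p has_real_derivative - taylor_exp m y) (at y)"
      using 2 p[of y] by (simp add: taylor_exp_def q_def)
    then show ?thesis
      by (rule has_field_derivative_transform_within_open[where S = "{..<0}"]) (use 2 in \<open>auto simp: taylor_exp_def p_def\<close>)
  next
    case 3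
    have p0: "p 0 = 1" "q 0 = 1" by (simp_all add: p_def q_def sum.atMost_shift sum.atMost_Suc_shift)
    have tp: "taylor_exp (Suc m) y = p y" if "y \<le> 0" for y
      using that p0 by (cases "y = 0") (auto simp: taylor_exp_def p_def simp del: sum.atMost_Suc)
    have "(p has_real_derivative - 1) (at 0 within {..0})"
      using p[of 0] p0 by (simp add: has_field_derivative_at_within)
    then have l: "(taylor_exp (Suc m) has_real_derivative - 1) (at 0 within {..0})"
      by (rule has_field_derivative_transform_within[where d = 1]) (auto simp: tp)
    have "((\<lambda>y. exp (- y)) has_real_derivative - 1) (at 0 within {0..})"
      by (auto intro!: derivative_eq_intros)
    then have r: "(taylor_exp (Suc m) has_real_derivative - 1) (at 0 within {0..})"
      by (rule has_field_derivative_transform_within[where d = 1]) (auto simp: taylor_exp_def)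
    have "(taylor_exp (Suc m) has_real_derivative - 1) (at 0 within {..0} \<union> {0..})"
      using l r unfolding has_field_derivative_iff by (simp add: Lim_within_Un)
    moreover have "{..0} \<union> {0..} = (UNIV :: real set)" by auto
    ultimately show ?thesis using 3 by (simp add: taylor_exp_def)
  qed
qed

lemma abs_taylor_exp_le:
  assumes "x \<ge> 1" "\<bar>t\<bar> \<le> 1"
  shows "\<bar>taylor_exp m (t * x)\<bar> \<le> real (Suc m) * x ^ m"
proof (cases "t \<ge> 0")
  case True
  then have "\<bar>taylor_exp m (t * x)\<bar> \<le> 1" using assms by (simp add: taylor_exp_def)
  also have "\<dots> \<le> real (Suc m) * x ^ m"
    using mult_mono[of 1 "real (Suc m)" 1 "x ^ m"] one_le_power[OF assms(1), of m] by simp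
  finally show ?thesis .
next
  case False
  have "\<bar>taylor_exp m (t * x)\<bar> \<le> (\<Sum>i\<le>m. \<bar>(- (t * x)) ^ i / fact i\<bar>)"
  proof -
    have "taylor_exp m (t * x) = (\<Sum>i\<le>m. (- (t * x)) ^ i / fact i)"
      using False assms by (auto simp: taylor_exp_def zero_le_mult_iff)
    then show ?thesis by (simp only: sum_abs)
  qed
  also have "\<dots> \<le> (\<Sum>i\<le>m. x ^ m)"
  proof (rule sum_mono)
    fix i assume i: "i \<in> {..m}"
    have "\<bar>(- (t * x)) ^ i / fact i\<bar> = \<bar>t * x\<bar> ^ i / fact i" by (simp add: power_abs)
    also have "\<dots> \<le> \<bar>t * x\<bar> ^ i / 1" by (intro divide_left_mono) (auto simp: fact_ge_1)
    also have "\<dots> \<le> x ^ i"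
      using assms mult_mono[of "\<bar>t\<bar>" 1 x x] by (auto simp: abs_mult intro!: power_mono)
    also have "\<dots> \<le> x ^ m" using i assms by (intro power_increasing) auto
    finally show "\<bar>(- (t * x)) ^ i / fact i\<bar> \<le> x ^ m" .
  qed
  finally show ?thesis by simp
qed

lemma Ck_on_taylor_series:
  fixes b :: "nat \<Rightarrow> complex" and x :: "nat \<Rightarrow> real"
  assumes x: "\<And>n. x n \<ge> 1" and k: "k \<le> K"
    and sm: "summable (\<lambda>n. norm (b n) * x n ^ K)"
  shows "Ck_on k (\<lambda>t. \<Sum>n. b n * of_real (taylor_exp K (t * x n))) {- 1<..<1}"
proof -
  define g where "g i n t = b n * of_real ((- x n) ^ i * taylor_exp (K - i) (t * x n))" for i n t
  have "Ck_on k (\<lambda>t. \<Sum>n. g 0 n t) {- 1<..<1}"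
  proof (rule Ck_on_suminf)
    fix i n t assume i: "i < k"
    have Suc: "K - i = Suc (K - Suc i)" using i k by simp
    have "(taylor_exp (K - i) has_real_derivative - taylor_exp (K - Suc i) (t * x n)) (at (t * x n))"
      unfolding Suc by (rule taylor_exp_has_derivative)
    then have "((\<lambda>t. taylor_exp (K - i) (t * x n)) has_real_derivative (- taylor_exp (K - Suc i) (t * x n)) * x n) (at t)"
      by (rule DERIV_chain2) (auto intro!: derivative_eq_intros)
    then have "((\<lambda>t. (- x n) ^ i * taylor_exp (K - i) (t * x n)) has_real_derivative (- x n) ^ i * ((- taylor_exp (K - Suc i) (t * x n)) * x n)) (at t)"
      by (rule DERIV_cmult)
    then have "((\<lambda>t. (- x n) ^ i * taylor_exp (K - i) (t * x n)) has_real_derivative (- x n) ^ Suc i * taylor_exp (K - Suc i) (t * x n)) (at t)"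
      by (simp add: mult_ac)
    then show "(g i n has_vector_derivative g (Suc i) n t) (at t)"
      unfolding g_def
      by (intro has_vector_derivative_mult_right has_vector_derivative_of_real)
  next
    fix n show "continuous_on {- 1<..<1} (g k n)" unfolding g_def
      by (intro continuous_intros continuous_on_compose2[OF continuous_on_taylor_exp]) auto
  next
    fix i t assume i: "i \<le> k" and t: "t \<in> {- 1<..<1::real}"
    have bd: "norm (g i n y) \<le> real (Suc K) * (norm (b n) * x n ^ K)" if y: "\<bar>y\<bar> \<le> 1" for n y
    proof -
      have "\<bar>taylor_exp (K - i) (y * x n)\<bar> \<le> real (Suc (K - i)) * x n ^ (K - i)"
        by (rule abs_taylor_exp_le[OF x y])
      also have "\<dots> \<le> real (Suc K) * x n ^ (K - i)"
        using x[of n] by (intro mult_right_mono) auto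
      finally have "x n ^ i * \<bar>taylor_exp (K - i) (y * x n)\<bar> \<le> x n ^ i * (real (Suc K) * x n ^ (K - i))"
        using x[of n] by (intro mult_left_mono) auto
      also have "\<dots> = real (Suc K) * x n ^ K"
        using i k by (simp add: power_add[symmetric])
      finally have "norm (b n) * (x n ^ i * \<bar>taylor_exp (K - i) (y * x n)\<bar>) \<le> norm (b n) * (real (Suc K) * x n ^ K)"
        by (rule mult_left_mono) simp
      moreover have "norm (g i n y) = norm (b n) * (x n ^ i * \<bar>taylor_exp (K - i) (y * x n)\<bar>)"
        using x[of n] by (simp add: g_def norm_mult norm_power power_abs abs_mult del: of_real_mult of_real_power of_real_minus)
      ultimately show ?thesis by (simp add: mult_ac)
    qed
    have "1 - \<bar>t\<bar> > 0" using t by auto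
    moreover have "\<bar>y\<bar> \<le> 1" if "y \<in> ball t (1 - \<bar>t\<bar>)" for y
      using that by (auto simp: dist_real_def)
    ultimately show "\<exists>\<delta>>0. \<exists>M. summable M \<and> (\<forall>n. \<forall>y\<in>ball t \<delta>. norm (g i n y) \<le> M n)"
      using bd sm by (intro exI[of _ "1 - \<bar>t\<bar>"] conjI exI[of _ "\<lambda>n. real (Suc K) * (norm (b n) * x n ^ K)"]) (auto intro: summable_mult)
  qed auto
  then show ?thesis by (simp add: g_def)
qed

lemma Ck_on_exp_series:
  fixes b :: "nat \<Rightarrow> complex" and x :: "nat \<Rightarrow> real"
  assumes U: "open U"
    and dom: "\<And>i t. t \<in> U \<Longrightarrow> \<exists>\<delta>>0. \<exists>M. summable M \<and> (\<forall>n. \<forall>y\<in>ball t \<delta>. norm (b n) * (\<bar>x n\<bar> ^ i * exp (- (y * x n))) \<le> M n)"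
  shows "Ck_on k (\<lambda>t. \<Sum>n. b n * of_real (exp (- (t * x n)))) U"
proof -
  define g where "g i n t = b n * of_real ((- x n) ^ i * exp (- (t * x n)))" for i n t
  have "Ck_on k (\<lambda>t. \<Sum>n. g 0 n t) U"
  proof (rule Ck_on_suminf[OF U])
    fix i n t
    have "((\<lambda>t. (- x n) ^ i * exp (- (t * x n))) has_real_derivative (- x n) ^ Suc i * exp (- (t * x n))) (at t)"
      by (auto intro!: derivative_eq_intros)
    then show "(g i n has_vector_derivative g (Suc i) n t) (at t)"
      unfolding g_def
      by (intro has_vector_derivative_mult_right has_vector_derivative_of_real)
  next
    fix n show "continuous_on U (g k n)" unfolding g_def by (intro continuous_intros)
  next
    fix i t assume "t \<in> U"
    have "norm (g i n y) = norm (b n) * (\<bar>x n\<bar> ^ i * exp (- (y * x n)))" for n y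
      by (simp add: g_def norm_mult norm_power power_abs abs_mult del: of_real_mult of_real_power of_real_minus)
    then show "\<exists>\<delta>>0. \<exists>M. summable M \<and> (\<forall>n. \<forall>y\<in>ball t \<delta>. norm (g i n y) \<le> M n)"
      using dom[OF \<open>t \<in> U\<close>, of i] by simp
  qed
  then show ?thesis by (simp add: g_def)
qed

section \<open>Functional calculus of the Dirac operator\<close>

lemma infsum_subset_support:
  assumes "finite F" "F \<subseteq> X" "\<And>x. x \<in> X - F \<Longrightarrow> f x = 0"
  shows "infsum f X = sum f F"
proof -
  have "infsum f X = infsum f F"
    by (rule infsum_cong_neutral) (use assms in auto)
  then show ?thesis using assms(1) by simp
qed

lemma ell2_finite_support:
  assumes "finite F" "F \<subseteq> X" "\<And>x. x \<notin> F \<Longrightarrow> f x = 0"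
  shows "f \<in> ell2 X"
proof -
  have "(\<lambda>x. (cmod (f x))\<^sup>2) summable_on X \<longleftrightarrow> (\<lambda>x. (cmod (f x))\<^sup>2) summable_on F"
    by (rule summable_on_cong_neutral) (use assms in auto)
  then show ?thesis using assms by (auto simp: ell2_def)
qed

lemma ell2_inner_basis:
  assumes "x \<in> X" shows "ell2_inner X (ell2_basis x) f = f x"
proof -
  have "ell2_inner X (ell2_basis x) f = sum (\<lambda>y. cnj (ell2_basis x y) * f y) {x}"
    unfolding ell2_inner_def by (rule infsum_subset_support) (use assms in \<open>auto simp: ell2_basis_def\<close>)
  then show ?thesis by (simp add: ell2_basis_def)
qed

locale swap_operator =
  fixes X :: "('a \<times> 'a) set" and w :: "'a \<times> 'a \<Rightarrow> real"
  assumes swap_mem: "e \<in> X \<Longrightarrow> prod.swap e \<in> X"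
    and swap_neq: "e \<in> X \<Longrightarrow> prod.swap e \<noteq> e"
    and w_swap: "e \<in> X \<Longrightarrow> w (prod.swap e) = w e"
    and w_pos: "e \<in> X \<Longrightarrow> w e > 0"
begin

definition T :: "('a \<times> 'a \<Rightarrow> complex) \<Rightarrow> 'a \<times> 'a \<Rightarrow> complex" where
  "T \<phi> = (\<lambda>e. if e \<in> X then of_real (w e) * \<phi> (prod.swap e) else 0)"

definition test_vec :: "real \<Rightarrow> 'a \<times> 'a \<Rightarrow> 'a \<times> 'a \<Rightarrow> complex" where
  "test_vec s x = (\<lambda>y. if y = x then 1 else if y = prod.swap x then of_real s else 0)"

lemma eigenspace_outside: "\<phi> \<in> eigenspace X T \<mu> \<Longrightarrow> e \<notin> X \<Longrightarrow> \<phi> e = 0"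
  by (cases e) (simp add: eigenspace_def ell2_def)

lemma eigenspace_swap:
  assumes "\<phi> \<in> eigenspace X T \<mu>" "e \<in> X"
  shows "of_real (w e) * \<phi> (prod.swap e) = of_real \<mu> * \<phi> e"
proof -
  have "T \<phi> e = of_real \<mu> * \<phi> e" using assms(1) by (simp add: eigenspace_def)
  then show ?thesis using assms(2) by (simp add: T_def)
qed

lemma eigenspace_swap_sign:
  assumes "\<phi> \<in> eigenspace X T \<mu>" "e \<in> X" "\<mu> = s * w e"
  shows "\<phi> (prod.swap e) = of_real s * \<phi> e"
  using eigenspace_swap[OF assms(1,2)] w_pos[OF assms(2)] by (simp add: assms(3) mult_ac)

lemma eigenspace_zero:
  assumes "\<phi> \<in> eigenspace X T \<mu>" "e \<in> X" "\<bar>\<mu>\<bar> \<noteq> w e"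
  shows "\<phi> e = 0"
proof (rule ccontr)
  assume ne: "\<phi> e \<noteq> 0"
  have "of_real (w e) * (of_real (w e) * \<phi> e) = of_real (w e) * (of_real \<mu> * \<phi> (prod.swap e))"
    using eigenspace_swap[OF assms(1) swap_mem[OF assms(2)]] w_swap[OF assms(2)] by simp
  also have "\<dots> = of_real \<mu> * (of_real \<mu> * \<phi> e)"
    using eigenspace_swap[OF assms(1,2)] by (simp add: mult.left_commute)
  finally have "of_real (w e * w e) * \<phi> e = of_real (\<mu> * \<mu>) * \<phi> e" by (simp add: mult_ac)
  then have "w e * w e = \<mu> * \<mu>" using ne by (metis mult_right_cancel of_real_eq_iff)
  then have "w e ^ 2 = \<bar>\<mu>\<bar> ^ 2" by (simp add: power2_eq_square)
  then have "w e = \<bar>\<mu>\<bar>" by (rule power2_eq_imp_eq) (use w_pos[OF assms(2)] in auto)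
  with assms(3) show False by simp
qed

lemma test_vec_eigenspace:
  assumes "x \<in> X" "s * s = 1" "\<mu> = s * w x"
  shows "(\<lambda>y. c * test_vec s x y) \<in> eigenspace X T \<mu>"
proof -
  have "(\<lambda>y. c * test_vec s x y) \<in> ell2 X"
    by (rule ell2_finite_support[of "{x, prod.swap x}"]) (use assms swap_mem in \<open>auto simp: test_vec_def\<close>)
  moreover have "T (\<lambda>y. c * test_vec s x y) y = of_real \<mu> * (c * test_vec s x y)" for y
  proof -
    have ss: "of_real s * of_real s = (1::complex)" using assms(2) by (metis of_real_1 of_real_mult)
    consider "y = x" | "y = prod.swap x" | "y \<noteq> x" "y \<noteq> prod.swap x" by blast
    then show ?thesis
    proof cases
      case 1 then show ?thesis using assms swap_neq[OF assms(1)] by (simp add: T_def test_vec_def)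
    next
      case 2
      have "of_real \<mu> * (c * of_real s) = (of_real s * of_real s) * (of_real (w x) * c)"
        by (simp add: assms(3) mult_ac)
      then show ?thesis using 2 swap_neq[OF assms(1)] swap_mem[OF assms(1)]
        by (auto simp: T_def test_vec_def w_swap[OF assms(1)] ss)
    next
      case 3 then have "prod.swap y \<noteq> x" "prod.swap y \<noteq> prod.swap x" by (auto simp: prod_eq_iff)
      with 3 show ?thesis by (simp add: T_def test_vec_def)
    qed
  qed
  ultimately show ?thesis by (auto simp: eigenspace_def)
qed

lemma inner_test_vec:
  assumes "x \<in> X"
  shows "ell2_inner X (test_vec s x) f = f x + of_real s * f (prod.swap x)"
proof -
  have "ell2_inner X (test_vec s x) f = sum (\<lambda>y. cnj (test_vec s x y) * f y) {x, prod.swap x}"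
    unfolding ell2_inner_def
    by (rule infsum_subset_support) (use assms swap_mem in \<open>auto simp: test_vec_def\<close>)
  then show ?thesis using swap_neq[OF assms] by (simp add: test_vec_def)
qed

definition is_proj :: "real \<Rightarrow> ('a \<times> 'a \<Rightarrow> complex) \<Rightarrow> ('a \<times> 'a \<Rightarrow> complex) \<Rightarrow> bool" where
  "is_proj \<mu> \<phi> \<psi> \<longleftrightarrow> \<psi> \<in> eigenspace X T \<mu> \<and> (\<forall>\<theta>\<in>eigenspace X T \<mu>. ell2_inner X \<theta> (\<lambda>x. \<phi> x - \<psi> x) = 0)"

lemma is_proj_unique:
  assumes "is_proj \<mu> \<phi> \<psi>" "is_proj \<mu> \<phi> \<psi>'"
  shows "\<psi> = \<psi>'"
proof
  fix x
  consider "x \<notin> X" | "x \<in> X" "\<bar>\<mu>\<bar> \<noteq> w x" | "x \<in> X" "\<bar>\<mu>\<bar> = w x" by blast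
  then show "\<psi> x = \<psi>' x"
  proof cases
    case 1 then show ?thesis
      using assms eigenspace_outside[of \<psi> \<mu> x] eigenspace_outside[of \<psi>' \<mu> x] by (simp add: is_proj_def)
  next
    case 2 then show ?thesis
      using assms eigenspace_zero[of \<psi> \<mu> x] eigenspace_zero[of \<psi>' \<mu> x] by (simp add: is_proj_def)
  next
    case 3
    define s where "s = sgn \<mu>"
    have s: "s * s = 1" "\<mu> = s * w x"
      using 3 w_pos[OF 3(1)] by (auto simp: s_def sgn_if abs_if split: if_splits)
    have ss: "of_real s * of_real s = (1::complex)" using s(1) by (metis of_real_1 of_real_mult)
    have tv: "test_vec s x \<in> eigenspace X T \<mu>" using test_vec_eigenspace[OF 3(1) s, of 1] by simp
    have "2 * \<psi> x = \<phi> x + of_real s * \<phi> (prod.swap x)" if "is_proj \<mu> \<phi> \<psi>" for \<psi>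
    proof -
      have "(\<phi> x - \<psi> x) + of_real s * (\<phi> (prod.swap x) - \<psi> (prod.swap x)) = 0"
        using that tv inner_test_vec[OF 3(1), of s "\<lambda>x. \<phi> x - \<psi> x"] by (simp add: is_proj_def)
      moreover have "\<psi> (prod.swap x) = of_real s * \<psi> x"
        by (rule eigenspace_swap_sign[OF _ 3(1) s(2)]) (use that in \<open>simp add: is_proj_def\<close>)
      then have "of_real s * \<psi> (prod.swap x) = \<psi> x" by (simp add: mult.assoc[symmetric] ss)
      ultimately show ?thesis by (simp add: algebra_simps)
    qed
    from this[OF assms(1)] this[OF assms(2)] have "2 * \<psi> x = 2 * \<psi>' x" by (rule trans[OF _ sym])
    then show ?thesis by simp
  qed
qed

lemma orth_proj_eqI: "is_proj \<mu> \<phi> \<psi> \<Longrightarrow> orth_proj X (eigenspace X T \<mu>) \<phi> = \<psi>"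
  unfolding orth_proj_def by (rule the_equality) (auto simp: is_proj_def intro: is_proj_unique[unfolded is_proj_def])

lemma orth_proj_basis_zero:
  assumes "e \<in> X" "\<bar>\<mu>\<bar> \<noteq> w e"
  shows "orth_proj X (eigenspace X T \<mu>) (ell2_basis e) = (\<lambda>_. 0)"
proof (rule orth_proj_eqI)
  have "(\<lambda>_. 0) \<in> eigenspace X T \<mu>"
    by (auto simp: eigenspace_def ell2_def T_def)
  moreover have "ell2_inner X \<theta> (ell2_basis e) = 0" if "\<theta> \<in> eigenspace X T \<mu>" for \<theta>
  proof -
    have "ell2_inner X \<theta> (ell2_basis e) = sum (\<lambda>y. cnj (\<theta> y) * ell2_basis e y) {e}"
      unfolding ell2_inner_def by (rule infsum_subset_support) (use assms in \<open>auto simp: ell2_basis_def\<close>)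
    then show ?thesis using eigenspace_zero[OF that assms] by simp
  qed
  ultimately show "is_proj \<mu> (ell2_basis e) (\<lambda>_. 0)" by (simp add: is_proj_def)
qed

lemma orth_proj_basis:
  assumes e: "e \<in> X" and s: "s * s = 1" "\<mu> = s * w e"
  shows "orth_proj X (eigenspace X T \<mu>) (ell2_basis e) = (\<lambda>y. 1 / 2 * test_vec s e y)"
proof (rule orth_proj_eqI)
  have ss: "of_real s * of_real s = (1::complex)" using s(1) by (metis of_real_1 of_real_mult)
  have "ell2_inner X \<theta> (\<lambda>y. ell2_basis e y - 1 / 2 * test_vec s e y) = 0" if th: "\<theta> \<in> eigenspace X T \<mu>" for \<theta>
  proof -
    have "ell2_inner X \<theta> (\<lambda>y. ell2_basis e y - 1 / 2 * test_vec s e y) =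
      sum (\<lambda>y. cnj (\<theta> y) * (ell2_basis e y - 1 / 2 * test_vec s e y)) {e, prod.swap e}"
      unfolding ell2_inner_def
      by (rule infsum_subset_support) (use e swap_mem in \<open>auto simp: ell2_basis_def test_vec_def\<close>)
    also have "\<dots> = cnj (\<theta> e) / 2 - cnj (\<theta> (prod.swap e)) * (of_real s / 2)"
      using swap_neq[OF e] by (simp add: ell2_basis_def test_vec_def)
    also have "\<theta> (prod.swap e) = of_real s * \<theta> e" by (rule eigenspace_swap_sign[OF th e s(2)])
    also have "cnj (of_real s * \<theta> e) * (of_real s / 2) = (of_real s * of_real s) * cnj (\<theta> e) / 2" by simp
    finally show ?thesis by (simp add: ss)
  qed
  with test_vec_eigenspace[OF e s, of "1 / 2"] show "is_proj \<mu> (ell2_basis e) (\<lambda>y. 1 / 2 * test_vec s e y)"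
    by (auto simp: is_proj_def)
qed

lemma fun_calculus_diagonal:
  assumes e: "e \<in> X"
  shows "ell2_inner X (ell2_basis e) (fun_calculus X T f (ell2_basis e)) = of_real ((f (w e) + f (- w e)) / 2)"
proof -
  have nz: "eigenspace X T (s * w e) \<noteq> {\<lambda>_. 0}" if "s * s = 1" for s
  proof -
    have "test_vec s e \<in> eigenspace X T (s * w e)" using test_vec_eigenspace[OF e that, of _ 1] by simp
    moreover have "test_vec s e e \<noteq> 0" by (simp add: test_vec_def)
    ultimately show ?thesis by force
  qed
  have "ell2_inner X (ell2_basis e) (fun_calculus X T f (ell2_basis e)) =
      (\<Sum>\<^sub>\<infinity>\<mu>\<in>{\<mu>. eigenspace X T \<mu> \<noteq> {\<lambda>_. 0}}. of_real (f \<mu>) * orth_proj X (eigenspace X T \<mu>) (ell2_basis e) e)"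
    by (simp add: ell2_inner_basis[OF e] fun_calculus_def)
  also have "\<dots> = (\<Sum>\<mu>\<in>{w e, - w e}. of_real (f \<mu>) * orth_proj X (eigenspace X T \<mu>) (ell2_basis e) e)"
  proof (rule infsum_subset_support)
    show "{w e, - w e} \<subseteq> {\<mu>. eigenspace X T \<mu> \<noteq> {\<lambda>_. 0}}" using nz[of 1] nz[of "- 1"] by simp
    show "of_real (f \<mu>) * orth_proj X (eigenspace X T \<mu>) (ell2_basis e) e = 0"
      if "\<mu> \<in> {\<mu>. eigenspace X T \<mu> \<noteq> {\<lambda>_. 0}} - {w e, - w e}" for \<mu>
      using that orth_proj_basis_zero[OF e, of \<mu>] by (auto simp: abs_if split: if_splits)
  qed simp
  also have "\<dots> = of_real ((f (w e) + f (- w e)) / 2)"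
    using w_pos[OF e] orth_proj_basis[OF e, of 1 "w e"] orth_proj_basis[OF e, of "- 1" "- w e"]
    by (simp add: test_vec_def add_divide_distrib)
  finally show ?thesis .
qed

end

section \<open>Counting edges\<close>

lemma convex_combination_gap:
  fixes c f :: "'v \<Rightarrow> real"
  assumes V: "finite V" "u0 \<in> V" and c: "\<And>u. u \<in> V \<Longrightarrow> c u \<ge> 0" "(\<Sum>u\<in>V. c u) = 1" "c u0 \<ge> \<delta>"
    and f: "\<And>u. u \<in> V \<Longrightarrow> f u0 \<le> f u" "\<And>u. u \<in> V \<Longrightarrow> f u - f u0 \<le> E" and E: "E \<ge> 0"
  shows "f u0 \<le> (\<Sum>u\<in>V. c u * f u)" "(\<Sum>u\<in>V. c u * f u) \<le> f u0 + (1 - \<delta>) * E"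
proof -
  have eq: "(\<Sum>u\<in>V. c u * f u) = f u0 + (\<Sum>u\<in>V. c u * (f u - f u0))"
    using c(2) by (simp add: right_diff_distrib sum_subtractf sum_distrib_right[symmetric])
  have "(\<Sum>u\<in>V. c u * (f u - f u0)) \<ge> 0" using c f by (intro sum_nonneg mult_nonneg_nonneg) auto
  with eq show "f u0 \<le> (\<Sum>u\<in>V. c u * f u)" by simp
  have "(\<Sum>u\<in>V. c u * (f u - f u0)) = (\<Sum>u\<in>V-{u0}. c u * (f u - f u0))"
    using V by (simp add: sum.remove)
  also have "\<dots> \<le> (\<Sum>u\<in>V-{u0}. c u * E)" using c f by (intro sum_mono mult_left_mono) auto
  also have "\<dots> = (1 - c u0) * E" using V c(2) by (simp add: sum_distrib_right[symmetric] sum.remove)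
  also have "\<dots> \<le> (1 - \<delta>) * E" using c(3) E by (intro mult_right_mono) auto
  finally show "(\<Sum>u\<in>V. c u * f u) \<le> f u0 + (1 - \<delta>) * E" using eq by simp
qed

text \<open>Convergence to the stationary distribution by Doeblin's contraction argument: one application
  of the \<open>k\<close>-step kernel shrinks the oscillation by the factor \<open>1 - \<delta>\<close>.\<close>

lemma stochastic_kernel_convergence:
  fixes c :: "nat \<Rightarrow> 'v \<Rightarrow> 'v \<Rightarrow> real"
  assumes V: "finite V" "V \<noteq> {}"
    and nonneg: "\<And>n v w. v \<in> V \<Longrightarrow> w \<in> V \<Longrightarrow> c n v w \<ge> 0"
    and row: "\<And>n v. v \<in> V \<Longrightarrow> (\<Sum>w\<in>V. c n v w) = 1"
    and comp: "\<And>m n v w. v \<in> V \<Longrightarrow> w \<in> V \<Longrightarrow> c (m + n) v w = (\<Sum>u\<in>V. c m v u * c n u w)"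
    and \<delta>: "\<delta> > 0" "\<And>v w. v \<in> V \<Longrightarrow> w \<in> V \<Longrightarrow> c k v w \<ge> \<delta>" and k: "k > 0"
    and stat_dist: "\<And>v. v \<in> V \<Longrightarrow> \<pi> v \<ge> 0" "(\<Sum>v\<in>V. \<pi> v) = 1"
    and stat: "\<And>n w. w \<in> V \<Longrightarrow> (\<Sum>v\<in>V. \<pi> v * c n v w) = \<pi> w"
    and vw: "v \<in> V" "w \<in> V"
  shows "(\<lambda>n. c n v w) \<longlonglongrightarrow> \<pi> w"
proof -
  have le1: "c n v w \<le> 1" if "v \<in> V" "w \<in> V" for n v w
  proof -
    have "c n v w \<le> (\<Sum>w\<in>V. c n v w)" by (rule member_le_sum) (use that V nonneg in auto)
    then show ?thesis using row[OF that(1)] by simp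
  qed
  define q where "q = 1 - \<delta>"
  have q: "0 \<le> q" "q < 1" using \<delta>(1) \<delta>(2)[OF vw] le1[OF vw, of k] by (auto simp: q_def)
  have osc: "c (j * k + n) v w - c (j * k + n) v' w \<le> q ^ j" if "v \<in> V" "v' \<in> V" for j n v v'
    using that
  proof (induction j arbitrary: v v')
    case 0
    then show ?case using le1[of v w n] nonneg[of v' w n] vw by simp
  next
    case (Suc j)
    define f where "f u = c (j * k + n) u w" for u
    obtain u0 where u0: "u0 \<in> V" "\<And>u. u \<in> V \<Longrightarrow> f u0 \<le> f u"
      using V arg_min_if_finite(1)[OF V, of f] arg_min_least[OF V, of _ f] by blast
    have eq: "c (Suc j * k + n) v w = (\<Sum>u\<in>V. c k v u * f u)" if "v \<in> V" for v
      using comp[of v w k "j * k + n"] that vw by (simp add: f_def add.assoc)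
    have gap: "f u0 \<le> (\<Sum>u\<in>V. c k v u * f u)" "(\<Sum>u\<in>V. c k v u * f u) \<le> f u0 + (1 - \<delta>) * q ^ j" if v: "v \<in> V" for v
      using convex_combination_gap[of V u0 "c k v" \<delta> f "q ^ j"] V u0 nonneg[OF v] row[OF v] \<delta>(2)[OF v] Suc.IH q
      by (auto simp: f_def)
    show ?case using gap(2)[OF Suc.prems(1)] gap(1)[OF Suc.prems(2)] eq Suc.prems by (simp add: q_def)
  qed
  have bound: "\<bar>c n v w - \<pi> w\<bar> \<le> q ^ (n div k)" for n
  proof -
    have n: "n div k * k + n mod k = n" by simp
    have d: "c n v w - c n u w \<le> q ^ (n div k)" "c n u w - c n v w \<le> q ^ (n div k)" if "u \<in> V" for u
      using osc[OF vw(1) that, of "n div k" "n mod k"] osc[OF that vw(1), of "n div k" "n mod k"] unfolding n by auto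
    have "c n v w - \<pi> w = (\<Sum>u\<in>V. \<pi> u * (c n v w - c n u w))"
      using stat[OF vw(2), of n] stat_dist(2) by (simp add: right_diff_distrib sum_subtractf sum_distrib_right[symmetric])
    also have "\<bar>\<dots>\<bar> \<le> (\<Sum>u\<in>V. \<pi> u * q ^ (n div k))"
      by (rule order_trans[OF sum_abs sum_mono]) (use stat_dist(1) d in \<open>auto simp: abs_mult abs_le_iff intro!: mult_left_mono\<close>)
    also have "\<dots> = q ^ (n div k)" using stat_dist(2) by (simp add: sum_distrib_right[symmetric])
    finally show ?thesis .
  qed
  have "filterlim (\<lambda>n. n div k) at_top sequentially"
    unfolding filterlim_at_top eventually_sequentially
  proof (intro allI exI impI)
    fix Z n :: nat assume "Z * k \<le> n"
    then show "Z \<le> n div k" using k by (simp add: less_eq_div_iff_mult_less_eq)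
  qed
  moreover have "(\<lambda>n. q ^ n) \<longlonglongrightarrow> 0" using q by (intro LIMSEQ_realpow_zero) auto
  ultimately have "(\<lambda>n. q ^ (n div k)) \<longlonglongrightarrow> 0" by (rule filterlim_compose[rotated])
  then have "(\<lambda>n. c n v w - \<pi> w) \<longlonglongrightarrow> 0"
    by (rule Lim_null_comparison[rotated]) (use bound in auto)
  then show ?thesis by (simp add: LIM_zero_iff)
qed

primrec walk_weight :: "('v, 'e) pre_digraph \<Rightarrow> nat \<Rightarrow> 'v \<Rightarrow> 'v \<Rightarrow> real" where
  "walk_weight G 0 u v = (if u = v then 1 else 0)"
| "walk_weight G (Suc n) u v = (\<Sum>x\<in>verts G. real (edge_count G u x) * walk_weight G n x v)"

lemma walk_weight_nonneg: "walk_weight G n u v \<ge> 0"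
  by (induction n arbitrary: u) (auto intro: sum_nonneg)

context fin_digraph
begin

lemma walk_weight_add:
  assumes "u \<in> verts G"
  shows "walk_weight G (m + n) u v = (\<Sum>x\<in>verts G. walk_weight G m u x * walk_weight G n x v)"
  using assms
proof (induction m arbitrary: u)
  case 0
  have "(\<Sum>x\<in>verts G. walk_weight G 0 u x * walk_weight G n x v) = (\<Sum>x\<in>verts G. if x = u then walk_weight G n x v else 0)"
    by (intro sum.cong) auto
  then show ?case using 0 by simp
next
  case (Suc m)
  have "walk_weight G (Suc m + n) u v = (\<Sum>y\<in>verts G. real (edge_count G u y) * (\<Sum>x\<in>verts G. walk_weight G m y x * walk_weight G n x v))"
    by (simp add: Suc.IH)
  also have "\<dots> = (\<Sum>x\<in>verts G. \<Sum>y\<in>verts G. real (edge_count G u y) * (walk_weight G m y x * walk_weight G n x v))"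
    by (subst sum.swap) (simp add: sum_distrib_left)
  also have "\<dots> = (\<Sum>x\<in>verts G. walk_weight G (Suc m) u x * walk_weight G n x v)"
    by (simp add: sum_distrib_right mult.assoc)
  finally show ?case .
qed

lemma walk_weight_1:
  assumes "v \<in> verts G"
  shows "walk_weight G (Suc 0) u v = real (edge_count G u v)"
proof -
  have "walk_weight G (Suc 0) u v = (\<Sum>x\<in>verts G. if x = v then real (edge_count G u x) else 0)"
    by (simp only: walk_weight.simps) (intro sum.cong, auto)
  then show ?thesis using assms by simp
qed

lemma finite_awalks: "finite {p. length p = n \<and> awalk u p v}"
  by (rule finite_subset[OF _ finite_lists_length_eq[OF finite_arcs, of n]]) (auto simp: awalk_def)

lemma card_awalks:
  assumes "u \<in> verts G"
  shows "real (card {p. length p = n \<and> awalk u p v}) = walk_weight G n u v"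
  using assms
proof (induction n arbitrary: u)
  case 0
  then have "{p. length p = 0 \<and> awalk u p v} = (if u = v then {[]} else {})"
    by (auto simp: awalk_Nil_iff)
  then show ?case by simp
next
  case (Suc n)
  have eq: "{p. length p = Suc n \<and> awalk u p v} =
      (\<Union>x\<in>verts G. (\<lambda>(e, p). e # p) ` ({e \<in> arcs G. tail G e = u \<and> head G e = x} \<times> {p. length p = n \<and> awalk x p v}))"
    by (auto simp: length_Suc_conv awalk_Cons_iff image_iff dest: awalk_hd_in_verts)
  have "card {p. length p = Suc n \<and> awalk u p v} =
     (\<Sum>x\<in>verts G. card ((\<lambda>(e, p). e # p) ` ({e \<in> arcs G. tail G e = u \<and> head G e = x} \<times> {p. length p = n \<and> awalk x p v})))"
    unfolding eq by (rule card_UN_disjoint)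
      (auto intro!: finite_imageI finite_cartesian_product finite_awalks)
  also have "\<dots> = (\<Sum>x\<in>verts G. edge_count G u x * card {p. length p = n \<and> awalk x p v})"
    by (intro sum.cong refl, subst card_image) (auto simp: inj_on_def card_cartesian_product edge_count_def)
  finally show ?case using Suc.IH by simp
qed

end

lemma graph_matrix_pow_entry:
  fixes vs :: "'v list"
  assumes G: "fin_digraph G" and enum: "distinct vs" "set vs = verts G" and ij: "i < length vs" "j < length vs"
  shows "((graph_matrix G vs :: real mat) ^\<^sub>m n) $$ (i, j) = walk_weight G n (vs ! i) (vs ! j)"
  using ij
proof (induction n arbitrary: j)
  case 0
  then show ?case using enum(1) by (simp add: graph_matrix_def nth_eq_iff_index_eq)
next
  case (Suc n)
  interpret fin_digraph G by (rule G)
  have dim: "dim_row (graph_matrix G vs :: real mat) = length vs" "dim_col (graph_matrix G vs :: real mat) = length vs"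
    by (simp_all add: graph_matrix_def)
  have bij: "bij_betw (\<lambda>i. vs ! i) {0..<length vs} (verts G)"
    using bij_betw_nth[OF enum(1), of "{0..<length vs}"] enum(2) by (simp add: lessThan_atLeast0)
  have "((graph_matrix G vs :: real mat) ^\<^sub>m Suc n) $$ (i, j) =
     (\<Sum>k\<in>{0..<length vs}. ((graph_matrix G vs :: real mat) ^\<^sub>m n) $$ (i, k) * (graph_matrix G vs :: real mat) $$ (k, j))"
    using Suc.prems dim by (simp add: scalar_prod_def)
  also have "\<dots> = (\<Sum>k\<in>{0..<length vs}. walk_weight G n (vs ! i) (vs ! k) * walk_weight G (Suc 0) (vs ! k) (vs ! j))"
  proof (rule sum.cong)
    fix k assume k: "k \<in> {0..<length vs}"
    have "vs ! j \<in> verts G" using Suc.prems nth_mem[of j vs] by (simp add: enum(2))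
    then show "((graph_matrix G vs :: real mat) ^\<^sub>m n) $$ (i, k) * (graph_matrix G vs :: real mat) $$ (k, j) =
       walk_weight G n (vs ! i) (vs ! k) * walk_weight G (Suc 0) (vs ! k) (vs ! j)"
      using k Suc.prems Suc.IH[of k] unfolding walk_weight_1[OF \<open>vs ! j \<in> verts G\<close>] by (simp add: graph_matrix_def)
  qed simp
  also have "\<dots> = (\<Sum>x\<in>verts G. walk_weight G n (vs ! i) x * walk_weight G (Suc 0) x (vs ! j))"
    by (rule sum.reindex_bij_betw[OF bij])
  also have "\<dots> = walk_weight G (n + Suc 0) (vs ! i) (vs ! j)"
    by (rule walk_weight_add[symmetric]) (use Suc.prems nth_mem[of i vs] in \<open>simp add: enum(2)\<close>)
  finally show ?case by simp
qed

lemma PF_eigenvectors_sums: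
  fixes vs :: "'v list"
  assumes enum: "distinct vs" "set vs = verts G" and PF: "PF_eigenvectors G vs R L" and v: "v \<in> verts G"
  shows "(\<Sum>x\<in>verts G. real (edge_count G v x) * R x) = lambda_PF G vs * R v"
    and "(\<Sum>x\<in>verts G. L x * real (edge_count G x v)) = lambda_PF G vs * L v"
proof -
  have bij: "bij_betw (\<lambda>i. vs ! i) {0..<length vs} (verts G)"
    using bij_betw_nth[OF enum(1), of "{0..<length vs}"] enum(2) by (simp add: lessThan_atLeast0)
  obtain i where i: "i < length vs" "vs ! i = v" using v enum(2) by (metis in_set_conv_nth)
  have "(graph_matrix G vs *\<^sub>v vertex_vec vs R) $ i = (lambda_PF G vs \<cdot>\<^sub>v vertex_vec vs R) $ i"
    using PF by (simp add: PF_eigenvectors_def eigenvector_def)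
  then have "(\<Sum>j\<in>{0..<length vs}. real (edge_count G v (vs ! j)) * R (vs ! j)) = lambda_PF G vs * R v"
    using i by (simp add: graph_matrix_def vertex_vec_def scalar_prod_def)
  then show "(\<Sum>x\<in>verts G. real (edge_count G v x) * R x) = lambda_PF G vs * R v"
    using sum.reindex_bij_betw[OF bij, of "\<lambda>x. real (edge_count G v x) * R x"] by simp
  have "(transpose_mat (graph_matrix G vs) *\<^sub>v vertex_vec vs L) $ i = (lambda_PF G vs \<cdot>\<^sub>v vertex_vec vs L) $ i"
    using PF by (simp add: PF_eigenvectors_def eigenvector_def)
  then have "(\<Sum>j\<in>{0..<length vs}. L (vs ! j) * real (edge_count G (vs ! j) v)) = lambda_PF G vs * L v"
    using i by (simp add: graph_matrix_def vertex_vec_def scalar_prod_def mult.commute)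
  then show "(\<Sum>x\<in>verts G. L x * real (edge_count G x v)) = lambda_PF G vs * L v"
    using sum.reindex_bij_betw[OF bij, of "\<lambda>x. L x * real (edge_count G x v)"] by simp
qed

lemma walk_weight_asymptotics:
  fixes vs :: "'v list"
  assumes G: "fin_digraph G" and enum: "distinct vs" "set vs = verts G"
    and prim: "primitive_mat (graph_matrix G vs)" and PF: "PF_eigenvectors G vs R L"
    and lam: "lambda_PF G vs > 0" and vw: "v \<in> verts G" "w \<in> verts G"
  shows "(\<lambda>n. walk_weight G n v w / lambda_PF G vs ^ n) \<longlonglongrightarrow> R v * L w"
proof -
  interpret fin_digraph G by (rule G)
  define lam where "lam = lambda_PF G vs"
  have lam0: "lam > 0" using lam by (simp add: lam_def)
  have pos: "R v > 0" "L v > 0" if "v \<in> verts G" for v using PF that by (auto simp: PF_eigenvectors_def)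
  have sums: "(\<Sum>v\<in>verts G. R v * L v) = 1" using PF by (simp add: PF_eigenvectors_def)
  note R1 = PF_eigenvectors_sums(1)[OF enum PF, folded lam_def] and L1 = PF_eigenvectors_sums(2)[OF enum PF, folded lam_def]
  have Rn: "(\<Sum>x\<in>verts G. walk_weight G n v x * R x) = lam ^ n * R v" if "v \<in> verts G" for n v
    using that
  proof (induction n arbitrary: v)
    case 0
    have "(\<Sum>x\<in>verts G. walk_weight G 0 v x * R x) = (\<Sum>x\<in>verts G. if x = v then R x else 0)"
      by (intro sum.cong) auto
    then show ?case using 0 by simp
  next
    case (Suc n)
    have "(\<Sum>x\<in>verts G. walk_weight G (Suc n) v x * R x) = (\<Sum>y\<in>verts G. real (edge_count G v y) * (\<Sum>x\<in>verts G. walk_weight G n y x * R x))"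
      by (simp add: sum_distrib_right sum_distrib_left, subst sum.swap) (simp add: mult.assoc)
    also have "\<dots> = (\<Sum>y\<in>verts G. real (edge_count G v y) * (lam ^ n * R y))"
      by (intro sum.cong) (simp_all add: Suc.IH)
    also have "\<dots> = lam ^ n * (\<Sum>y\<in>verts G. real (edge_count G v y) * R y)"
      by (simp add: sum_distrib_left mult_ac)
    finally show ?case using R1[OF Suc.prems] by simp
  qed
  have Ln: "(\<Sum>x\<in>verts G. L x * walk_weight G n x w) = lam ^ n * L w" if "w \<in> verts G" for n w
  proof (induction n)
    case 0
    have "(\<Sum>x\<in>verts G. L x * walk_weight G 0 x w) = (\<Sum>x\<in>verts G. if x = w then L x else 0)"
      by (intro sum.cong) auto
    then show ?case using that by simp
  next
    case (Suc n)
    have "(\<Sum>x\<in>verts G. L x * walk_weight G (Suc n) x w) = (\<Sum>y\<in>verts G. (\<Sum>x\<in>verts G. L x * real (edge_count G x y)) * walk_weight G n y w)"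
      by (simp add: sum_distrib_right sum_distrib_left, subst sum.swap) (simp add: mult.assoc)
    also have "\<dots> = (\<Sum>y\<in>verts G. lam * L y * walk_weight G n y w)"
      by (intro sum.cong) (simp_all add: L1)
    also have "\<dots> = lam * (\<Sum>y\<in>verts G. L y * walk_weight G n y w)"
      by (simp add: sum_distrib_left mult_ac)
    finally show ?case using Suc by simp
  qed
  define c where "c n v w = walk_weight G n v w * R w / (lam ^ n * R v)" for n v w
  obtain k where k: "k > 0" "\<And>i j. i < length vs \<Longrightarrow> j < length vs \<Longrightarrow> ((graph_matrix G vs :: real mat) ^\<^sub>m k) $$ (i, j) > 0"
    using prim by (auto simp: primitive_mat_def graph_matrix_def)
  have wk: "walk_weight G k v w > 0" if "v \<in> verts G" "w \<in> verts G" for v w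
  proof -
    have "v \<in> set vs" "w \<in> set vs" using that by (simp_all add: enum(2))
    then obtain i j where "i < length vs" "vs ! i = v" "j < length vs" "vs ! j = w"
      unfolding in_set_conv_nth by blast
    then show ?thesis using k(2)[of i j] graph_matrix_pow_entry[OF G enum, of i j k] by simp
  qed
  define \<delta> where "\<delta> = Min ((\<lambda>(v, w). c k v w) ` (verts G \<times> verts G))"
  have fin: "finite ((\<lambda>(v, w). c k v w) ` (verts G \<times> verts G))" by simp
  have ckpos: "c k v w > 0" if "v \<in> verts G" "w \<in> verts G" for v w
    using that wk pos lam0 by (auto simp: c_def)
  have d: "\<delta> > 0" unfolding \<delta>_def using vw ckpos by (subst Min_gr_iff[OF fin]) auto
  have dle: "\<delta> \<le> c k v w" if "v \<in> verts G" "w \<in> verts G" for v w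
    unfolding \<delta>_def by (rule Min_le[OF fin]) (use that in auto)
  have "(\<lambda>n. c n v w) \<longlonglongrightarrow> R w * L w"
  proof (rule stochastic_kernel_convergence[where V = "verts G" and \<delta> = \<delta> and k = k])
    show "c n v w \<ge> 0" if "v \<in> verts G" "w \<in> verts G" for n v w
      using that pos lam0 walk_weight_nonneg[of G n v w] by (auto simp: c_def less_imp_le)
    show "(\<Sum>w\<in>verts G. c n v w) = 1" if "v \<in> verts G" for n v
      using Rn[OF that, of n] pos[OF that] lam0 by (simp add: c_def sum_divide_distrib[symmetric])
    show "c (m + n) v w = (\<Sum>u\<in>verts G. c m v u * c n u w)" if "v \<in> verts G" "w \<in> verts G" for m n v w
    proof -
      have "(\<Sum>u\<in>verts G. c m v u * c n u w) = (\<Sum>u\<in>verts G. walk_weight G m v u * walk_weight G n u w * (R w / (lam ^ (m + n) * R v)))"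
      proof (rule sum.cong)
        fix x assume "x \<in> verts G"
        then have "R x \<noteq> 0" using pos(1)[of x] by simp
        then show "c m v x * c n x w = walk_weight G m v x * walk_weight G n x w * (R w / (lam ^ (m + n) * R v))"
          by (simp add: c_def power_add mult_ac)
      qed simp
      also have "\<dots> = c (m + n) v w"
        unfolding sum_distrib_right[symmetric] walk_weight_add[OF that(1), symmetric] by (simp add: c_def)
      finally show ?thesis by simp
    qed
    show "(\<Sum>v\<in>verts G. R v * L v * c n v w) = R w * L w" if "w \<in> verts G" for n w
    proof -
      have "(\<Sum>v\<in>verts G. R v * L v * c n v w) = (\<Sum>v\<in>verts G. L v * walk_weight G n v w * (R w / lam ^ n))"
        by (intro sum.cong refl) (use pos lam0 in \<open>force simp: c_def\<close>)
      also have "\<dots> = lam ^ n * L w * (R w / lam ^ n)"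
        unfolding sum_distrib_right[symmetric] Ln[OF that] ..
      finally show ?thesis using lam0 by simp
    qed
  qed (use d dle k vw sums pos in \<open>auto simp: less_imp_le\<close>)
  then have "(\<lambda>n. c n v w * (R v / R w)) \<longlonglongrightarrow> R w * L w * (R v / R w)"
    by (intro tendsto_intros)
  moreover have "c n v w * (R v / R w) = walk_weight G n v w / lam ^ n" for n
    using pos(1)[OF vw(1)] pos(1)[OF vw(2)] by (simp add: c_def)
  ultimately show ?thesis using pos(1)[OF vw(2)] by (simp add: lam_def mult.commute)
qed

lemma lambda_PF_gt_1:
  fixes vs :: "'v list"
  assumes G: "fin_digraph G" and enum: "distinct vs" "set vs = verts G"
    and loop: "l \<in> arcs G" "tail G l = head G l" and PF: "PF_eigenvectors G vs R L"
    and no_unit: "\<forall>\<mu>. eigenvalue (graph_matrix G vs :: complex mat) \<mu> \<longrightarrow> cmod \<mu> \<noteq> 1"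
  shows "lambda_PF G vs > 1"
proof -
  interpret fin_digraph G by (rule G)
  define v where "v = tail G l"
  have v: "v \<in> verts G" using loop by (simp add: v_def)
  have pos: "R v > 0" if "v \<in> verts G" for v using PF that by (auto simp: PF_eigenvectors_def)
  have "finite {\<epsilon> \<in> arcs G. tail G \<epsilon> = v \<and> head G \<epsilon> = v}" by simp
  then have "edge_count G v v > 0"
    unfolding edge_count_def using loop by (subst card_gt_0_iff) (auto simp: v_def)
  then have "1 * R v \<le> real (edge_count G v v) * R v" using pos[OF v] by (intro mult_right_mono) auto
  also have "\<dots> \<le> (\<Sum>x\<in>verts G. real (edge_count G v x) * R x)"
    by (rule member_le_sum) (use v pos in \<open>auto simp: less_imp_le\<close>)
  also have "\<dots> = lambda_PF G vs * R v" by (rule PF_eigenvectors_sums(1)[OF enum PF v])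
  finally have ge: "lambda_PF G vs \<ge> 1" using pos[OF v] by simp
  have "length vs > 0" using v enum(2) by (cases vs) auto
  moreover have "(graph_matrix G vs :: complex mat) \<in> carrier_mat (length vs) (length vs)"
    by (simp add: graph_matrix_def)
  ultimately have "lambda_PF G vs \<in> norm ` spectrum (graph_matrix G vs :: complex mat)"
    unfolding lambda_PF_def by (intro spectral_radius_mem_max(1)) auto
  then have "lambda_PF G vs \<noteq> 1" using no_unit by (auto simp: spectrum_def)
  with ge show ?thesis by simp
qed

locale horizontal_edges = fin_digraph G for G :: "('v, 'e) pre_digraph" +
  fixes \<tau>h :: "'e \<Rightarrow> 'e" and H :: "('e \<times> 'e) set"
  assumes H_horizontal: "H \<subseteq> horizontal_pairs G" and H_sym: "sym H"
begin

lemma finite_H: "finite H"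
  by (rule finite_subset[OF H_horizontal finite_subset[of _ "arcs G \<times> arcs G"]]) (auto simp: horizontal_pairs_def)

lemma H_cases:
  assumes "h \<in> H"
  shows "fst h \<noteq> snd h" "tail G (fst h) = tail G (snd h)" "fst h \<in> arcs G" "snd h \<in> arcs G" "tail G (fst h) \<in> verts G"
  using assms H_horizontal by (auto simp: horizontal_pairs_def)

definition edge_data :: "nat \<Rightarrow> ('e list \<times> 'e \<times> 'e) set" where
  "edge_data n = {(p, h). h \<in> H \<and> Suc (length p) = n \<and> (\<exists>u. awalk u p (tail G (fst h)))}"

definition pair_of :: "'e list \<times> 'e \<times> 'e \<Rightarrow> 'e path_pair" where
  "pair_of = (\<lambda>(p, a, b). (extend_path \<tau>h (p @ [a]), extend_path \<tau>h (p @ [b])))"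

lemma edges_at_eq: "edges_at G \<tau>h H n = pair_of ` edge_data n"
proof (rule equalityI; rule subsetI)
  fix x assume "x \<in> edges_at G \<tau>h H n"
  then obtain p a b where "x = (extend_path \<tau>h (p @ [a]), extend_path \<tau>h (p @ [b]))" "(a, b) \<in> H"
      "length p + 1 = n" "\<exists>u. awalk u p (tail G a)"
    unfolding edges_at_def by blast
  then have "x = pair_of (p, a, b)" "(a, b) \<in> H" "length p + 1 = n" "\<exists>u. awalk u p (tail G a)"
    by (simp_all add: pair_of_def)
  then show "x \<in> pair_of ` edge_data n" by (auto simp: edge_data_def intro!: image_eqI[of _ _ "(p, a, b)"])
next
  fix x assume "x \<in> pair_of ` edge_data n"
  then obtain p a b u where "x = pair_of (p, a, b)" "(a, b) \<in> H" "length p + 1 = n" "awalk u p (tail G a)"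
    unfolding edge_data_def by auto
  then show "x \<in> edges_at G \<tau>h H n" unfolding edges_at_def pair_of_def by auto
qed

lemma extend_path_prefix: "i < length p \<Longrightarrow> extend_path \<tau>h (p @ [x]) i = p ! i"
  and extend_path_last: "extend_path \<tau>h (p @ [x]) (length p) = x"
  by (simp_all add: extend_path_def nth_append)

lemma pair_of_eqD:
  assumes "d \<in> edge_data n" "d' \<in> edge_data m" "pair_of d = pair_of d'"
  shows "n = m \<and> d = d'"
proof -
  obtain p a b where d: "d = (p, a, b)" by (cases d)
  obtain p' a' b' where d': "d' = (p', a', b')" by (cases d')
  have ab: "a \<noteq> b" "a' \<noteq> b'" using assms H_cases(1) unfolding d d' edge_data_def by force+
  have eq: "extend_path \<tau>h (p @ [a]) i = extend_path \<tau>h (p' @ [a']) i"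
    "extend_path \<tau>h (p @ [b]) i = extend_path \<tau>h (p' @ [b']) i" for i
    using assms(3) by (auto simp: d d' pair_of_def)
  have len: "length p = length p'"
  proof (rule ccontr)
    assume "length p \<noteq> length p'"
    then consider "length p < length p'" | "length p' < length p" by linarith
    then show False
    proof cases
      case 1 then show ?thesis using eq[of "length p"] ab extend_path_prefix[OF 1] by (simp add: extend_path_last)
    next
      case 2 then show ?thesis using eq[of "length p'"] ab extend_path_prefix[OF 2] by (simp add: extend_path_last)
    qed
  qed
  have "p = p'"
  proof (rule nth_equalityI[OF len])
    fix i assume "i < length p"
    then show "p ! i = p' ! i" using eq(1)[of i] len by (simp add: extend_path_prefix)
  qed
  moreover have "a = a'" "b = b'" using eq[of "length p"] len by (simp_all add: extend_path_last) (simp_all add: extend_path_def nth_append)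
  ultimately show ?thesis using assms by (auto simp: d d' edge_data_def)
qed

lemma edge_level_eq:
  assumes "e \<in> edges_at G \<tau>h H n" shows "edge_level G \<tau>h H e = n"
  unfolding edge_level_def
proof (rule the_equality)
  show "e \<in> edges_at G \<tau>h H n" by (rule assms)
  fix m assume "e \<in> edges_at G \<tau>h H m"
  with assms show "m = n" unfolding edges_at_eq using pair_of_eqD by fast
qed

lemma edges_at_disjoint: "n \<noteq> m \<Longrightarrow> edges_at G \<tau>h H n \<inter> edges_at G \<tau>h H m = {}"
  by (auto dest: edge_level_eq)

lemma swap_edges_at:
  assumes "e \<in> edges_at G \<tau>h H n"
  shows "prod.swap e \<in> edges_at G \<tau>h H n" "prod.swap e \<noteq> e"
proof -
  obtain p a b where d: "(p, a, b) \<in> edge_data n" "e = pair_of (p, a, b)"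
    using assms unfolding edges_at_eq by force
  then have ab: "(a, b) \<in> H" by (simp add: edge_data_def)
  then have ba: "(b, a) \<in> H" using H_sym by (simp add: sym_def)
  have "(p, b, a) \<in> edge_data n" using d(1) ba H_cases(2)[OF ab] by (auto simp: edge_data_def)
  moreover have "prod.swap e = pair_of (p, b, a)" by (simp add: d(2) pair_of_def)
  ultimately show "prod.swap e \<in> edges_at G \<tau>h H n" unfolding edges_at_eq by (rule image_eqI[rotated])
  have "a \<noteq> b" using H_cases(1)[OF ab] by simp
  then show "prod.swap e \<noteq> e"
    using pair_of_eqD[OF \<open>(p, b, a) \<in> edge_data n\<close> d(1)] \<open>prod.swap e = pair_of (p, b, a)\<close> d(2) by auto
qed

lemma finite_edge_data: "finite (edge_data n)"
proof (rule finite_subset)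
  show "edge_data n \<subseteq> {p. set p \<subseteq> arcs G \<and> length p = n - 1} \<times> H"
    by (auto simp: edge_data_def awalk_def)
  show "finite ({p. set p \<subseteq> arcs G \<and> length p = n - 1} \<times> H)"
    by (intro finite_cartesian_product finite_H finite_lists_length_eq finite_arcs)
qed

lemma finite_edges_at: "finite (edges_at G \<tau>h H n)"
  unfolding edges_at_eq by (intro finite_imageI finite_edge_data)

lemma awalk_start_unique:
  assumes "awalk u p w" "awalk u' p w" shows "u = u'"
  using assms by (cases p) (auto simp: awalk_Nil_iff awalk_Cons_iff)

lemma card_edges_at:
  "real (card (edges_at G \<tau>h H (Suc n))) = (\<Sum>h\<in>H. \<Sum>v\<in>verts G. walk_weight G n v (tail G (fst h)))"
proof -
  have "card (edges_at G \<tau>h H (Suc n)) = card (edge_data (Suc n))"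
    unfolding edges_at_eq by (rule card_image) (auto simp: inj_on_def dest: pair_of_eqD)
  also have "edge_data (Suc n) = (\<Union>h\<in>H. \<Union>v\<in>verts G. (\<lambda>p. (p, h)) ` {p. length p = n \<and> awalk v p (tail G (fst h))})"
    by (auto simp: edge_data_def)
  also have "card \<dots> = (\<Sum>h\<in>H. card (\<Union>v\<in>verts G. (\<lambda>p. (p, h)) ` {p. length p = n \<and> awalk v p (tail G (fst h))}))"
    by (rule card_UN_disjoint) (auto intro: finite_H finite_awalks)
  also have "\<dots> = (\<Sum>h\<in>H. \<Sum>v\<in>verts G. card ((\<lambda>p. (p, h)) ` {p. length p = n \<and> awalk v p (tail G (fst h))}))"
    by (intro sum.cong refl card_UN_disjoint) (auto intro: finite_awalks dest: awalk_start_unique)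
  also have "\<dots> = (\<Sum>h\<in>H. \<Sum>v\<in>verts G. card {p. length p = n \<and> awalk v p (tail G (fst h))})"
    by (intro sum.cong refl card_image) (auto simp: inj_on_def)
  finally show ?thesis by (simp add: card_awalks)
qed

lemma edges_at_0: "edges_at G \<tau>h H 0 = {}"
  by (simp add: edges_at_eq edge_data_def)

lemma card_edges_at_asymptotics:
  fixes vs :: "'v list"
  assumes enum: "distinct vs" "set vs = verts G"
    and prim: "primitive_mat (graph_matrix G vs)" and PF: "PF_eigenvectors G vs R L"
    and lam: "lambda_PF G vs > 0"
  shows "(\<lambda>n. real (card (edges_at G \<tau>h H n)) / lambda_PF G vs ^ n) \<longlonglongrightarrow> C1 G vs R L H"
proof -
  have "(\<lambda>n. (1 / lambda_PF G vs) * (\<Sum>h\<in>H. \<Sum>v\<in>verts G. walk_weight G n v (tail G (fst h)) / lambda_PF G vs ^ n))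
     \<longlonglongrightarrow> (1 / lambda_PF G vs) * (\<Sum>h\<in>H. \<Sum>v\<in>verts G. R v * L (tail G (fst h)))"
    by (intro tendsto_mult tendsto_const tendsto_sum walk_weight_asymptotics[OF fin_digraph_axioms enum prim PF lam] H_cases(5))
  moreover have "(1 / lambda_PF G vs) * (\<Sum>h\<in>H. \<Sum>v\<in>verts G. walk_weight G n v (tail G (fst h)) / lambda_PF G vs ^ n) =
      real (card (edges_at G \<tau>h H (Suc n))) / lambda_PF G vs ^ Suc n" for n
    by (simp add: card_edges_at sum_divide_distrib mult.commute)
  moreover have "(\<Sum>h\<in>H. \<Sum>v\<in>verts G. R v * L (tail G (fst h))) = (\<Sum>v\<in>verts G. \<Sum>h\<in>H. R v * L (tail G (fst h)))"
    by (rule sum.swap)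
  ultimately have "(\<lambda>n. real (card (edges_at G \<tau>h H (Suc n))) / lambda_PF G vs ^ Suc n) \<longlonglongrightarrow> C1 G vs R L H"
    by (simp only: C1_def)
  then show ?thesis by (rule LIMSEQ_imp_Suc)
qed

end

section \<open>Traces as sums over levels\<close>

context horizontal_edges
begin

lemma all_edges_eq: "all_edges G \<tau>h H = (\<Union>n. edges_at G \<tau>h H n)"
proof -
  have "n \<ge> 1" if "e \<in> edges_at G \<tau>h H n" for e n using that by (cases n) (auto simp: edges_at_0)
  then show ?thesis by (auto simp: all_edges_def)
qed

lemma swap_operator_edges:
  assumes "\<rho> > 0"
  shows "swap_operator (all_edges G \<tau>h H) (\<lambda>e. inverse (\<rho> ^ edge_level G \<tau>h H e))"
proof
  fix e assume "e \<in> all_edges G \<tau>h H"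
  then obtain n where n: "e \<in> edges_at G \<tau>h H n" by (auto simp: all_edges_eq)
  show "prod.swap e \<in> all_edges G \<tau>h H" using swap_edges_at(1)[OF n] by (auto simp: all_edges_eq)
  show "prod.swap e \<noteq> e" by (rule swap_edges_at(2)[OF n])
  show "inverse (\<rho> ^ edge_level G \<tau>h H (prod.swap e)) = inverse (\<rho> ^ edge_level G \<tau>h H e)"
    using edge_level_eq[OF n] edge_level_eq[OF swap_edges_at(1)[OF n]] by simp
  show "inverse (\<rho> ^ edge_level G \<tau>h H e) > 0" using assms by simp
qed

lemma fun_calculus_dirac_diagonal:
  assumes rho: "\<rho> > 0" and even: "\<And>x. f (- x) = f x" and e: "e \<in> all_edges G \<tau>h H"
  shows "ell2_inner (all_edges G \<tau>h H) (ell2_basis e) (fun_calculus (all_edges G \<tau>h H) (dirac G \<tau>h H \<rho>) f (ell2_basis e)) =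
    of_real (f (inverse (\<rho> ^ edge_level G \<tau>h H e)))"
proof -
  interpret swap_operator "all_edges G \<tau>h H" "\<lambda>e. inverse (\<rho> ^ edge_level G \<tau>h H e)"
    by (rule swap_operator_edges[OF rho])
  have "dirac G \<tau>h H \<rho> = T" by (intro ext) (simp add: dirac_def T_def)
  then show ?thesis using fun_calculus_diagonal[OF e, of f] even by simp
qed

lemma level_sum_all_edges:
  fixes \<phi> :: "nat \<Rightarrow> real"
  assumes "\<And>n. \<phi> n \<ge> 0"
  shows "(\<lambda>e. complex_of_real (\<phi> (edge_level G \<tau>h H e))) summable_on all_edges G \<tau>h H \<longleftrightarrow>
      summable (\<lambda>n. real (card (edges_at G \<tau>h H n)) * \<phi> n)"
    and "summable (\<lambda>n. real (card (edges_at G \<tau>h H n)) * \<phi> n) \<Longrightarrow>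
      (\<Sum>\<^sub>\<infinity>e\<in>all_edges G \<tau>h H. complex_of_real (\<phi> (edge_level G \<tau>h H e))) = of_real (\<Sum>n. real (card (edges_at G \<tau>h H n)) * \<phi> n)"
proof -
  let ?S = "Sigma UNIV (edges_at G \<tau>h H)"
  have bij: "bij_betw snd ?S (all_edges G \<tau>h H)"
  proof (rule bij_betw_imageI)
    show "inj_on snd ?S" using edges_at_disjoint by (auto simp: inj_on_def)
    show "snd ` ?S = all_edges G \<tau>h H" by (force simp: all_edges_eq)
  qed
  have lev: "complex_of_real (\<phi> (edge_level G \<tau>h H (snd x))) = (case x of (n, e) \<Rightarrow> complex_of_real (\<phi> n))" if "x \<in> ?S" for x
    using that edge_level_eq by auto
  have "(\<lambda>e. complex_of_real (\<phi> (edge_level G \<tau>h H e))) summable_on all_edges G \<tau>h H \<longleftrightarrow>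
      (\<lambda>x. complex_of_real (\<phi> (edge_level G \<tau>h H (snd x)))) summable_on ?S"
    by (rule summable_on_reindex_bij_betw[OF bij, symmetric])
  also have "\<dots> \<longleftrightarrow> (\<lambda>(n, e). complex_of_real (\<phi> n)) summable_on ?S"
    by (rule summable_on_cong) (rule lev)
  finally have 1: "(\<lambda>e. complex_of_real (\<phi> (edge_level G \<tau>h H e))) summable_on all_edges G \<tau>h H \<longleftrightarrow> (\<lambda>(n, e). complex_of_real (\<phi> n)) summable_on ?S" .
  also have "\<dots> \<longleftrightarrow> (\<lambda>x. norm (case x of (n, e) \<Rightarrow> complex_of_real (\<phi> n))) summable_on ?S"
    by (rule summable_on_iff_abs_summable_on_complex)
  also have "\<dots> \<longleftrightarrow> (\<lambda>n. real (card (edges_at G \<tau>h H n)) * \<phi> n) summable_on UNIV"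
    by (rule trans[OF Infinite_Sum.abs_summable_on_Sigma_iff]) (simp add: finite_edges_at assms)
  also have "\<dots> \<longleftrightarrow> summable (\<lambda>n. real (card (edges_at G \<tau>h H n)) * \<phi> n)"
    by (rule summable_on_UNIV_nonneg_real_iff) (use assms in simp)
  finally show iff: "(\<lambda>e. complex_of_real (\<phi> (edge_level G \<tau>h H e))) summable_on all_edges G \<tau>h H \<longleftrightarrow>
      summable (\<lambda>n. real (card (edges_at G \<tau>h H n)) * \<phi> n)" .
  assume sm: "summable (\<lambda>n. real (card (edges_at G \<tau>h H n)) * \<phi> n)"
  have "(\<Sum>\<^sub>\<infinity>e\<in>all_edges G \<tau>h H. complex_of_real (\<phi> (edge_level G \<tau>h H e))) =
      (\<Sum>\<^sub>\<infinity>x\<in>?S. complex_of_real (\<phi> (edge_level G \<tau>h H (snd x))))"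
    by (rule infsum_reindex_bij_betw[OF bij, symmetric])
  also have "\<dots> = (\<Sum>\<^sub>\<infinity>(n, e)\<in>?S. complex_of_real (\<phi> n))" by (rule infsum_cong) (rule lev)
  also have "\<dots> = (\<Sum>\<^sub>\<infinity>n\<in>UNIV. \<Sum>\<^sub>\<infinity>e\<in>edges_at G \<tau>h H n. complex_of_real (\<phi> n))"
    by (rule infsum_Sigma'_banach[symmetric]) (use 1 iff sm in simp)
  also have "\<dots> = (\<Sum>\<^sub>\<infinity>n\<in>UNIV. complex_of_real (real (card (edges_at G \<tau>h H n)) * \<phi> n))"
    by (simp add: finite_edges_at)
  also have "\<dots> = of_real (\<Sum>n. real (card (edges_at G \<tau>h H n)) * \<phi> n)"
  proof -
    have "summable (\<lambda>n. norm (complex_of_real (real (card (edges_at G \<tau>h H n)) * \<phi> n)))"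
      using sm assms by (simp add: norm_mult)
    then have "((\<lambda>n. complex_of_real (real (card (edges_at G \<tau>h H n)) * \<phi> n)) has_sum of_real (\<Sum>n. real (card (edges_at G \<tau>h H n)) * \<phi> n)) UNIV"
      by (rule norm_summable_imp_has_sum) (rule sums_of_real[OF summable_sums[OF sm]])
    then show ?thesis by (rule infsumI)
  qed
  finally show "(\<Sum>\<^sub>\<infinity>e\<in>all_edges G \<tau>h H. complex_of_real (\<phi> (edge_level G \<tau>h H e))) = of_real (\<Sum>n. real (card (edges_at G \<tau>h H n)) * \<phi> n)" .
qed

lemma fun_calculus_trace:
  assumes rho: "\<rho> > 0" and even: "\<And>x. f (- x) = f x" and nonneg: "\<And>x. f x \<ge> 0"
  shows "finite_trace (all_edges G \<tau>h H) (fun_calculus (all_edges G \<tau>h H) (dirac G \<tau>h H \<rho>) f) \<longleftrightarrow>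
      summable (\<lambda>n. real (card (edges_at G \<tau>h H n)) * f (inverse (\<rho> ^ n)))"
    and "summable (\<lambda>n. real (card (edges_at G \<tau>h H n)) * f (inverse (\<rho> ^ n))) \<Longrightarrow>
      op_trace (all_edges G \<tau>h H) (fun_calculus (all_edges G \<tau>h H) (dirac G \<tau>h H \<rho>) f) =
      of_real (\<Sum>n. real (card (edges_at G \<tau>h H n)) * f (inverse (\<rho> ^ n)))"
proof -
  note diag = fun_calculus_dirac_diagonal[of \<rho> f, OF rho even]
  have "finite_trace (all_edges G \<tau>h H) (fun_calculus (all_edges G \<tau>h H) (dirac G \<tau>h H \<rho>) f) \<longleftrightarrow>
     (\<lambda>e. complex_of_real (f (inverse (\<rho> ^ edge_level G \<tau>h H e)))) summable_on all_edges G \<tau>h H"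
    unfolding finite_trace_def by (rule summable_on_cong) (rule diag)
  then show "finite_trace (all_edges G \<tau>h H) (fun_calculus (all_edges G \<tau>h H) (dirac G \<tau>h H \<rho>) f) \<longleftrightarrow>
      summable (\<lambda>n. real (card (edges_at G \<tau>h H n)) * f (inverse (\<rho> ^ n)))"
    using level_sum_all_edges(1)[of "\<lambda>n. f (inverse (\<rho> ^ n))"] nonneg by simp
  assume "summable (\<lambda>n. real (card (edges_at G \<tau>h H n)) * f (inverse (\<rho> ^ n)))"
  then have "(\<Sum>\<^sub>\<infinity>e\<in>all_edges G \<tau>h H. complex_of_real (f (inverse (\<rho> ^ edge_level G \<tau>h H e)))) = of_real (\<Sum>n. real (card (edges_at G \<tau>h H n)) * f (inverse (\<rho> ^ n)))"
    by (rule level_sum_all_edges(2)[rotated]) (rule nonneg)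
  moreover have "op_trace (all_edges G \<tau>h H) (fun_calculus (all_edges G \<tau>h H) (dirac G \<tau>h H \<rho>) f) =
     (\<Sum>\<^sub>\<infinity>e\<in>all_edges G \<tau>h H. complex_of_real (f (inverse (\<rho> ^ edge_level G \<tau>h H e))))"
    unfolding op_trace_def by (rule infsum_cong) (rule diag)
  ultimately show "op_trace (all_edges G \<tau>h H) (fun_calculus (all_edges G \<tau>h H) (dirac G \<tau>h H \<rho>) f) =
      of_real (\<Sum>n. real (card (edges_at G \<tau>h H n)) * f (inverse (\<rho> ^ n)))" by simp
qed

end

section \<open>The heat trace\<close>

lemma summable_poly_times_power:
  fixes Q :: "complex poly"
  assumes "0 \<le> r" "r < 1"
  shows "summable (\<lambda>n. norm (poly Q (of_nat n)) * r ^ n)"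
proof -
  have mono: "summable (\<lambda>n. real n ^ i * r ^ n)" for i
  proof -
    define r' where "r' = max r (1 / 2)"
    have r': "0 < r'" "r' < 1" "r \<le> r'" using assms by (auto simp: r'_def)
    define \<epsilon> where "\<epsilon> = - ln r' / 2"
    have eps: "\<epsilon> > 0" using r' by (simp add: \<epsilon>_def)
    obtain D where D: "D > 0" "\<And>x::real. \<bar>x\<bar> ^ i \<le> D * exp (\<epsilon> * \<bar>x\<bar>)"
      using abs_power_le_exp[OF eps, of i] by blast
    have r'e: "r' = exp (- (2 * \<epsilon>))" using r' by (simp add: \<epsilon>_def)
    show ?thesis
    proof (rule summable_comparison_test)
      show "summable (\<lambda>n. D * exp (- \<epsilon>) ^ n)"
        using eps by (intro summable_mult summable_geometric) simp
      have "real n ^ i * r ^ n \<le> D * exp (- \<epsilon>) ^ n" for n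
      proof -
        have "real n ^ i * r ^ n \<le> (D * exp (\<epsilon> * real n)) * r' ^ n"
          using D(2)[of "real n"] r' assms D(1) by (intro mult_mono power_mono) auto
        also have "\<dots> = D * exp (- \<epsilon>) ^ n"
          unfolding r'e by (simp add: exp_of_nat_mult[symmetric] exp_add[symmetric] mult.assoc)
        finally show ?thesis .
      qed
      then show "\<exists>N. \<forall>n\<ge>N. norm (real n ^ i * r ^ n) \<le> D * exp (- \<epsilon>) ^ n" using assms by auto
    qed
  qed
  show ?thesis
  proof (rule summable_comparison_test)
    show "summable (\<lambda>n. \<Sum>i\<le>degree Q. norm (coeff Q i) * (real n ^ i * r ^ n))"
      by (intro summable_sum summable_mult mono)
    have "norm (poly Q (of_nat n)) * r ^ n \<le> (\<Sum>i\<le>degree Q. norm (coeff Q i) * (real n ^ i * r ^ n))" for n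
    proof -
      have "norm (poly Q (of_nat n)) \<le> (\<Sum>i\<le>degree Q. norm (coeff Q i) * real n ^ i)"
        unfolding poly_altdef by (rule order_trans[OF norm_sum]) (simp add: norm_mult norm_power)
      then have "norm (poly Q (of_nat n)) * r ^ n \<le> (\<Sum>i\<le>degree Q. norm (coeff Q i) * real n ^ i) * r ^ n"
        using assms by (intro mult_right_mono) auto
      then show ?thesis by (simp add: sum_distrib_right mult.assoc)
    qed
    then show "\<exists>N. \<forall>n\<ge>N. norm (norm (poly Q (of_nat n)) * r ^ n) \<le> (\<Sum>i\<le>degree Q. norm (coeff Q i) * (real n ^ i * r ^ n))"
      using assms by auto
  qed
qed

lemma Ck_on_subset:
  assumes "Ck_on k f U" "V \<subseteq> U" shows "Ck_on k f V"
proof -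
  obtain g where "g 0 = f" "\<forall>i<k. \<forall>x\<in>U. (g i has_vector_derivative g (Suc i) x) (at x)" "continuous_on U (g k)"
    using assms(1) unfolding Ck_on_def by blast
  then show ?thesis unfolding Ck_on_def using assms(2)
    by (intro exI[of _ g] conjI) (auto intro: continuous_on_subset)
qed

lemma Ck_on_bounded_exp_series:
  fixes b :: "nat \<Rightarrow> complex" and x :: "nat \<Rightarrow> real"
  assumes "summable (\<lambda>n. norm (b n))" and x: "\<And>n. 0 \<le> x n" "\<And>n. b n \<noteq> 0 \<Longrightarrow> x n \<le> X"
  shows "Ck_on k (\<lambda>t. \<Sum>n. b n * of_real (exp (- (t * x n)))) UNIV"
proof (rule Ck_on_exp_series)
  fix i and t :: real
  have "norm (b n) * (\<bar>x n\<bar> ^ i * exp (- (y * x n))) \<le> norm (b n) * (X ^ i * exp ((\<bar>t\<bar> + 1) * X))"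
    if y: "y \<in> ball t 1" for n y
  proof (cases "b n = 0")
    case False
    have X: "0 \<le> x n" "x n \<le> X" using x False by auto
    have "- y \<le> \<bar>t\<bar> + 1" using y by (auto simp: dist_real_def)
    then have "(- y) * x n \<le> (\<bar>t\<bar> + 1) * x n" using X by (intro mult_right_mono) auto
    also have "\<dots> \<le> (\<bar>t\<bar> + 1) * X" using X by (intro mult_left_mono) auto
    finally have "exp (- (y * x n)) \<le> exp ((\<bar>t\<bar> + 1) * X)" by simp
    then show ?thesis using X by (intro mult_left_mono mult_mono power_mono) auto
  qed simp
  then show "\<exists>\<delta>>0. \<exists>M. summable M \<and> (\<forall>n. \<forall>y\<in>ball t \<delta>. norm (b n) * (\<bar>x n\<bar> ^ i * exp (- (y * x n))) \<le> M n)"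
    by (intro exI[of _ 1] conjI exI[of _ "\<lambda>n. norm (b n) * (X ^ i * exp ((\<bar>t\<bar> + 1) * X))"] summable_mult2 assms(1)) auto
qed simp

lemma Ck_on_decaying_exp_series:
  fixes b :: "nat \<Rightarrow> complex" and x :: "nat \<Rightarrow> real"
  assumes "summable (\<lambda>n. norm (b n))" and x: "\<And>n. 0 \<le> x n"
  shows "Ck_on k (\<lambda>t. \<Sum>n. b n * of_real (exp (- (t * x n)))) {0<..}"
proof (rule Ck_on_exp_series)
  fix i and t :: real
  assume t: "t \<in> {0<..}"
  then obtain D where D: "D > 0" "\<And>x::real. \<bar>x\<bar> ^ i \<le> D * exp (t / 2 * \<bar>x\<bar>)"
    using abs_power_le_exp[of "t / 2" i] by auto
  have "norm (b n) * (\<bar>x n\<bar> ^ i * exp (- (y * x n))) \<le> norm (b n) * D" if y: "y \<in> ball t (t / 2)" for n y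
  proof (rule mult_left_mono)
    have "t / 2 \<le> y" using y by (auto simp: dist_real_def abs_if split: if_splits)
    then have "t / 2 * x n \<le> y * x n" using x by (intro mult_right_mono) auto
    then have "\<bar>x n\<bar> ^ i * exp (- (y * x n)) \<le> (D * exp (t / 2 * \<bar>x n\<bar>)) * exp (- (t / 2 * x n))"
      using D by (intro mult_mono D(2)) auto
    also have "\<dots> = D" using x by (simp add: mult.assoc exp_add[symmetric])
    finally show "\<bar>x n\<bar> ^ i * exp (- (y * x n)) \<le> D" .
  qed simp
  then show "\<exists>\<delta>>0. \<exists>M. summable M \<and> (\<forall>n. \<forall>y\<in>ball t \<delta>. norm (b n) * (\<bar>x n\<bar> ^ i * exp (- (y * x n))) \<le> M n)"
    using t by (intro exI[of _ "t / 2"] conjI exI[of _ "\<lambda>n. norm (b n) * D"] summable_mult2 assms(1)) auto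
qed simp

locale path_space_triple = horizontal_edges G \<tau>h H
  for G :: "('v, 'e) pre_digraph" and \<tau>h :: "'e \<Rightarrow> 'e" and H :: "('e \<times> 'e) set" +
  fixes vs :: "'v list" and R L :: "'v \<Rightarrow> real" and \<rho> :: real
  assumes enum: "distinct vs" "set vs = verts G"
    and primitive: "primitive_mat (graph_matrix G vs)"
    and PF: "PF_eigenvectors G vs R L"
    and lambda_gt_1: "lambda_PF G vs > 1"
    and rho: "0 < \<rho>" "\<rho> < 1"
begin

abbreviation lam :: real where "lam \<equiv> lambda_PF G vs"

definition cnt :: "nat \<Rightarrow> real" where "cnt n = real (card (edges_at G \<tau>h H n))"

definition \<kappa> :: real where "\<kappa> = - ln \<rho>"

definition s0 :: real where "s0 = ln lam / \<kappa>"

lemma kappa_pos: "\<kappa> > 0" using rho by (simp add: \<kappa>_def)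

lemma s0_pos: "s0 > 0" using kappa_pos lambda_gt_1 by (simp add: s0_def)

lemma exp_kappa_s0: "exp (\<kappa> * real n * s0) = lam ^ n"
  using kappa_pos lambda_gt_1 by (simp add: s0_def exp_of_nat_mult)

lemma inverse_rho_pow: "inverse (\<rho> ^ n) = exp (\<kappa> * real n)"
  using rho by (simp add: \<kappa>_def exp_minus exp_of_nat2_mult power_inverse)

lemma inverse_rho_pow_sq: "(inverse (\<rho> ^ n))\<^sup>2 = exp (2 * \<kappa> * real n)"
  unfolding inverse_rho_pow by (simp add: power2_eq_square exp_add[symmetric])

lemma cnt_nonneg: "cnt n \<ge> 0" by (simp add: cnt_def)

lemma cnt_asymptotics: "(\<lambda>n. cnt n / lam ^ n) \<longlonglongrightarrow> C1 G vs R L H"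
  unfolding cnt_def using card_edges_at_asymptotics[OF enum primitive PF] lambda_gt_1 by simp

lemma cnt_bound: obtains C where "C > 0" "\<And>n. cnt n \<le> C * lam ^ n"
proof -
  have "Bseq (\<lambda>n. cnt n / lam ^ n)" using cnt_asymptotics by (intro convergent_imp_Bseq convergentI)
  then obtain C where C: "C > 0" "\<And>n. norm (cnt n / lam ^ n) \<le> C" by (auto elim: BseqE)
  have "cnt n \<le> C * lam ^ n" for n
    using C(2)[of n] lambda_gt_1 cnt_nonneg[of n] by (simp add: field_simps)
  with C(1) show ?thesis by (rule that)
qed

lemma C1_pos:
  assumes "H \<noteq> {}" shows "C1 G vs R L H > 0"
proof -
  have pos: "R v > 0" "L v > 0" if "v \<in> verts G" for v using PF that by (auto simp: PF_eigenvectors_def)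
  obtain h where h: "h \<in> H" using assms by auto
  have inner: "(\<Sum>h\<in>H. R v * L (tail G (fst h))) > 0" if "v \<in> verts G" for v
    using that assms pos H_cases(5) by (intro sum_pos finite_H) auto
  have "(\<Sum>v\<in>verts G. \<Sum>h\<in>H. R v * L (tail G (fst h))) > 0"
    by (rule sum_pos[OF finite_verts _ inner]) (use H_cases(5)[OF h] in auto)
  then show ?thesis using lambda_gt_1 by (simp add: C1_def)
qed

definition pos_sum :: "real \<Rightarrow> real" where
  "pos_sum t = (\<Sum>n. lam ^ n * exp (- (t * exp (2 * \<kappa> * real n))))"

definition neg_sum :: "real \<Rightarrow> real" where
  "neg_sum t = (\<Sum>n. lam powr (- 1 - real n) * exp (- (t * exp (2 * \<kappa> * (- 1 - real n)))))"

lemma pos_sum_summable: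
  assumes "t > 0" shows "summable (\<lambda>n. lam ^ n * exp (- (t * exp (2 * \<kappa> * real n))))"
proof -
  have "summable (\<lambda>m. norm (lattice_term \<kappa> t 0 (of_real s0) (0 + int m)))"
    by (rule int_sum_split(1)[OF lattice_term_summable]) (use kappa_pos assms s0_pos in auto)
  then show ?thesis by (simp add: lattice_term_def norm_mult exp_kappa_s0)
qed

lemma lam_powr_eq: "lam powr (- 1 - real n) = exp (\<kappa> * (- 1 - real n) * s0)"
  using kappa_pos lambda_gt_1 by (simp add: s0_def powr_def)

lemma neg_sum_summable:
  assumes "t > 0" shows "summable (\<lambda>n. lam powr (- 1 - real n) * exp (- (t * exp (2 * \<kappa> * (- 1 - real n)))))"
proof -
  have "summable (\<lambda>m. norm (lattice_term \<kappa> t 0 (of_real s0) (0 - 1 - int m)))"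
    by (rule int_sum_split(2)[OF lattice_term_summable]) (use kappa_pos assms s0_pos in auto)
  then show ?thesis by (simp add: lattice_term_def norm_mult lam_powr_eq)
qed

lemma per_leading_term:
  assumes t: "t > 0"
  shows "per (- 2 * ln \<rho>) (of_real (ln lam)) (- ln t) * of_real (t powr (- s0 / 2)) = of_real (pos_sum t + neg_sum t)"
proof -
  have s0: "of_real s0 * of_real \<kappa> = (of_real (ln lam) :: complex)"
    using kappa_pos by (simp add: s0_def)
  have tp: "of_real (t powr (- s0 / 2)) = (of_real t powr (- of_real s0 / 2) :: complex)"
    using t powr_of_real[of t "- s0 / 2"] by simp
  let ?f = "lattice_term \<kappa> t 0 (of_real s0)"
  have sm: "summable (\<lambda>n. norm (?f (int_decode n)))"
    by (rule lattice_term_summable) (use kappa_pos t s0_pos in auto)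
  have "per (- 2 * ln \<rho>) (of_real (ln lam)) (- ln t) * of_real (t powr (- s0 / 2)) =
      per (2 * \<kappa>) (of_real s0 * of_real \<kappa>) (- ln t) * of_real t powr (- of_real s0 / 2)"
    by (simp only: s0 tp) (simp add: \<kappa>_def)
  also have "\<dots> = (\<Sum>n. ?f (int_decode n))"
    using higher_deriv_per_times_powr[of \<kappa> t "of_real s0" 0] kappa_pos t s0_pos by simp
  also have "\<dots> = (\<Sum>m. ?f (0 + int m)) + (\<Sum>m. ?f (0 - 1 - int m))"
    by (rule int_sum_split(3)[OF sm])
  also have "(\<Sum>m. ?f (0 + int m)) = of_real (pos_sum t)"
    unfolding pos_sum_def suminf_of_real[OF pos_sum_summable[OF t]]
    by (intro suminf_cong) (simp add: lattice_term_def exp_kappa_s0[symmetric] exp_of_real[symmetric])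
  also have "(\<Sum>m. ?f (0 - 1 - int m)) = of_real (neg_sum t)"
    unfolding neg_sum_def suminf_of_real[OF neg_sum_summable[OF t]]
    by (intro suminf_cong) (simp add: lattice_term_def lam_powr_eq exp_of_real[symmetric])
  finally show ?thesis by simp
qed

lemma trace_summable:
  assumes t: "t > 0" shows "summable (\<lambda>n. cnt n * exp (- (t * exp (2 * \<kappa> * real n))))"
proof -
  obtain C where C: "C > 0" "\<And>n. cnt n \<le> C * lam ^ n" using cnt_bound by blast
  have "cnt n * exp (- (t * exp (2 * \<kappa> * real n))) \<le> C * (lam ^ n * exp (- (t * exp (2 * \<kappa> * real n))))" for n
    using mult_right_mono[OF C(2)[of n], of "exp (- (t * exp (2 * \<kappa> * real n)))"] by (simp add: mult.assoc)
  then show ?thesis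
    by (intro summable_comparison_test[OF _ summable_mult[OF pos_sum_summable[OF t], of C]]) (auto simp: cnt_nonneg)
qed

lemma heat_trace:
  assumes t: "t > 0"
  shows "finite_trace (all_edges G \<tau>h H) (heat_op G \<tau>h H \<rho> t)"
    and "op_trace (all_edges G \<tau>h H) (heat_op G \<tau>h H \<rho> t) = of_real (\<Sum>n. cnt n * exp (- (t * exp (2 * \<kappa> * real n))))"
proof -
  have sm: "summable (\<lambda>n. real (card (edges_at G \<tau>h H n)) * exp (- t * (inverse (\<rho> ^ n))\<^sup>2))"
    using trace_summable[OF t] unfolding inverse_rho_pow_sq by (simp add: cnt_def)
  show "finite_trace (all_edges G \<tau>h H) (heat_op G \<tau>h H \<rho> t)"
    unfolding heat_op_def by (subst fun_calculus_trace(1)) (use rho sm in auto)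
  have "op_trace (all_edges G \<tau>h H) (heat_op G \<tau>h H \<rho> t) = of_real (\<Sum>n. real (card (edges_at G \<tau>h H n)) * exp (- t * (inverse (\<rho> ^ n))\<^sup>2))"
    unfolding heat_op_def by (rule fun_calculus_trace(2)) (use rho sm in auto)
  then show "op_trace (all_edges G \<tau>h H) (heat_op G \<tau>h H \<rho> t) = of_real (\<Sum>n. cnt n * exp (- (t * exp (2 * \<kappa> * real n))))"
    unfolding inverse_rho_pow_sq by (simp add: cnt_def)
qed

end

context path_space_triple
begin

lemma pos_sum_at_top: "filterlim pos_sum at_top (at_right 0)"
  unfolding filterlim_at_top
proof
  fix Z :: real
  define m where "m = nat \<lceil>Z\<rceil> + 1"
  have "((\<lambda>t. \<Sum>n<m. lam ^ n * exp (- (t * exp (2 * \<kappa> * real n)))) \<longlongrightarrow> (\<Sum>n<m. lam ^ n * exp (- (0 * exp (2 * \<kappa> * real n))))) (at_right 0)"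
    by (intro tendsto_intros)
  moreover have "(\<Sum>n<m. lam ^ n * exp (- (0 * exp (2 * \<kappa> * real n)))) > Z"
  proof -
    have "Z < (\<Sum>n<m. 1)" by (simp add: m_def) linarith
    also have "\<dots> \<le> (\<Sum>n<m. lam ^ n)" using lambda_gt_1 by (intro sum_mono) simp
    finally show ?thesis by simp
  qed
  ultimately have "eventually (\<lambda>t. (\<Sum>n<m. lam ^ n * exp (- (t * exp (2 * \<kappa> * real n)))) > Z) (at_right 0)"
    by (rule order_tendstoD(1))
  moreover have "eventually (\<lambda>t::real. t > 0) (at_right 0)" by (simp add: eventually_at_right_less)
  ultimately show "eventually (\<lambda>t. Z \<le> pos_sum t) (at_right 0)"
  proof eventually_elim
    case (elim t)
    have "(\<Sum>n<m. lam ^ n * exp (- (t * exp (2 * \<kappa> * real n)))) \<le> pos_sum t"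
      unfolding pos_sum_def by (rule sum_le_suminf[OF pos_sum_summable]) (use elim lambda_gt_1 in auto)
    with elim show ?case by simp
  qed
qed

lemma neg_sum_bounds:
  assumes "t > 0"
  shows "0 \<le> neg_sum t" "neg_sum t \<le> (\<Sum>n. lam powr (- 1 - real n))"
proof -
  have eq: "lam powr (- 1 - real n) = inverse lam * inverse lam ^ n" for n
    using lambda_gt_1 by (simp add: powr_diff powr_minus powr_realpow divide_inverse power_inverse)
  have sm: "summable (\<lambda>n. lam powr (- 1 - real n))"
    unfolding eq using lambda_gt_1 by (intro summable_mult summable_geometric) (simp add: inverse_less_1_iff)
  show "0 \<le> neg_sum t" unfolding neg_sum_def
    by (rule suminf_nonneg[OF neg_sum_summable[OF assms]]) simp
  show "neg_sum t \<le> (\<Sum>n. lam powr (- 1 - real n))"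
    unfolding neg_sum_def
    by (rule suminf_le[OF _ neg_sum_summable[OF assms] sm]) (use assms in \<open>simp add: mult_left_le\<close>)
qed

lemma heat_trace_leading_term:
  assumes c: "c > 0" and C: "C1 G vs R L H > 0"
  shows "eventually (\<lambda>t. \<bar>(\<Sum>n. cnt n * exp (- (t * exp (2 * \<kappa> * real n)))) - C1 G vs R L H * (pos_sum t + neg_sum t)\<bar>
    \<le> c * (C1 G vs R L H * (pos_sum t + neg_sum t))) (at_right 0)"
proof -
  define C where "C = C1 G vs R L H"
  have C0: "C > 0" using assms(2) by (simp add: C_def)
  define e where "e = c * C / 2"
  have e: "e > 0" using c C0 by (simp add: e_def)
  obtain N where N: "\<And>n. n \<ge> N \<Longrightarrow> \<bar>cnt n / lam ^ n - C\<bar> < e"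
    using LIMSEQ_D[OF cnt_asymptotics e] by (auto simp: C_def)
  define B where "B = (\<Sum>n<N. \<bar>cnt n - C * lam ^ n\<bar>) + C * (\<Sum>n. lam powr (- 1 - real n))"
  have diff: "\<bar>cnt n - C * lam ^ n\<bar> \<le> e * lam ^ n + (if n < N then \<bar>cnt n - C * lam ^ n\<bar> else 0)" for n
  proof (cases "n < N")
    case False
    then have "\<bar>cnt n / lam ^ n - C\<bar> * lam ^ n \<le> e * lam ^ n"
      using N[of n] lambda_gt_1 by (intro mult_right_mono) auto
    moreover have "\<bar>cnt n / lam ^ n - C\<bar> * lam ^ n = \<bar>(cnt n / lam ^ n - C) * lam ^ n\<bar>"
      using lambda_gt_1 by (simp add: abs_mult)
    moreover have "(cnt n / lam ^ n - C) * lam ^ n = cnt n - C * lam ^ n"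
      using lambda_gt_1 by (simp add: field_simps)
    ultimately show ?thesis using False by simp
  qed (use e lambda_gt_1 in simp)
  have "eventually (\<lambda>t. pos_sum t \<ge> B / e) (at_right 0)"
    using pos_sum_at_top by (simp add: filterlim_at_top)
  moreover have "eventually (\<lambda>t::real. t > 0) (at_right 0)" by (simp add: eventually_at_right_less)
  ultimately show ?thesis
  proof eventually_elim
    case (elim t)
    then have t: "t > 0" by simp
    define w where "w n = exp (- (t * exp (2 * \<kappa> * real n)))" for n :: nat
    have w: "0 \<le> w n" "w n \<le> 1" for n using t by (auto simp: w_def)
    note sm = trace_summable[OF t, folded w_def] and smp = pos_sum_summable[OF t, folded w_def]
    have P: "pos_sum t = (\<Sum>n. lam ^ n * w n)" by (simp add: pos_sum_def w_def)
    have smd: "summable (\<lambda>n. cnt n * w n - C * (lam ^ n * w n))"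
      by (intro summable_diff sm summable_mult smp)
    have "(\<Sum>n. cnt n * w n) - C * pos_sum t = (\<Sum>n. cnt n * w n - C * (lam ^ n * w n))"
      unfolding P using suminf_diff[OF sm summable_mult[OF smp, of C]] suminf_mult[OF smp, of C] by simp
    also have "\<bar>\<dots>\<bar> \<le> (\<Sum>n. e * (lam ^ n * w n) + (if n < N then \<bar>cnt n - C * lam ^ n\<bar> else 0))"
    proof -
      have le: "norm (cnt n * w n - C * (lam ^ n * w n)) \<le> e * (lam ^ n * w n) + (if n < N then \<bar>cnt n - C * lam ^ n\<bar> else 0)" for n
      proof -
        have "norm (cnt n * w n - C * (lam ^ n * w n)) = \<bar>cnt n - C * lam ^ n\<bar> * w n"
          using w(1)[of n] by (simp add: abs_mult left_diff_distrib flip: mult.assoc)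
            (metis abs_mult abs_of_nonneg left_diff_distrib)
        also have "\<dots> \<le> (e * lam ^ n + (if n < N then \<bar>cnt n - C * lam ^ n\<bar> else 0)) * w n"
          by (intro mult_right_mono diff w)
        also have "\<dots> \<le> e * (lam ^ n * w n) + (if n < N then \<bar>cnt n - C * lam ^ n\<bar> else 0)"
          using w[of n] by (auto simp: distrib_right mult.assoc intro: mult_left_le)
        finally show ?thesis .
      qed
      have "summable (\<lambda>n. e * (lam ^ n * w n) + (if n < N then \<bar>cnt n - C * lam ^ n\<bar> else 0))"
        by (intro summable_add summable_mult smp summable_finite[of "{..<N}"]) auto
      from norm_suminf_le[OF le this] show ?thesis by simp
    qed
    also have "\<dots> = e * pos_sum t + (\<Sum>n<N. \<bar>cnt n - C * lam ^ n\<bar>)"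
    proof -
      have "(\<lambda>n. if n < N then \<bar>cnt n - C * lam ^ n\<bar> else 0) sums (\<Sum>n<N. \<bar>cnt n - C * lam ^ n\<bar>)"
        using sums_If_finite_set[of "{..<N}" "\<lambda>n. \<bar>cnt n - C * lam ^ n\<bar>"] by simp
      from sums_add[OF sums_mult[OF summable_sums[OF smp], of e] this] show ?thesis
        unfolding P by (simp add: sums_iff)
    qed
    finally have 1: "\<bar>(\<Sum>n. cnt n * w n) - C * pos_sum t\<bar> \<le> e * pos_sum t + (\<Sum>n<N. \<bar>cnt n - C * lam ^ n\<bar>)" .
    have nb: "0 \<le> C * neg_sum t" "C * neg_sum t \<le> C * (\<Sum>n. lam powr (- 1 - real n))"
      using neg_sum_bounds[OF t] C0 by (auto intro: mult_left_mono)
    have "B \<le> e * pos_sum t" using elim e by (simp add: field_simps)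
    then have "\<bar>(\<Sum>n. cnt n * w n) - C * (pos_sum t + neg_sum t)\<bar> \<le> 2 * e * pos_sum t"
      using 1 nb unfolding B_def distrib_left by linarith
    also have "\<dots> \<le> c * (C * (pos_sum t + neg_sum t))"
      using mult_nonneg_nonneg[OF less_imp_le[OF c] nb(1)] by (simp add: e_def algebra_simps)
    finally show ?case by (simp add: C_def w_def)
  qed
qed

lemma heat_trace_equivalent:
  "(\<lambda>t. op_trace (all_edges G \<tau>h H) (heat_op G \<tau>h H \<rho> t) - of_real (C1 G vs R L H) * per (- 2 * ln \<rho>) (of_real (ln lam)) (- ln t) * of_real (t powr (- s0 / 2)))
    \<in> o[at_right 0](\<lambda>t. of_real (C1 G vs R L H) * per (- 2 * ln \<rho>) (of_real (ln lam)) (- ln t) * of_real (t powr (- s0 / 2)))"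
proof (rule landau_o.smallI)
  fix c :: real assume c: "c > 0"
  define tr where "tr t = (\<Sum>n. cnt n * exp (- (t * exp (2 * \<kappa> * real n))))" for t
  define S where "S t = C1 G vs R L H * (pos_sum t + neg_sum t)" for t
  have ev: "eventually (\<lambda>t. \<bar>tr t - S t\<bar> \<le> c * S t) (at_right 0)"
  proof (cases "H = {}")
    case True
    then have "edges_at G \<tau>h H n = {}" for n by (simp add: edges_at_def)
    then have "cnt n = 0" for n by (simp add: cnt_def)
    moreover have "C1 G vs R L H = 0" using True by (simp add: C1_def)
    ultimately show ?thesis by (simp add: tr_def S_def)
  next
    case False
    show ?thesis unfolding tr_def S_def by (rule heat_trace_leading_term[OF c C1_pos[OF False]])
  qed
  have "eventually (\<lambda>t::real. t > 0) (at_right 0)" by (simp add: eventually_at_right_less)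
  with ev show "eventually (\<lambda>t. norm (op_trace (all_edges G \<tau>h H) (heat_op G \<tau>h H \<rho> t) - of_real (C1 G vs R L H) * per (- 2 * ln \<rho>) (of_real (ln lam)) (- ln t) * of_real (t powr (- s0 / 2)))
     \<le> c * norm (of_real (C1 G vs R L H) * per (- 2 * ln \<rho>) (of_real (ln lam)) (- ln t) * of_real (t powr (- s0 / 2)))) (at_right 0)"
  proof eventually_elim
    case (elim t)
    have g: "of_real (C1 G vs R L H) * per (- 2 * ln \<rho>) (of_real (ln lam)) (- ln t) * of_real (t powr (- s0 / 2)) = of_real (S t)"
      unfolding mult.assoc per_leading_term[OF elim(2)] by (simp add: S_def)
    have "norm (complex_of_real (tr t) - of_real (S t)) \<le> c * norm (complex_of_real (S t))"
      using elim(1) c by (simp flip: of_real_diff) (smt (verit) abs_ge_self mult_left_mono)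
    then show ?case unfolding g heat_trace(2)[OF elim(2)] tr_def .
  qed
qed

lemma spectral_dim_eq:
  assumes "H \<noteq> {}"
  shows "spectral_dim G \<tau>h H \<rho> = ereal s0"
proof -
  have weight: "inverse (\<rho> ^ n) powr (- s) = exp (\<kappa> * real n * (- s))" for n s
    unfolding inverse_rho_pow by (simp add: powr_def mult_ac)
  have term_eq: "cnt n * exp (\<kappa> * real n * (- s)) = cnt n / lam ^ n * exp (\<kappa> * (s0 - s)) ^ n" for n s
    by (simp add: exp_kappa_s0[symmetric] exp_of_nat_mult[symmetric] exp_diff[symmetric] divide_inverse exp_minus[symmetric] exp_add[symmetric] algebra_simps)
  have iff: "finite_trace (all_edges G \<tau>h H) (abs_dirac_power G \<tau>h H \<rho> s) \<longleftrightarrow> summable (\<lambda>n. cnt n * exp (\<kappa> * real n * (- s)))" for s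
    unfolding abs_dirac_power_def
    by (subst fun_calculus_trace(1)) (use rho in \<open>simp_all add: weight cnt_def\<close>)
  have conv: "summable (\<lambda>n. cnt n * exp (\<kappa> * real n * (- s))) \<longleftrightarrow> s0 < s" for s
  proof
    assume s: "s0 < s"
    have q: "exp (\<kappa> * (s0 - s)) < 1" using s kappa_pos by (simp add: mult_pos_neg)
    obtain C where C: "C > 0" "\<And>n. cnt n \<le> C * lam ^ n" using cnt_bound by blast
    show "summable (\<lambda>n. cnt n * exp (\<kappa> * real n * (- s)))"
    proof (rule summable_comparison_test)
      show "summable (\<lambda>n. C * exp (\<kappa> * (s0 - s)) ^ n)"
        using q by (intro summable_mult summable_geometric) simp
      have "cnt n * exp (\<kappa> * real n * (- s)) \<le> C * exp (\<kappa> * (s0 - s)) ^ n" for n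
        unfolding term_eq using C(2)[of n] lambda_gt_1 by (intro mult_right_mono) (auto simp: field_simps)
      then show "\<exists>N. \<forall>n\<ge>N. norm (cnt n * exp (\<kappa> * real n * (- s))) \<le> C * exp (\<kappa> * (s0 - s)) ^ n"
        using cnt_nonneg by auto
    qed
  next
    assume sm: "summable (\<lambda>n. cnt n * exp (\<kappa> * real n * (- s)))"
    show "s0 < s"
    proof (rule ccontr)
      assume "\<not> s0 < s"
      then have q: "exp (\<kappa> * (s0 - s)) \<ge> 1" using kappa_pos by simp
      have "cnt n / lam ^ n \<le> cnt n * exp (\<kappa> * real n * (- s))" for n
        unfolding term_eq using mult_left_mono[OF one_le_power[OF q, of n], of "cnt n / lam ^ n"] cnt_nonneg[of n] lambda_gt_1 by simp
      then have "C1 G vs R L H \<le> 0"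
        by (intro LIMSEQ_le[OF cnt_asymptotics summable_LIMSEQ_zero[OF sm]]) auto
      with C1_pos[OF assms] show False by simp
    qed
  qed
  have "spectral_dim G \<tau>h H \<rho> = Inf {ereal s |s. s0 < s}"
    unfolding spectral_dim_def iff conv ..
  also have "\<dots> = ereal s0"
  proof (rule antisym)
    show "ereal s0 \<le> Inf {ereal s |s. s0 < s}" by (rule Inf_greatest) auto
    show "Inf {ereal s |s. s0 < s} \<le> ereal s0"
    proof (rule dense_ge)
      fix y assume "ereal s0 < y"
      then show "Inf {ereal s |s. s0 < s} \<le> y" by (cases y) (auto intro: Inf_lower)
    qed
  qed
  finally show ?thesis .
qed

end

context path_space_triple
begin

definition poly_exp_term :: "complex poly \<Rightarrow> complex \<Rightarrow> int \<Rightarrow> complex" where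
  "poly_exp_term Q \<zeta> n = poly Q (of_int n) * exp (of_real (\<kappa> * of_int n) * (Ln \<zeta> / of_real \<kappa>))"

lemma poly_exp_term_nat:
  assumes "\<zeta> \<noteq> 0"
  shows "poly_exp_term Q \<zeta> (int n) = poly Q (of_nat n) * \<zeta> ^ n"
proof -
  have "of_real (\<kappa> * of_int (int n)) * (Ln \<zeta> / of_real \<kappa>) = of_nat n * Ln \<zeta>"
    using kappa_pos by simp
  then show ?thesis using assms by (simp only: poly_exp_term_def exp_of_nat_mult exp_Ln) simp
qed

lemma poly_deriv_split:
  fixes Q :: "complex poly" and N :: int
  assumes t: "t > 0" and \<zeta>: "cmod \<zeta> > 1"
  defines "g \<equiv> \<lambda>n. poly_exp_term Q \<zeta> n * of_real (exp (- (t * exp (2 * \<kappa> * of_int n))))"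
  shows "poly_deriv Q (1 / (- ln \<rho>)) (\<lambda>s. per (- 2 * ln \<rho>) (- s * ln \<rho>) (- ln t) * of_real t powr (- s / 2)) (Ln \<zeta> / (- ln \<rho>)) =
      (\<Sum>m. g (N + int m)) + (\<Sum>m. g (N - 1 - int m))"
    and "summable (\<lambda>m. norm (g (N + int m)))" "summable (\<lambda>m. norm (g (N - 1 - int m)))"
proof -
  have "\<zeta> \<noteq> 0" using \<zeta> by auto
  then have "Re (Ln \<zeta> / of_real \<kappa>) > 0"
    using kappa_pos \<zeta> by (simp add: Re_divide_of_real)
  note pd = poly_deriv_per_times_powr[where Q = Q, OF kappa_pos t this]
  have g: "g = (\<lambda>n. poly Q (of_int n) * exp (of_real (\<kappa> * of_int n) * (Ln \<zeta> / of_real \<kappa>)) * of_real (exp (- (t * exp (2 * \<kappa> * of_int n)))))"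
    by (simp add: g_def poly_exp_term_def)
  note split = int_sum_split[OF pd(2), of N]
  show "summable (\<lambda>m. norm (g (N + int m)))" "summable (\<lambda>m. norm (g (N - 1 - int m)))"
    unfolding g by (rule split(1), rule split(2))
  have "poly_deriv Q (1 / (- ln \<rho>)) (\<lambda>s. per (- 2 * ln \<rho>) (- s * ln \<rho>) (- ln t) * of_real t powr (- s / 2)) (Ln \<zeta> / (- ln \<rho>)) =
      poly_deriv Q (1 / of_real \<kappa>) (\<lambda>s. per (2 * \<kappa>) (s * of_real \<kappa>) (- ln t) * of_real t powr (- s / 2)) (Ln \<zeta> / of_real \<kappa>)"
    by (simp add: \<kappa>_def)
  also have "\<dots> = (\<Sum>m. g (N + int m)) + (\<Sum>m. g (N - 1 - int m))"
    unfolding g split(3)[symmetric] by (rule pd(1))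
  finally show "poly_deriv Q (1 / (- ln \<rho>)) (\<lambda>s. per (- 2 * ln \<rho>) (- s * ln \<rho>) (- ln t) * of_real t powr (- s / 2)) (Ln \<zeta> / (- ln \<rho>)) =
      (\<Sum>m. g (N + int m)) + (\<Sum>m. g (N - 1 - int m))" .
qed

lemma exists_maximal_order:
  fixes B :: "complex set"
  assumes B: "finite B" "\<And>\<zeta>. \<zeta> \<in> B \<Longrightarrow> cmod \<zeta> < 1"
  obtains K where "\<And>\<zeta>. \<zeta> \<in> B \<Longrightarrow> cmod \<zeta> < \<rho> ^ (2 * K)"
    "\<And>k. (\<And>\<zeta>. \<zeta> \<in> B \<Longrightarrow> cmod \<zeta> < \<rho> ^ (2 * k)) \<Longrightarrow> k \<le> K \<or> B \<subseteq> {0}"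
proof (cases "B \<subseteq> {0}")
  case True
  then show ?thesis using that[of 0] B by auto
next
  case False
  then obtain \<zeta>0 where m0: "\<zeta>0 \<in> B" "\<zeta>0 \<noteq> 0" by auto
  define A where "A = {k. \<forall>\<zeta>\<in>B. cmod \<zeta> < \<rho> ^ (2 * k)}"
  obtain m where m: "\<rho> ^ m < cmod \<zeta>0"
    using real_arch_pow_inv[of "cmod \<zeta>0" \<rho>] m0(2) rho by auto
  have "k \<le> m" if "k \<in> A" for k
  proof (rule ccontr)
    assume "\<not> k \<le> m"
    then have "\<rho> ^ (2 * k) \<le> \<rho> ^ m" using rho by (intro power_decreasing) auto
    then show False using that m0(1) m by (force simp: A_def)
  qed
  then have fin: "finite A" by (intro finite_subset[of A "{..m}"]) auto
  have "0 \<in> A" using B(2) by (simp add: A_def)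
  then have "Max A \<in> A" using fin by (intro Max_in) auto
  then show ?thesis using Max_ge[OF fin] by (intro that[of "Max A"]) (auto simp: A_def)
qed

lemma heat_trace_expansion:
  fixes P :: "complex \<Rightarrow> complex poly"
  assumes polys: "counting_polys G vs \<tau>h H P"
    and no_unit: "\<forall>\<zeta>. eigenvalue (graph_matrix G vs :: complex mat) \<zeta> \<longrightarrow> cmod \<zeta> \<noteq> 1"
  shows "\<exists>h. remainder_regular (graph_matrix G vs) P \<rho> h \<and>
    (\<forall>t>0. op_trace (all_edges G \<tau>h H) (heat_op G \<tau>h H \<rho> t) =
          (\<Sum>\<zeta>\<in>{\<zeta> \<in> spectrum (graph_matrix G vs). cmod \<zeta> > 1}.
             poly_deriv (P \<zeta>) (1 / (- ln \<rho>))
               (\<lambda>s. per (- 2 * ln \<rho>) (- s * ln \<rho>) (- ln t) * of_real t powr (- s / 2))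
               (Ln \<zeta> / (- ln \<rho>))) + h t)"
proof -
  define Sp where "Sp = spectrum (graph_matrix G vs :: complex mat)"
  have "(graph_matrix G vs :: complex mat) \<in> carrier_mat (length vs) (length vs)"
    by (simp add: graph_matrix_def)
  then have finSp: "finite Sp" unfolding Sp_def by (rule card_finite_spectrum)
  have not1: "cmod \<zeta> \<noteq> 1" if "\<zeta> \<in> Sp" for \<zeta> using that no_unit by (simp add: Sp_def spectrum_def)
  define big where "big = {\<zeta> \<in> Sp. cmod \<zeta> > 1}"
  define small where "small = {\<zeta> \<in> Sp. cmod \<zeta> < 1 \<and> P \<zeta> \<noteq> 0}"
  have fin: "finite big" "finite small" using finSp by (simp_all add: big_def small_def)
  have "\<forall>\<^sub>F n in sequentially. of_real (cnt n) = (\<Sum>\<zeta>\<in>Sp. poly (P \<zeta>) (of_nat n) * \<zeta> ^ n)"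
    using polys by (simp add: counting_polys_def cnt_def Sp_def)
  then obtain M0 where M0: "\<And>n. n \<ge> M0 \<Longrightarrow> of_real (cnt n) = (\<Sum>\<zeta>\<in>Sp. poly (P \<zeta>) (of_nat n) * \<zeta> ^ n)"
    by (auto simp: eventually_sequentially)
  define M where "M = Suc M0"
  have M: "of_real (cnt n) = (\<Sum>\<zeta>\<in>big. poly (P \<zeta>) (of_nat n) * \<zeta> ^ n) + (\<Sum>\<zeta>\<in>small. poly (P \<zeta>) (of_nat n) * \<zeta> ^ n)"
    if "n \<ge> M" for n
  proof -
    have "(\<Sum>\<zeta>\<in>Sp. poly (P \<zeta>) (of_nat n) * \<zeta> ^ n) = (\<Sum>\<zeta>\<in>big \<union> small. poly (P \<zeta>) (of_nat n) * \<zeta> ^ n)"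
      by (rule sum.mono_neutral_right) (use finSp not1 in \<open>force simp: big_def small_def not_less\<close>)+
    also have "\<dots> = (\<Sum>\<zeta>\<in>big. poly (P \<zeta>) (of_nat n) * \<zeta> ^ n) + (\<Sum>\<zeta>\<in>small. poly (P \<zeta>) (of_nat n) * \<zeta> ^ n)"
      by (rule sum.union_disjoint[OF fin]) (auto simp: big_def small_def)
    finally show ?thesis using M0[of n] that by (simp add: M_def)
  qed
  have small1: "cmod \<zeta> < 1" if "\<zeta> \<in> small" for \<zeta> using that by (simp add: small_def)
  obtain K where K: "\<And>\<zeta>. \<zeta> \<in> small \<Longrightarrow> cmod \<zeta> < \<rho> ^ (2 * K)"
    "\<And>k. (\<And>\<zeta>. \<zeta> \<in> small \<Longrightarrow> cmod \<zeta> < \<rho> ^ (2 * k)) \<Longrightarrow> k \<le> K \<or> small \<subseteq> {0}"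
    using exists_maximal_order[OF fin(2) small1] by metis

  define a where "a n = (if n < M then complex_of_real (cnt n) else 0)" for n
  define b where "b m = (\<Sum>\<zeta>\<in>small. poly (P \<zeta>) (of_nat (m + M)) * \<zeta> ^ (m + M))" for m
  define q where "q m = (\<Sum>\<zeta>\<in>big. poly_exp_term (P \<zeta>) \<zeta> (int M - 1 - int m))" for m
  define x where "x m = exp (2 * \<kappa> * real (m + M))" for m
  define y where "y m = exp (2 * \<kappa> * of_int (int M - 1 - int m))" for m
  define h1 where "h1 t = (\<Sum>n. a n * of_real (exp (- (t * exp (2 * \<kappa> * real n)))))" for t
  define h2 where "h2 t = (\<Sum>m. b m * of_real (taylor_exp K (t * x m)))" for t
  define h3 where "h3 t = (\<Sum>m. - q m * of_real (exp (- (t * y m))))" for t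

  have sum_b: "summable (\<lambda>m. norm (b m) * x m ^ k)" if k: "\<And>\<zeta>. \<zeta> \<in> small \<Longrightarrow> cmod \<zeta> < \<rho> ^ (2 * k)" for k
  proof (rule summable_comparison_test)
    have "summable (\<lambda>m. norm (poly (P \<zeta>) (of_nat (m + M))) * (cmod \<zeta> / \<rho> ^ (2 * k)) ^ (m + M))" if "\<zeta> \<in> small" for \<zeta>
      using summable_ignore_initial_segment[OF summable_poly_times_power[of "cmod \<zeta> / \<rho> ^ (2 * k)" "P \<zeta>"], of M]
        k[OF that] rho by simp
    then show "summable (\<lambda>m. \<Sum>\<zeta>\<in>small. norm (poly (P \<zeta>) (of_nat (m + M))) * (cmod \<zeta> / \<rho> ^ (2 * k)) ^ (m + M))"
      by (intro summable_sum)
    have "norm (b m) * x m ^ k \<le> (\<Sum>\<zeta>\<in>small. norm (poly (P \<zeta>) (of_nat (m + M))) * (cmod \<zeta> / \<rho> ^ (2 * k)) ^ (m + M))" for m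
    proof -
      have "x m ^ k = inverse (\<rho> ^ (2 * k)) ^ (m + M)"
        unfolding x_def inverse_rho_pow_sq[symmetric] by (simp add: power_inverse power_mult[symmetric] mult_ac)
      then have xk: "norm (poly (P \<zeta>) (of_nat (m + M)) * \<zeta> ^ (m + M)) * x m ^ k = norm (poly (P \<zeta>) (of_nat (m + M))) * (cmod \<zeta> / \<rho> ^ (2 * k)) ^ (m + M)" for \<zeta>
        by (simp add: norm_mult norm_power power_mult_distrib divide_inverse)
      have "norm (b m) * x m ^ k \<le> (\<Sum>\<zeta>\<in>small. norm (poly (P \<zeta>) (of_nat (m + M)) * \<zeta> ^ (m + M))) * x m ^ k"
        unfolding b_def by (intro mult_right_mono norm_sum) (simp add: x_def)
      then show ?thesis unfolding sum_distrib_right xk .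
    qed
    then show "\<exists>N. \<forall>m\<ge>N. norm (norm (b m) * x m ^ k) \<le> (\<Sum>\<zeta>\<in>small. norm (poly (P \<zeta>) (of_nat (m + M))) * (cmod \<zeta> / \<rho> ^ (2 * k)) ^ (m + M))"
      by (auto simp: x_def)
  qed
  have sum_b0: "summable (\<lambda>m. norm (b m))" using sum_b[of 0] small1 by simp
  have yle: "y m \<le> exp (2 * \<kappa> * real M)" for m
    using kappa_pos by (simp add: y_def)
  have sum_q: "summable (\<lambda>m. norm (q m))"
  proof (rule summable_comparison_test)
    let ?g = "\<lambda>\<zeta> n. poly_exp_term (P \<zeta>) \<zeta> n * of_real (exp (- (1 * exp (2 * \<kappa> * of_int n))))"
    show "summable (\<lambda>m. (\<Sum>\<zeta>\<in>big. norm (?g \<zeta> (int M - 1 - int m))) * exp (exp (2 * \<kappa> * real M)))"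
      by (intro summable_mult2 summable_sum poly_deriv_split(3)) (auto simp: big_def)
    have "norm (q m) \<le> (\<Sum>\<zeta>\<in>big. norm (?g \<zeta> (int M - 1 - int m))) * exp (exp (2 * \<kappa> * real M))" for m
    proof -
      have "norm (poly_exp_term (P \<zeta>) \<zeta> (int M - 1 - int m)) \<le> norm (?g \<zeta> (int M - 1 - int m)) * exp (exp (2 * \<kappa> * real M))" for \<zeta>
      proof -
        have "1 \<le> exp (- y m) * exp (exp (2 * \<kappa> * real M))" using yle[of m] by (simp add: exp_add[symmetric])
        then have "norm (poly_exp_term (P \<zeta>) \<zeta> (int M - 1 - int m)) * 1 \<le> norm (poly_exp_term (P \<zeta>) \<zeta> (int M - 1 - int m)) * (exp (- y m) * exp (exp (2 * \<kappa> * real M)))"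
          by (intro mult_left_mono) auto
        then show ?thesis by (simp add: norm_mult y_def mult.assoc)
      qed
      then have "(\<Sum>\<zeta>\<in>big. norm (poly_exp_term (P \<zeta>) \<zeta> (int M - 1 - int m))) \<le> (\<Sum>\<zeta>\<in>big. norm (?g \<zeta> (int M - 1 - int m)) * exp (exp (2 * \<kappa> * real M)))"
        by (intro sum_mono)
      then show ?thesis unfolding q_def sum_distrib_right[symmetric] by (rule order_trans[OF norm_sum])
    qed
    then show "\<exists>N. \<forall>m\<ge>N. norm (norm (q m)) \<le> (\<Sum>\<zeta>\<in>big. norm (?g \<zeta> (int M - 1 - int m))) * exp (exp (2 * \<kappa> * real M))"
      by auto
  qed

  have Ck1: "Ck_on k h1 UNIV" for k
    unfolding h1_def
  proof (rule Ck_on_bounded_exp_series)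
    show "summable (\<lambda>n. norm (a n))" by (rule summable_finite[of "{..<M}"]) (auto simp: a_def)
    show "exp (2 * \<kappa> * real n) \<le> exp (2 * \<kappa> * real M)" if "a n \<noteq> 0" for n
      using that kappa_pos by (auto simp: a_def split: if_splits)
  qed simp
  have Ck3: "Ck_on k h3 UNIV" for k
    unfolding h3_def
    by (rule Ck_on_bounded_exp_series[where X = "exp (2 * \<kappa> * real M)"]) (use sum_q yle in \<open>auto simp: y_def\<close>)
  have h2_pos: "h2 t = (\<Sum>m. b m * of_real (exp (- (t * x m))))" if "t > 0" for t
    using that by (simp add: h2_def taylor_exp_def x_def)
  have Ck2: "Ck_on k h2 {0<..}" for k
    by (rule Ck_on_cong[OF _ _ Ck_on_decaying_exp_series[OF sum_b0, of x]]) (auto simp: h2_pos x_def)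
  have Ck2': "Ck_on k h2 {- 1<..<1}" if k: "\<And>\<zeta>. \<zeta> \<in> small \<Longrightarrow> cmod \<zeta> < \<rho> ^ (2 * k)" for k
  proof (cases "k \<le> K")
    case True
    show ?thesis unfolding h2_def
      by (rule Ck_on_taylor_series[OF _ True sum_b[OF K(1)]]) (use kappa_pos in \<open>auto simp: x_def\<close>)
  next
    case False
    then have "small \<subseteq> {0}" using K(2)[of k] k by auto
    then have "b m = 0" for m unfolding b_def by (intro sum.neutral) (auto simp: M_def)
    then have "h2 = (\<lambda>_. 0)" by (simp add: h2_def fun_eq_iff)
    then show ?thesis unfolding Ck_on_def by (intro exI[of _ "\<lambda>_ _. 0"]) auto
  qed

  define h where "h t = h1 t + h2 t + h3 t" for t
  have Ckh: "Ck_on k h U" if "Ck_on k h2 U" for k U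
    unfolding h_def by (intro Ck_on_add that Ck_on_subset[OF Ck1] Ck_on_subset[OF Ck3]) auto
  show ?thesis
  proof (intro exI[of _ h] conjI allI impI)
    have "Ck_on k h {- 1<..<1}" if "\<forall>\<zeta>\<in>Sp. cmod \<zeta> < 1 \<and> P \<zeta> \<noteq> 0 \<longrightarrow> cmod \<zeta> < \<rho> ^ (2 * k)" for k
      by (rule Ckh[OF Ck2']) (use that in \<open>auto simp: small_def\<close>)
    then show "remainder_regular (graph_matrix G vs) P \<rho> h"
      unfolding remainder_regular_def Sp_def[symmetric]
      by (intro conjI allI exI[of _ 1] impI Ckh[OF Ck2]) auto
  next
    fix t :: real assume t: "t > 0"
    define g where "g \<zeta> n = poly_exp_term (P \<zeta>) \<zeta> n * of_real (exp (- (t * exp (2 * \<kappa> * of_int n))))" for \<zeta> n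
    define w where "w n = exp (- (t * exp (2 * \<kappa> * real n)))" for n
    have big1: "cmod \<zeta> > 1" if "\<zeta> \<in> big" for \<zeta> using that by (simp add: big_def)
    note split = poly_deriv_split[OF t big1, where N = "int M" and Q = "P _", folded g_def]
    have smg: "summable (\<lambda>m. g \<zeta> (int M + int m))" "summable (\<lambda>m. g \<zeta> (int M - 1 - int m))" if "\<zeta> \<in> big" for \<zeta>
      using split(2,3)[OF that, of \<zeta>] by (auto intro: summable_norm_cancel simp: g_def)
    have smw: "summable (\<lambda>m. b m * of_real (exp (- (t * x m))))"
    proof (rule summable_comparison_test[OF _ sum_b0])
      show "\<exists>N. \<forall>n\<ge>N. norm (b n * of_real (exp (- (t * x n)))) \<le> norm (b n)"
        using t by (auto simp: norm_mult x_def intro!: mult_left_le)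
    qed
    have "complex_of_real (\<Sum>n. cnt n * w n) = (\<Sum>n. of_real (cnt n * w n))"
      by (rule suminf_of_real) (use trace_summable[OF t] in \<open>simp add: w_def\<close>)
    also have "\<dots> = (\<Sum>m. of_real (cnt (m + M) * w (m + M))) + (\<Sum>n<M. of_real (cnt n * w n))"
      by (rule suminf_split_initial_segment) (rule summable_of_real, use trace_summable[OF t] in \<open>simp add: w_def\<close>)
    also have "(\<Sum>n<M. complex_of_real (cnt n * w n)) = h1 t"
    proof -
      have "(\<lambda>n. a n * of_real (w n)) sums (\<Sum>n<M. complex_of_real (cnt n * w n))"
        using sums_If_finite_set[of "{..<M}" "\<lambda>n. complex_of_real (cnt n * w n)"]
        by (rule sums_cong[THEN iffD1, rotated]) (auto simp: a_def)
      then show ?thesis by (simp add: h1_def w_def sums_iff)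
    qed
    also have "(\<Sum>m. complex_of_real (cnt (m + M) * w (m + M))) = (\<Sum>m. (\<Sum>\<zeta>\<in>big. g \<zeta> (int M + int m)) + b m * of_real (exp (- (t * x m))))"
    proof (rule suminf_cong)
      fix m
      have "g \<zeta> (int M + int m) = poly (P \<zeta>) (of_nat (m + M)) * \<zeta> ^ (m + M) * of_real (w (m + M))" if "\<zeta> \<in> big" for \<zeta>
      proof -
        have "\<zeta> \<noteq> 0" using big1[OF that] by auto
        from poly_exp_term_nat[OF this, of "P \<zeta>" "m + M"] show ?thesis
          by (simp add: g_def w_def add.commute)
      qed
      moreover have "exp (- (t * x m)) = w (m + M)" by (simp add: x_def w_def)
      ultimately show "complex_of_real (cnt (m + M) * w (m + M)) = (\<Sum>\<zeta>\<in>big. g \<zeta> (int M + int m)) + b m * of_real (exp (- (t * x m)))"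
        using M[of "m + M"] by (simp add: b_def sum_distrib_right distrib_right)
    qed
    also have "\<dots> = (\<Sum>\<zeta>\<in>big. \<Sum>m. g \<zeta> (int M + int m)) + h2 t"
      unfolding h2_pos[OF t] using smg(1) smw by (subst suminf_add[symmetric]) (auto intro: summable_sum simp: suminf_sum)
    finally have tr: "complex_of_real (\<Sum>n. cnt n * w n) = (\<Sum>\<zeta>\<in>big. \<Sum>m. g \<zeta> (int M + int m)) + h2 t + h1 t" .
    have h3: "h3 t = - (\<Sum>\<zeta>\<in>big. \<Sum>m. g \<zeta> (int M - 1 - int m))"
    proof -
      have "h3 t = (\<Sum>m. - (\<Sum>\<zeta>\<in>big. g \<zeta> (int M - 1 - int m)))"
        unfolding h3_def by (intro suminf_cong) (simp add: q_def g_def y_def sum_distrib_right)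
      also have "\<dots> = - (\<Sum>m. \<Sum>\<zeta>\<in>big. g \<zeta> (int M - 1 - int m))"
        by (rule suminf_minus) (intro summable_sum smg(2))
      also have "(\<Sum>m. \<Sum>\<zeta>\<in>big. g \<zeta> (int M - 1 - int m)) = (\<Sum>\<zeta>\<in>big. \<Sum>m. g \<zeta> (int M - 1 - int m))"
        by (rule suminf_sum) (rule smg(2))
      finally show ?thesis .
    qed
    have "(\<Sum>\<zeta>\<in>big. poly_deriv (P \<zeta>) (1 / (- ln \<rho>))
               (\<lambda>s. per (- 2 * ln \<rho>) (- s * ln \<rho>) (- ln t) * of_real t powr (- s / 2)) (Ln \<zeta> / (- ln \<rho>))) =
      (\<Sum>\<zeta>\<in>big. (\<Sum>m. g \<zeta> (int M + int m)) + (\<Sum>m. g \<zeta> (int M - 1 - int m)))"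
      unfolding g_def by (intro sum.cong refl poly_deriv_split(1) t big1)
    then show "op_trace (all_edges G \<tau>h H) (heat_op G \<tau>h H \<rho> t) =
          (\<Sum>\<zeta>\<in>{\<zeta> \<in> spectrum (graph_matrix G vs). cmod \<zeta> > 1}.
             poly_deriv (P \<zeta>) (1 / (- ln \<rho>))
               (\<lambda>s. per (- 2 * ln \<rho>) (- s * ln \<rho>) (- ln t) * of_real t powr (- s / 2))
               (Ln \<zeta> / (- ln \<rho>))) + h t"
      unfolding Sp_def[symmetric] big_def[symmetric] heat_trace(2)[OF t]
      using tr h3 by (simp add: w_def h_def sum.distrib)
  qed
qed

end

theorem theorem3p6:
  fixes G :: "('v, 'e) pre_digraph" and vs :: "'v list" and l :: 'e and \<tau>h :: "'e \<Rightarrow> 'e"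
    and H :: "('e \<times> 'e) set" and \<rho> :: real and R L :: "'v \<Rightarrow> real"
    and P :: "complex \<Rightarrow> complex poly"
  assumes graph: "fin_digraph G"
    and enum: "distinct vs" "set vs = verts G"
    and primitive: "primitive_mat (graph_matrix G vs)"
    and loop: "l \<in> arcs G" "tail G l = head G l"
    and cont: "is_continuation G l \<tau>h"
    and horiz: "H \<subseteq> horizontal_pairs G" "sym H"
    and rho: "0 < \<rho>" "\<rho> < 1"
    and PF: "PF_eigenvectors G vs R L"
    and polys: "counting_polys G vs \<tau>h H P"
    and no_unit: "\<forall>\<mu>. eigenvalue (graph_matrix G vs :: complex mat) \<mu> \<longrightarrow> cmod \<mu> \<noteq> 1"
  shows "(\<forall>t>0. finite_trace (all_edges G \<tau>h H) (heat_op G \<tau>h H \<rho> t)) \<and>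
    (\<exists>h. remainder_regular (graph_matrix G vs) P \<rho> h \<and>
       (\<forall>t>0. op_trace (all_edges G \<tau>h H) (heat_op G \<tau>h H \<rho> t) =
          (\<Sum>\<mu>\<in>{\<mu> \<in> spectrum (graph_matrix G vs). cmod \<mu> > 1}.
             poly_deriv (P \<mu>) (1 / (- ln \<rho>))
               (\<lambda>s. per (- 2 * ln \<rho>) (- s * ln \<rho>) (- ln t) * of_real t powr (- s / 2))
               (Ln \<mu> / (- ln \<rho>))) + h t)) \<and>
    (let s0 = ln (lambda_PF G vs) / (- ln \<rho>);
         g = (\<lambda>t. of_real (C1 G vs R L H)
                  * per (- 2 * ln \<rho>) (of_real (ln (lambda_PF G vs))) (- ln t)
                  * of_real (t powr (- s0 / 2)))
     in (\<lambda>t. op_trace (all_edges G \<tau>h H) (heat_op G \<tau>h H \<rho> t) - g t) \<in> o[at_right 0](g) \<and>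
        (H \<noteq> {} \<longrightarrow> spectral_dim G \<tau>h H \<rho> = ereal s0))"
proof -
  interpret fin_digraph G by (rule graph)
  interpret path_space_triple G \<tau>h H vs R L \<rho>
    by unfold_locales
      (use horiz enum primitive PF rho lambda_PF_gt_1[OF graph enum loop PF no_unit] in auto)
  have s0: "ln (lambda_PF G vs) / (- ln \<rho>) = s0" by (simp add: s0_def \<kappa>_def)
  show ?thesis
    unfolding Let_def s0
    using heat_trace(1) heat_trace_expansion[OF polys no_unit] heat_trace_equivalent spectral_dim_eq by blast
qed

end
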